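(* Let $n\ge 2$ and let $a>0$ be a constant. There are no complete maximal hypersurfaces $\psi:M\to\overline M$ ($M$ nonempty and connected) bounded away from future infinity in the $(n+1)$-dimensional Robertson-Walker Radiation Model spacetime $\overline M=\mathbb{R}^+\times_{(2at)^{1/2}}\mathbb{R}^n$.
   Context: For an open interval $I\subseteq\mathbb{R}$ and a smooth function $f:I\to(0,\infty)$, $I\times_f\mathbb{R}^n$ denotes the product manifold $I\times\mathbb{R}^n$ with the Lorentzian metric $\bar g=-dt^2+f(t)^2 g_{\mathbb{R}^n}$, where $g_{\mathbb{R}^n}$ is the Euclidean metric, time-oriented by $\partial_t$. The Radiation Model is the case $I=\mathbb{R}^+=(0,\infty)$, $f(t)=(2at)^{1/2}$. A spacelike hypersurface is an immersion $\psi:M\to\overline M$ of an $n$-dimensional manifold $M$ such that the induced metric $g_M=\psi^*\bar g$ is Riemannian; it is complete if $(M,g_M)$ is complete. Put $\tau:=\pi_I\circ\psi$, with $\pi_I$ the projection onto $I$. The hypersurface is bounded away from future infinity if $\sup_M\tau<\infty$. Let $N$ be the unit timelike normal vector field along $\psi$ with the same time-orientation as $\partial_t$, $AX=-\overline\nabla_X N$ the shape operator ($\overline\nabla$ the Levi-Civita connection of $\bar g$), and $H=-\frac1n\mathrm{trace}(A)$ the mean curvature. The hypersurface is maximal if $H\equiv 0$. *)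

theory Defs
  imports "HOL-Analysis.Analysis"
begin

section \<open>Smooth manifolds\<close>

text \<open>Intended for open \<open>S\<close> in a finite-dimensional domain: all iterated directional derivatives
  up to order \<open>k\<close> exist and are continuous.\<close>

primrec Ck_on :: "nat \<Rightarrow> ('a::real_normed_vector \<Rightarrow> 'b::real_normed_vector) \<Rightarrow> 'a set \<Rightarrow> bool" where
  "Ck_on 0 f S \<longleftrightarrow> continuous_on S f"
| "Ck_on (Suc k) f S \<longleftrightarrow>
     f differentiable_on S \<and> (\<forall>v. Ck_on k (\<lambda>x. frechet_derivative f (at x) v) S)"

definition smooth_on :: "('a::real_normed_vector \<Rightarrow> 'b::real_normed_vector) \<Rightarrow> 'a set \<Rightarrow> bool" where
  "smooth_on f S \<longleftrightarrow> (\<forall>k. Ck_on k f S)"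

text \<open>A chart is a pair of its domain and its coordinate map; the values of the coordinate map
  outside the domain are irrelevant.\<close>

type_synonym ('m, 'n) chart = "'m set \<times> ('m \<Rightarrow> real ^ 'n)"

definition coords :: "('m, 'n) chart \<Rightarrow> (real ^ 'n) set" where
  "coords c = snd c ` fst c"

definition param :: "('m, 'n) chart \<Rightarrow> real ^ 'n \<Rightarrow> 'm" where
  "param c = inv_into (fst c) (snd c)"

definition is_chart :: "'m topology \<Rightarrow> ('m, 'n::finite) chart \<Rightarrow> bool" where
  "is_chart X c \<longleftrightarrow> openin X (fst c) \<and> open (coords c) \<and>
     homeomorphic_map (subtopology X (fst c)) (top_of_set (coords c)) (snd c)"

text \<open>The atlas is not required to be maximal.\<close>

definition smooth_manifold :: "'m topology \<Rightarrow> ('m, 'n::finite) chart set \<Rightarrow> bool" where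
  "smooth_manifold X A \<longleftrightarrow>
     Hausdorff_space X \<and> second_countable X \<and>
     (\<forall>c\<in>A. is_chart X c) \<and> (\<Union>c\<in>A. fst c) = topspace X \<and>
     (\<forall>c\<in>A. \<forall>d\<in>A. smooth_on (snd d \<circ> param c) (snd c ` (fst c \<inter> fst d)))"

definition chart_at :: "('m, 'n) chart set \<Rightarrow> 'm \<Rightarrow> ('m, 'n) chart" where
  "chart_at A p = (SOME c. c \<in> A \<and> p \<in> fst c)"

section \<open>Length, distance and completeness\<close>

text \<open>A metric on the manifold is given by its coordinate expressions: \<open>g c x u v\<close> is the value, in
  the chart \<open>c\<close> at the coordinate point \<open>x\<close>, on tangent vectors with components \<open>u\<close> and \<open>v\<close>.\<close>

type_synonym ('m, 'n) chart_metric =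
  "('m, 'n) chart \<Rightarrow> real ^ 'n \<Rightarrow> real ^ 'n \<Rightarrow> real ^ 'n \<Rightarrow> real"

definition C1_curve_on ::
  "('m, 'n::finite) chart set \<Rightarrow> real \<Rightarrow> real \<Rightarrow> (real \<Rightarrow> 'm) \<Rightarrow> bool" where
  "C1_curve_on A a b \<gamma> \<longleftrightarrow>
     (\<forall>c\<in>A. \<exists>d. continuous_on {s \<in> {a..b}. \<gamma> s \<in> fst c} d \<and>
        (\<forall>s\<in>{a..b}. \<gamma> s \<in> fst c \<longrightarrow>
           ((snd c \<circ> \<gamma>) has_vector_derivative d s) (at s within {a..b})))"

text \<open>The library's \<open>piecewise_C1_differentiable_on\<close> does not demand one-sided derivatives at the
  break points, so it admits curves whose speed is not integrable. Hence the explicit partition.\<close>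

definition piecewise_C1_curve ::
  "'m topology \<Rightarrow> ('m, 'n::finite) chart set \<Rightarrow> (real \<Rightarrow> 'm) \<Rightarrow> bool" where
  "piecewise_C1_curve X A \<gamma> \<longleftrightarrow> pathin X \<gamma> \<and>
     (\<exists>K. finite K \<and> {0, 1} \<subseteq> K \<and> K \<subseteq> {0..1} \<and>
        (\<forall>a\<in>K. \<forall>b\<in>K. a < b \<and> K \<inter> {a<..<b} = {} \<longrightarrow> C1_curve_on A a b \<gamma>))"

definition curve_speed ::
  "('m, 'n::finite) chart set \<Rightarrow> ('m, 'n) chart_metric \<Rightarrow> (real \<Rightarrow> 'm) \<Rightarrow> real \<Rightarrow> real" where
  "curve_speed A g \<gamma> s =
     (let c = chart_at A (\<gamma> s); v = vector_derivative (snd c \<circ> \<gamma>) (at s)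
      in sqrt (g c (snd c (\<gamma> s)) v v))"

definition curve_length ::
  "('m, 'n::finite) chart set \<Rightarrow> ('m, 'n) chart_metric \<Rightarrow> (real \<Rightarrow> 'm) \<Rightarrow> real" where
  "curve_length A g \<gamma> = integral {0..1} (curve_speed A g \<gamma>)"

definition riemannian_dist ::
  "'m topology \<Rightarrow> ('m, 'n::finite) chart set \<Rightarrow> ('m, 'n) chart_metric \<Rightarrow> 'm \<Rightarrow> 'm \<Rightarrow> real" where
  "riemannian_dist X A g p q =
     Inf (curve_length A g ` {\<gamma>. piecewise_C1_curve X A \<gamma> \<and> \<gamma> 0 = p \<and> \<gamma> 1 = q})"

text \<open>The condition of \<open>Metric_space.mcomplete\<close>, written out for the Riemannian distance of a
  connected manifold.\<close>

definition riemannian_complete ::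
  "'m topology \<Rightarrow> ('m, 'n::finite) chart set \<Rightarrow> ('m, 'n) chart_metric \<Rightarrow> bool" where
  "riemannian_complete X A g \<longleftrightarrow>
     (\<forall>\<sigma> :: nat \<Rightarrow> 'm. range \<sigma> \<subseteq> topspace X \<longrightarrow>
        (\<forall>\<epsilon>>0. \<exists>N. \<forall>i\<ge>N. \<forall>j\<ge>N. riemannian_dist X A g (\<sigma> i) (\<sigma> j) < \<epsilon>) \<longrightarrow>
        (\<exists>p\<in>topspace X. (\<lambda>i. riemannian_dist X A g (\<sigma> i) p) \<longlonglongrightarrow> 0))"

section \<open>Robertson--Walker spacetimes and their Levi-Civita connection\<close>

text \<open>The ambient manifold \<open>I \<times> R^n\<close> is an open subset of a vector space, whose global
  coordinates are used for it throughout.\<close>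

definition rw_metric ::
  "(real \<Rightarrow> real) \<Rightarrow> real \<times> 'e::euclidean_space \<Rightarrow> real \<times> 'e \<Rightarrow> real \<times> 'e \<Rightarrow> real" where
  "rw_metric f p u v = - (fst u * fst v) + (f (fst p))\<^sup>2 * (snd u \<bullet> snd v)"

text \<open>The covariant derivative at \<open>p\<close>, in direction \<open>u\<close>, of the constant vector field \<open>v\<close>: the
  Koszul formula for constant fields, whose Lie brackets vanish.\<close>

definition christoffel :: "('e::euclidean_space \<Rightarrow> 'e \<Rightarrow> 'e \<Rightarrow> real) \<Rightarrow> 'e \<Rightarrow> 'e \<Rightarrow> 'e \<Rightarrow> 'e" where
  "christoffel g p u v = (THE z. \<forall>w. 2 * g p z w =
       frechet_derivative (\<lambda>q. g q v w) (at p) u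
     + frechet_derivative (\<lambda>q. g q u w) (at p) v
     - frechet_derivative (\<lambda>q. g q u v) (at p) w)"

text \<open>The covariant derivative, in direction \<open>u\<close>, of a vector field \<open>V\<close> along a map \<open>F\<close>.\<close>

definition cov_deriv_along ::
  "('e::euclidean_space \<Rightarrow> 'e \<Rightarrow> 'e \<Rightarrow> real) \<Rightarrow> ('d::euclidean_space \<Rightarrow> 'e) \<Rightarrow> ('d \<Rightarrow> 'e) \<Rightarrow> 'd \<Rightarrow> 'd \<Rightarrow> 'e"
  where
  "cov_deriv_along g F V x u =
     frechet_derivative V (at x) u
     + christoffel g (F x) (frechet_derivative F (at x) u) (V x)"

section \<open>Spacelike hypersurfaces\<close>

definition immersion ::
  "('m, 'n::finite) chart set \<Rightarrow> ('m \<Rightarrow> 'e::euclidean_space) \<Rightarrow> bool" where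
  "immersion A \<psi> \<longleftrightarrow>
     (\<forall>c\<in>A. smooth_on (\<psi> \<circ> param c) (coords c) \<and>
        (\<forall>x\<in>coords c. inj (frechet_derivative (\<psi> \<circ> param c) (at x))))"

definition induced_metric ::
  "('e::euclidean_space \<Rightarrow> 'e \<Rightarrow> 'e \<Rightarrow> real) \<Rightarrow> ('m \<Rightarrow> 'e) \<Rightarrow> ('m, 'n::finite) chart_metric" where
  "induced_metric g \<psi> c x u v =
     g (\<psi> (param c x))
       (frechet_derivative (\<psi> \<circ> param c) (at x) u)
       (frechet_derivative (\<psi> \<circ> param c) (at x) v)"

definition riemannian_metric ::
  "('m, 'n::finite) chart set \<Rightarrow> ('m, 'n) chart_metric \<Rightarrow> bool" where
  "riemannian_metric A g \<longleftrightarrow>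
     (\<forall>c\<in>A. (\<forall>u v. smooth_on (\<lambda>x. g c x u v) (coords c)) \<and>
        (\<forall>x\<in>coords c. bilinear (g c x) \<and> (\<forall>u v. g c x u v = g c x v u) \<and>
           (\<forall>u. u \<noteq> 0 \<longrightarrow> g c x u u > 0)))"

definition spacelike_hypersurface ::
  "real set \<Rightarrow> (real \<Rightarrow> real) \<Rightarrow> 'm topology \<Rightarrow> ('m, 'n::finite) chart set
    \<Rightarrow> ('m \<Rightarrow> real \<times> (real ^ 'n)) \<Rightarrow> bool" where
  "spacelike_hypersurface I f X A \<psi> \<longleftrightarrow>
     smooth_manifold X A \<and> \<psi> ` topspace X \<subseteq> I \<times> UNIV \<and> immersion A \<psi> \<and>
     riemannian_metric A (induced_metric (rw_metric f) \<psi>)"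

text \<open>The unit normal has the time-orientation of \<open>(1, 0)\<close>, the field \<open>\<partial>\<^sub>t\<close>: for timelike vectors
  in signature \<open>(-,+,\<dots>,+)\<close> this means that their product is negative.\<close>

definition unit_normal ::
  "(real \<Rightarrow> real) \<Rightarrow> ('m \<Rightarrow> real \<times> (real ^ 'n)) \<Rightarrow> ('m, 'n::finite) chart
    \<Rightarrow> real ^ 'n \<Rightarrow> real \<times> (real ^ 'n)" where
  "unit_normal f \<psi> c x = (THE N.
     rw_metric f (\<psi> (param c x)) N N = -1 \<and>
     (\<forall>u. rw_metric f (\<psi> (param c x)) N (frechet_derivative (\<psi> \<circ> param c) (at x) u) = 0) \<and>
     rw_metric f (\<psi> (param c x)) N (1, 0) < 0)"

text \<open>The tangent vector \<open>AX\<close> of the hypersurface with \<open>d\<psi>(AX)\<close> equal to minus the derivative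
  of the unit normal, in components with respect to the chart \<open>c\<close>.\<close>

definition shape_operator ::
  "(real \<Rightarrow> real) \<Rightarrow> ('m \<Rightarrow> real \<times> (real ^ 'n)) \<Rightarrow> ('m, 'n::finite) chart
    \<Rightarrow> real ^ 'n \<Rightarrow> real ^ 'n \<Rightarrow> real ^ 'n" where
  "shape_operator f \<psi> c x u = (THE w.
     frechet_derivative (\<psi> \<circ> param c) (at x) w =
     - cov_deriv_along (rw_metric f) (\<psi> \<circ> param c) (unit_normal f \<psi> c) x u)"

definition mean_curvature ::
  "(real \<Rightarrow> real) \<Rightarrow> ('m \<Rightarrow> real \<times> (real ^ 'n)) \<Rightarrow> ('m, 'n::finite) chart \<Rightarrow> real ^ 'n \<Rightarrow> real" where
  "mean_curvature f \<psi> c x = - (1 / real CARD('n)) * trace (matrix (shape_operator f \<psi> c x))"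

definition maximal_hypersurface ::
  "real set \<Rightarrow> (real \<Rightarrow> real) \<Rightarrow> 'm topology \<Rightarrow> ('m, 'n::finite) chart set
    \<Rightarrow> ('m \<Rightarrow> real \<times> (real ^ 'n)) \<Rightarrow> bool" where
  "maximal_hypersurface I f X A \<psi> \<longleftrightarrow>
     spacelike_hypersurface I f X A \<psi> \<and> (\<forall>c\<in>A. \<forall>x\<in>coords c. mean_curvature f \<psi> c x = 0)"

definition complete_hypersurface ::
  "(real \<Rightarrow> real) \<Rightarrow> 'm topology \<Rightarrow> ('m, 'n::finite) chart set
    \<Rightarrow> ('m \<Rightarrow> real \<times> (real ^ 'n)) \<Rightarrow> bool" where
  "complete_hypersurface f X A \<psi> \<longleftrightarrow>
     riemannian_complete X A (induced_metric (rw_metric f) \<psi>)"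

definition bounded_away_from_future_infinity ::
  "'m topology \<Rightarrow> ('m \<Rightarrow> real \<times> 'e) \<Rightarrow> bool" where
  "bounded_away_from_future_infinity X \<psi> \<longleftrightarrow> bdd_above ((fst \<circ> \<psi>) ` topspace X)"

end

theory Submission
  imports Defs
begin

text \<open>The projection \<open>\<pi>\<close> of the hypersurface to \<open>R^n\<close> is a local diffeomorphism, and the induced
  metric is at most \<open>2 a T\<close> times the pullback of the Euclidean one, where \<open>T\<close> bounds the time.
  Completeness therefore lets local sections of \<open>\<pi>\<close> extend to arbitrarily large balls, over which the
  hypersurface is a graph. The spacetime is conformal to half of Minkowski space, and a
  hyperboloid with a distant centre touches this graph from one side at an interior point. There the
  Hessian comparison makes a multiple of the shape operator positive definite with respect to the
  induced metric, so its trace, and hence the mean curvature, does not vanish.\<close>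

section \<open>Sections of local homeomorphisms\<close>

text \<open>In conformal time \<open>\<eta> = sqrt (2 t / a)\<close> the metric reads
  \<open>a^2 \<eta>^2 (- d\<eta>^2 + dx^2)\<close>. Hyperboloids are umbilic in Minkowski space, and
  umbilicity survives the conformal change, so their second fundamental form stays a multiple of the
  induced metric. The multiple has the favourable sign exactly where the conformal time
  \<open>c\<close> of the centre exceeds \<open>2 \<eta>\<close>. The bound on the time therefore
  acts twice: it controls the lengths of lifted segments, and it allows one distant centre to serve
  for all points.

  The hypersurface is not compact, so a touching point has to be produced, and it is not known in
  advance to be a graph. A section over a single large ball is enough: over its centre the barrier
  is bounded independently of the radius \<open>R\<close>, while over the bounding sphere it is at
  least \<open>a / 2 * R^2\<close>, so the minimum is interior. From there the second-derivative
  test along coordinate lines suffices, with the trace evaluated in a frame orthonormal for the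
  induced metric.\<close>

definition is_section :: "'m topology \<Rightarrow> ('m \<Rightarrow> 'e::topological_space) \<Rightarrow> 'e set \<Rightarrow> ('e \<Rightarrow> 'm) \<Rightarrow> bool" where
  "is_section X \<pi> S s \<longleftrightarrow> continuous_map (top_of_set S) X s \<and> (\<forall>x\<in>S. \<pi> (s x) = x)"

lemma is_section_subset: "is_section X \<pi> S s \<Longrightarrow> T \<subseteq> S \<Longrightarrow> is_section X \<pi> T s"
  unfolding is_section_def by (auto intro: continuous_map_from_subtopology_mono)

lemma is_section_in_topspace: "is_section X \<pi> S s \<Longrightarrow> x \<in> S \<Longrightarrow> s x \<in> topspace X"
  unfolding is_section_def continuous_map_def by auto

locale locally_injective =
  fixes X :: "'m topology" and \<pi> :: "'m \<Rightarrow> 'e::euclidean_space"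
  assumes Hausdorff: "Hausdorff_space X"
    and locally_inj: "\<And>p. p \<in> topspace X \<Longrightarrow> \<exists>U. openin X U \<and> p \<in> U \<and> inj_on \<pi> U"
begin

text \<open>The set of agreement is closed because \<open>X\<close> is Hausdorff, and open because
  near a common value both sections stay in a set on which \<open>\<pi>\<close> is
  injective.\<close>

lemma section_unique:
  assumes s: "is_section X \<pi> S s" and t: "is_section X \<pi> S t" and "connected S"
    and "z \<in> S" "s z = t z" "x \<in> S"
  shows "s x = t x"
proof -
  let ?E = "{x \<in> S. s x = t x}"
  have s': "continuous_map (top_of_set S) X s" and t': "continuous_map (top_of_set S) X t"
    using s t by (auto simp: is_section_def)
  have "closedin (top_of_set S) ?E"
    using closedin_continuous_maps_eq[OF Hausdorff s' t'] by simp
  moreover have "openin (top_of_set S) ?E"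
  proof (subst openin_subopen, safe)
    fix x assume x: "x \<in> S" "s x = t x"
    obtain U where U: "openin X U" "s x \<in> U" "inj_on \<pi> U"
      using locally_inj is_section_in_topspace[OF s x(1)] by blast
    let ?V = "{y \<in> S. s y \<in> U} \<inter> {y \<in> S. t y \<in> U}"
    have "openin (top_of_set S) ?V"
      using openin_continuous_map_preimage[OF s' U(1)] openin_continuous_map_preimage[OF t' U(1)]
      by auto
    moreover have "?V \<subseteq> ?E"
      using s t U(3) by (auto simp: is_section_def inj_on_def)
    ultimately show "\<exists>T. openin (top_of_set S) T \<and> x \<in> T \<and> T \<subseteq> ?E"
      using x U by auto
  qed
  ultimately have "?E = {} \<or> ?E = S"
    using \<open>connected S\<close> connected_clopen by blast
  with assms show ?thesis by blast
qed

lemma section_glue: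
  assumes sec: "\<And>i. i \<in> I \<Longrightarrow> is_section X \<pi> (S i) (s i)" and op: "\<And>i. i \<in> I \<Longrightarrow> open (S i)"
    and eq: "\<And>i j x. i \<in> I \<Longrightarrow> j \<in> I \<Longrightarrow> x \<in> S i \<inter> S j \<Longrightarrow> s i x = s j x"
  obtains t where "is_section X \<pi> (\<Union>i\<in>I. S i) t" "\<And>i x. i \<in> I \<Longrightarrow> x \<in> S i \<Longrightarrow> t x = s i x"
proof -
  let ?W = "\<Union>i\<in>I. S i"
  have "\<exists>g. continuous_map (top_of_set ?W) X g \<and>
      (\<forall>x i. i \<in> I \<longrightarrow> x \<in> topspace (top_of_set ?W) \<inter> S i \<longrightarrow> g x = s i x)"
  proof (rule pasting_lemma_exists[where I = I and T = S and f = s])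
    show "continuous_map (subtopology (top_of_set ?W) (S i)) X (s i)" if "i \<in> I" for i
    proof -
      have "?W \<inter> S i = S i" using that by auto
      then show ?thesis using sec[OF that] by (simp add: is_section_def subtopology_subtopology)
    qed
    show "openin (top_of_set ?W) (S i)" if "i \<in> I" for i
      using op[OF that] that by (auto simp: openin_open)
    show "s i x = s j x" if "i \<in> I" "j \<in> I" "x \<in> topspace (top_of_set ?W) \<inter> S i \<inter> S j" for i j x
      using that by (intro eq) auto
  qed auto
  then obtain g where g: "continuous_map (top_of_set ?W) X g"
      "\<And>x i. i \<in> I \<Longrightarrow> x \<in> S i \<Longrightarrow> g x = s i x" by auto
  have "is_section X \<pi> ?W g"
    using g sec unfolding is_section_def by force
  then show ?thesis using g that by blast
qed

end

text \<open>\<open>section_limit\<close> is the form in which completeness enters: the limit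
  \<open>l\<close> may lie on the bounding sphere, where \<open>s\<close> is not yet defined, and
  still the lifted points converge.\<close>

locale complete_local_homeo = locally_injective +
  assumes continuous_proj: "continuous_map X euclidean \<pi>"
    and local_section: "\<And>p. p \<in> topspace X \<Longrightarrow> \<exists>\<rho>>0. \<exists>s. is_section X \<pi> (ball (\<pi> p) \<rho>) s \<and> s (\<pi> p) = p"
    and section_limit: "\<And>x r s u l. is_section X \<pi> (ball x r) s \<Longrightarrow> range u \<subseteq> ball x r \<Longrightarrow> u \<longlonglongrightarrow> l
        \<Longrightarrow> \<exists>p. limitin X (s \<circ> u) p sequentially"
begin

text \<open>Lifting a sequence that tends to \<open>z\<close> yields a limit \<open>p\<close> over
  \<open>z\<close>. The local section through \<open>p\<close> and \<open>s\<close> both take late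
  members of the sequence into a set where \<open>\<pi>\<close> is injective, so they agree at one
  point; the overlap of the two balls is convex, so they agree on all of it.\<close>

lemma section_at_boundary:
  assumes s: "is_section X \<pi> (ball x r) s" and "r > 0" and z: "z \<in> cball x r"
  obtains \<rho> \<sigma> where "\<rho> > 0" "is_section X \<pi> (ball z \<rho>) \<sigma>"
    "\<And>y. y \<in> ball x r \<inter> ball z \<rho> \<Longrightarrow> \<sigma> y = s y"
proof -
  have "z \<in> closure (ball x r)" using assms by simp
  then obtain u where u: "\<And>i. u i \<in> ball x r" "u \<longlonglongrightarrow> z"
    unfolding closure_sequential by blast
  then obtain p where p: "limitin X (s \<circ> u) p sequentially"
    using section_limit[OF s] by blast
  then have pX: "p \<in> topspace X" by (rule limitin_topspace)
  have "(\<lambda>i. \<pi> (s (u i))) \<longlonglongrightarrow> \<pi> p"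
    using continuous_map_limit[OF continuous_proj p] by (simp add: comp_def)
  moreover have "\<pi> (s (u i)) = u i" for i
    using s u by (simp add: is_section_def)
  ultimately have "\<pi> p = z" using u LIMSEQ_unique by auto
  obtain \<rho> \<sigma> where \<sigma>: "\<rho> > 0" "is_section X \<pi> (ball z \<rho>) \<sigma>" "\<sigma> z = p"
    using local_section[OF pX] \<open>\<pi> p = z\<close> by auto
  obtain U where U: "openin X U" "p \<in> U" "inj_on \<pi> U"
    using locally_inj[OF pX] by blast
  have "\<forall>\<^sub>F i in sequentially. dist (u i) z < \<rho>"
    using u \<sigma> by (simp add: tendstoD)
  moreover have "\<forall>\<^sub>F i in sequentially. s (u i) \<in> U"
    using p U by (auto simp: limitin_def)
  moreover have "\<forall>\<^sub>F i in sequentially. u i \<in> {y \<in> ball z \<rho>. \<sigma> y \<in> U}"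
  proof -
    have "openin (top_of_set (ball z \<rho>)) {y \<in> ball z \<rho>. \<sigma> y \<in> U}"
      using openin_continuous_map_preimage[of "top_of_set (ball z \<rho>)" X \<sigma> U] \<sigma> U
      by (auto simp: is_section_def)
    then have "open {y \<in> ball z \<rho>. \<sigma> y \<in> U}"
      using openin_open_eq by blast
    then show ?thesis
      by (rule topological_tendstoD[OF u(2)]) (use \<sigma> U in auto)
  qed
  ultimately have "\<forall>\<^sub>F i in sequentially. u i \<in> ball z \<rho> \<and> s (u i) \<in> U \<and> \<sigma> (u i) \<in> U"
    by eventually_elim auto
  then obtain i where i: "u i \<in> ball z \<rho>" "s (u i) \<in> U" "\<sigma> (u i) \<in> U"
    using eventually_happens by force
  have "\<pi> (s (u i)) = u i" "\<pi> (\<sigma> (u i)) = u i"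
    using s \<sigma> u i by (auto simp: is_section_def)
  then have "\<sigma> (u i) = s (u i)" using i U by (metis inj_onD)
  then have "\<sigma> y = s y" if "y \<in> ball x r \<inter> ball z \<rho>" for y
    using that u(1)[of i] i
    by (intro section_unique[of "ball x r \<inter> ball z \<rho>" \<sigma> s "u i" y])
      (auto intro: is_section_subset[OF s] is_section_subset[OF \<sigma>(2)] convex_connected convex_Int)
  then show ?thesis using that \<sigma> by blast
qed

lemma section_extend:
  assumes s: "is_section X \<pi> (ball x r) s" and "r > 0"
  obtains r' t where "r' > r" "is_section X \<pi> (ball x r') t" "t x = s x"
proof -
  define good where "good z \<rho> \<sigma> \<longleftrightarrow> \<rho> > 0 \<and> is_section X \<pi> (ball z \<rho>) \<sigma> \<and>
      (\<forall>y \<in> ball x r \<inter> ball z \<rho>. \<sigma> y = s y)" for z \<rho> \<sigma>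
  have "\<exists>\<rho> \<sigma>. good z \<rho> \<sigma>" if "z \<in> cball x r" for z
    using section_at_boundary[OF s \<open>r > 0\<close> that] unfolding good_def by metis
  then obtain \<rho> \<sigma> where good: "\<And>z. z \<in> cball x r \<Longrightarrow> good z (\<rho> z) (\<sigma> z)"
    by metis
  have agree: "\<sigma> z y = \<sigma> w y" if z: "z \<in> cball x r" and w: "w \<in> cball x r"
      and y: "y \<in> ball z (\<rho> z) \<inter> ball w (\<rho> w)" for z w y
  proof -
    \<comment> \<open>Nearest-point projection to \<open>cball x r\<close> is 1-Lipschitz and fixes
      the centres, so it maps each of the two small balls into itself. Hence their overlap meets the
      closed ball and, being open, the open ball, where both sections equal
      \<open>s\<close>.\<close>
    let ?B = "ball z (\<rho> z) \<inter> ball w (\<rho> w)" and ?q = "closest_point (cball x r) y"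
    have near: "?q \<in> ball v (\<rho> v)" if "v \<in> cball x r" "y \<in> ball v (\<rho> v)" for v
    proof -
      have "dist (closest_point (cball x r) v) ?q \<le> dist v y"
        using \<open>r > 0\<close> by (intro closest_point_lipschitz) auto
      then show ?thesis using that by (simp add: closest_point_self)
    qed
    have "?q \<in> cball x r" using \<open>r > 0\<close> by (intro closest_point_in_set) auto
    then have "?B \<inter> closure (ball x r) \<noteq> {}"
      using near[OF z] near[OF w] y \<open>r > 0\<close> by auto
    then have "?B \<inter> ball x r \<noteq> {}"
      using open_Int_closure_eq_empty[of ?B "ball x r"] by blast
    then obtain v where "v \<in> ?B \<inter> ball x r" by blast
    then show ?thesis
      using good[OF z] good[OF w] y
      by (intro section_unique[of ?B "\<sigma> z" "\<sigma> w" v y])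
        (auto simp: good_def intro: is_section_subset convex_connected convex_Int)
  qed
  obtain t where t: "is_section X \<pi> (\<Union>z\<in>cball x r. ball z (\<rho> z)) t"
      and ts: "\<And>z y. z \<in> cball x r \<Longrightarrow> y \<in> ball z (\<rho> z) \<Longrightarrow> t y = \<sigma> z y"
  proof (rule section_glue[of "cball x r" "\<lambda>z. ball z (\<rho> z)" \<sigma>])
    show "is_section X \<pi> (ball z (\<rho> z)) (\<sigma> z)" if "z \<in> cball x r" for z
      using good[OF that] by (simp add: good_def)
  qed (use agree in \<open>blast intro: open_ball\<close>)+
  have "cball x r \<subseteq> (\<Union>z\<in>cball x r. ball z (\<rho> z))"
    using good unfolding good_def by force
  then obtain \<epsilon> where \<epsilon>: "\<epsilon> > 0" "(\<Union>z\<in>cball x r. ball z \<epsilon>) \<subseteq> (\<Union>z\<in>cball x r. ball z (\<rho> z))"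
    using compact_subset_open_imp_ball_epsilon_subset[OF compact_cball, of "\<Union>z\<in>cball x r. ball z (\<rho> z)" x r]
    by blast
  have "ball x (r + \<epsilon>) \<subseteq> (\<Union>z\<in>cball x r. ball z \<epsilon>)"
  proof
    fix y assume y: "y \<in> ball x (r + \<epsilon>)"
    show "y \<in> (\<Union>z\<in>cball x r. ball z \<epsilon>)"
    proof (cases "dist x y \<le> r")
      case True then show ?thesis using \<epsilon> by force
    next
      case False
      \<comment> \<open>\<open>?z\<close> is the radial projection of \<open>y\<close> to the sphere
        of radius \<open>r\<close>, which lies closer than \<open>\<epsilon>\<close> to
        \<open>y\<close>.\<close>
      let ?k = "r / dist x y" let ?z = "x + ?k *\<^sub>R (y - x)"
      have k: "0 \<le> ?k" "?k \<le> 1" "dist x y > 0" using False \<open>r > 0\<close> by (auto simp: divide_le_eq)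
      have "dist x ?z = r"
        using k \<open>r > 0\<close> by (simp add: dist_norm norm_minus_commute)
      moreover have "?z - y = (?k - 1) *\<^sub>R (y - x)" by (simp add: algebra_simps)
      then have "dist ?z y = (1 - ?k) * dist x y"
        using k by (simp add: dist_norm norm_minus_commute)
      then have "dist ?z y < \<epsilon>" using k y by (simp add: field_simps)
      ultimately show ?thesis by (auto intro!: bexI[of _ ?z])
    qed
  qed
  then have "is_section X \<pi> (ball x (r + \<epsilon>)) t"
    using is_section_subset[OF t order.trans[OF _ \<epsilon>(2)]] by simp
  moreover have "t x = s x"
    using ts[of x x] good[of x] \<open>r > 0\<close> unfolding good_def by auto
  ultimately show ?thesis using that[of "r + \<epsilon>" t] \<epsilon> by simp
qed

text \<open>If the possible radii were bounded, the sections on the smaller balls, which agree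
  because all of them pass through \<open>p\<close>, would glue to one on the ball of supremal
  radius, and \<open>section_extend\<close> would enlarge that ball.\<close>

theorem section_on_ball:
  assumes p: "p \<in> topspace X"
  obtains s where "is_section X \<pi> (ball (\<pi> p) R) s" "s (\<pi> p) = p"
proof -
  define P where "P r \<longleftrightarrow> r > 0 \<and> (\<exists>s. is_section X \<pi> (ball (\<pi> p) r) s \<and> s (\<pi> p) = p)" for r
  have "\<exists>r. P r \<and> R \<le> r"
  proof (rule ccontr)
    assume "\<not> ?thesis"
    then have "r \<le> R" if "P r" for r using that by (meson linear)
    then have bdd: "bdd_above (Collect P)" by (intro bdd_aboveI[of _ R]) simp
    obtain s where s: "\<And>r. P r \<Longrightarrow> is_section X \<pi> (ball (\<pi> p) r) (s r) \<and> s r (\<pi> p) = p"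
    proof -
      have "\<forall>r. \<exists>s. P r \<longrightarrow> is_section X \<pi> (ball (\<pi> p) r) s \<and> s (\<pi> p) = p"
        unfolding P_def by auto
      from choice[OF this] show ?thesis using that by auto
    qed
    have agree: "s i x = s j x" if "P i" "P j" "x \<in> ball (\<pi> p) i \<inter> ball (\<pi> p) j" for i j x
      using that s[of i] s[of j]
      by (intro section_unique[of "ball (\<pi> p) i \<inter> ball (\<pi> p) j" "s i" "s j" "\<pi> p" x])
        (auto simp: P_def intro: is_section_subset convex_connected convex_Int)
    obtain t where t: "is_section X \<pi> (\<Union>r\<in>Collect P. ball (\<pi> p) r) t"
        and ts: "\<And>r x. P r \<Longrightarrow> x \<in> ball (\<pi> p) r \<Longrightarrow> t x = s r x"
    proof (rule section_glue[of "Collect P" "ball (\<pi> p)" s])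
      show "is_section X \<pi> (ball (\<pi> p) r) (s r)" if "r \<in> Collect P" for r
        using s that by simp
      show "s i x = s j x" if "i \<in> Collect P" "j \<in> Collect P" "x \<in> ball (\<pi> p) i \<inter> ball (\<pi> p) j" for i j x
        using that by (intro agree) auto
    qed auto
    let ?r = "Sup (Collect P)"
    obtain r0 where r0: "P r0" using local_section[OF p] unfolding P_def by metis
    then have "?r > 0" using cSup_upper[OF _ bdd, of r0] unfolding P_def by force
    have "ball (\<pi> p) ?r \<subseteq> (\<Union>r\<in>Collect P. ball (\<pi> p) r)"
    proof
      fix x assume "x \<in> ball (\<pi> p) ?r"
      then obtain r where "P r" "dist (\<pi> p) x < r"
        using r0 by (auto elim!: less_cSupE)
      then show "x \<in> (\<Union>r\<in>Collect P. ball (\<pi> p) r)" by auto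
    qed
    then have "is_section X \<pi> (ball (\<pi> p) ?r) t" by (rule is_section_subset[OF t])
    then obtain r' t' where "r' > ?r" "is_section X \<pi> (ball (\<pi> p) r') t'" "t' (\<pi> p) = t (\<pi> p)"
      using section_extend \<open>?r > 0\<close> by metis
    moreover have "t (\<pi> p) = p" using ts[OF r0, of "\<pi> p"] s[OF r0] r0 by (simp add: P_def)
    ultimately have "P r'" using \<open>?r > 0\<close> unfolding P_def by auto
    then show False using cSup_upper[OF _ bdd] \<open>r' > ?r\<close> by force
  qed
  then obtain r s where "R \<le> r" "is_section X \<pi> (ball (\<pi> p) r) s" "s (\<pi> p) = p"
    unfolding P_def by blast
  then show ?thesis
    using that is_section_subset[of X \<pi> _ s "ball (\<pi> p) R"] subset_ball by blast
qed

end

section \<open>Linear algebra and second derivatives\<close>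

text \<open>A negative \<open>k\<close> makes \<open>f'\<close> negative just to the right of 0, and
  \<open>f\<close> would drop below its minimum there. Only differentiability of \<open>f'\<close>
  at the single point 0 enters.\<close>

lemma local_min_second_derivative:
  fixes f f' :: "real \<Rightarrow> real"
  assumes "d > 0" and f: "\<And>x. \<bar>x\<bar> < d \<Longrightarrow> (f has_real_derivative f' x) (at x)"
    and f': "(f' has_real_derivative k) (at 0)"
    and min: "\<And>x. \<bar>x\<bar> < d \<Longrightarrow> f 0 \<le> f x"
  shows "f' 0 = 0" "k \<ge> 0"
proof -
  show 0: "f' 0 = 0"
    using DERIV_local_min[OF f \<open>d > 0\<close>] min \<open>d > 0\<close> by simp
  show "k \<ge> 0"
  proof (rule ccontr)
    assume "\<not> k \<ge> 0"
    then obtain e where e: "e > 0" "\<And>h. 0 < h \<Longrightarrow> h < e \<Longrightarrow> f' h < 0"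
      using DERIV_neg_dec_right[OF f'] 0 by auto
    define h where "h = min d e / 2"
    have h: "0 < h" "h < d" "h < e" using \<open>d > 0\<close> e by (auto simp: h_def)
    have "f h < f 0"
    proof (rule DERIV_neg_imp_decreasing_open[OF h(1)])
      fix x assume "0 < x" "x < h"
      then show "\<exists>y. (f has_real_derivative y) (at x) \<and> y < 0"
        using f[of x] e h by (intro exI[of _ "f' x"]) auto
    next
      show "continuous_on {0..h} f"
        using f h by (intro DERIV_atLeastAtMost_imp_continuous_on) force
    qed
    then show False using min[of h] h by simp
  qed
qed

lemma has_real_derivative_inner:
  fixes f g :: "real \<Rightarrow> 'e::real_inner"
  assumes "(f has_vector_derivative f') (at s)" "(g has_vector_derivative g') (at s)"
  shows "((\<lambda>s. f s \<bullet> g s) has_real_derivative f s \<bullet> g' + f' \<bullet> g s) (at s)"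
  using assms unfolding has_field_derivative_def has_vector_derivative_def
  by (auto intro!: derivative_eq_intros simp: algebra_simps)

text \<open>Invariance of the trace under change of basis; the images of the axes under
  \<open>Q\<close> form the new basis.\<close>

lemma trace_eq_sum_frame:
  fixes B Q R :: "real ^ 'n \<Rightarrow> real ^ 'n"
  assumes B: "linear B" and Q: "linear Q" and R: "linear R" and "\<And>x. Q (R x) = x"
  shows "trace (matrix B) = (\<Sum>i\<in>UNIV. R (B (Q (axis i 1))) $ i)"
proof -
  have "matrix Q ** matrix R = mat 1"
    using assms by (simp add: matrix_compose[symmetric] comp_def matrix_id_mat_1[unfolded id_def])
  then have "matrix B = matrix Q ** (matrix R ** matrix B)"
    by (simp add: matrix_mul_assoc)
  then have "trace (matrix B) = trace (matrix R ** matrix B ** matrix Q)"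
    by (metis trace_mul_sym)
  also have "matrix R ** matrix B ** matrix Q = matrix (R \<circ> B \<circ> Q)"
    using assms by (simp add: matrix_compose linear_compose)
  finally show ?thesis by (simp add: trace_def matrix_def)
qed

text \<open>In a frame orthonormal for \<open>g\<close> the diagonal entries of \<open>B\<close> are
  the values \<open>g (B q) q\<close> on the frame vectors, so the sign of the quadratic form passes
  to the trace.\<close>

lemma trace_pos:
  fixes B Q :: "real ^ 'n \<Rightarrow> real ^ 'n"
  assumes B: "linear B" and Q: "linear Q"
    and ortho: "\<And>u v. g (Q u) (Q v) = u \<bullet> v" and "\<And>u. u \<noteq> 0 \<Longrightarrow> g (B u) u > 0" and "inj Q"
  shows "trace (matrix B) > 0"
proof -
  obtain R where R: "linear R" "\<And>x. Q (R x) = x"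
    using linear_surjective_right_inverse[OF Q] linear_injective_imp_surjective[OF Q \<open>inj Q\<close>]
    by (auto simp: fun_eq_iff)
  have "R (B (Q (axis i 1))) $ i > 0" for i
  proof -
    have "R (B (Q (axis i 1))) $ i = g (B (Q (axis i 1))) (Q (axis i 1))"
      using ortho[of "R (B (Q (axis i 1)))" "axis i 1"] by (simp add: R cart_eq_inner_axis)
    moreover have "Q (axis i 1) \<noteq> 0"
      using \<open>inj Q\<close> linear_injective_0[OF Q] by (metis axis_eq_0_iff zero_neq_one)
    ultimately show ?thesis using assms(4) by simp
  qed
  then show ?thesis
    unfolding trace_eq_sum_frame[OF B Q R] by (intro sum_pos) auto
qed

section \<open>Differentiable dependence of solutions of linear systems\<close>

lemma differentiable_prod:
  fixes f :: "'i \<Rightarrow> 'a::real_normed_vector \<Rightarrow> 'b::real_normed_field"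
  assumes "\<And>i. i \<in> I \<Longrightarrow> f i differentiable at x"
  shows "(\<lambda>x. \<Prod>i\<in>I. f i x) differentiable at x"
  using assms by (induction I rule: infinite_finite_induct) auto

lemma differentiable_det:
  fixes M :: "'a::real_normed_vector \<Rightarrow> real ^ 'n ^ 'n"
  assumes "\<And>i j. (\<lambda>x. M x $ i $ j) differentiable at x"
  shows "(\<lambda>x. det (M x)) differentiable at x"
  unfolding det_def using assms
  by (intro differentiable_sum ballI differentiable_mult differentiable_const differentiable_prod)
    (auto simp: finite_permutations)

text \<open>Cramer's rule, so that the solution depends on the system as regularly as its entries.\<close>

definition cramer_solution :: "real ^ 'n ^ 'n \<Rightarrow> real ^ 'n \<Rightarrow> real ^ 'n" where
  "cramer_solution M b = (\<chi> k. det (\<chi> i j. if j = k then b $ i else M $ i $ j) / det M)"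

lemma cramer_solution: "det M \<noteq> 0 \<Longrightarrow> M *v x = b \<longleftrightarrow> x = cramer_solution M b"
  unfolding cramer_solution_def by (rule cramer)

lemma differentiable_vec:
  fixes f :: "'a::real_normed_vector \<Rightarrow> real ^ 'n"
  assumes "\<And>i. (\<lambda>x. f x $ i) differentiable at x"
  shows "f differentiable at x"
proof -
  have "(\<lambda>x. \<Sum>i\<in>UNIV. f x $ i *\<^sub>R axis i 1) differentiable at x"
    using assms by (intro differentiable_sum ballI differentiable_scaleR) auto
  moreover have "(\<Sum>i\<in>UNIV. f x $ i *\<^sub>R axis i 1) = f x" for x
    by (simp add: scalar_mult_eq_scaleR[symmetric] basis_expansion)
  ultimately show ?thesis by (metis (no_types, lifting) ext)
qed

lemma differentiable_cramer_solution:
  fixes M :: "'a::real_normed_vector \<Rightarrow> real ^ 'n ^ 'n"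
  assumes "\<And>i j. (\<lambda>x. M x $ i $ j) differentiable at x" "\<And>i. (\<lambda>x. b x $ i) differentiable at x"
    and "det (M x) \<noteq> 0"
  shows "(\<lambda>x. cramer_solution (M x) (b x)) differentiable at x"
  unfolding cramer_solution_def
proof (rule differentiable_vec)
  fix k
  have "(\<lambda>x. (\<chi> i j. if j = k then b x $ i else M x $ i $ j) $ i $ j) differentiable at x" for i j
    using assms by (cases "j = k") auto
  then show "(\<lambda>x. (\<chi> k. det (\<chi> i j. if j = k then b x $ i else M x $ i $ j) / det (M x)) $ k) differentiable at x"
    using assms by (simp add: differentiable_divide differentiable_det)
qed

section \<open>Maximal hypersurfaces of the Radiation Model\<close>

lemma rw_metric_radiation:
  assumes "a > 0" "fst p \<ge> 0"
  shows "rw_metric (\<lambda>t. sqrt (2 * a * t)) p u v = - (fst u * fst v) + 2 * a * fst p * (snd u \<bullet> snd v)"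
  using assms by (simp add: rw_metric_def)

lemma frechet_rw_metric_radiation:
  fixes p u v w :: "real \<times> 'e::euclidean_space"
  assumes "a > 0" "fst p > 0"
  shows "frechet_derivative (\<lambda>q. rw_metric (\<lambda>t. sqrt (2 * a * t)) q v w) (at p) u
      = 2 * a * fst u * (snd v \<bullet> snd w)"
proof -
  have op: "open {q :: real \<times> 'e. fst q > 0}"
    by (intro open_Collect_less continuous_intros)
  have "((\<lambda>q. - (fst v * fst w) + 2 * a * fst q * (snd v \<bullet> snd w)) has_derivative
      (\<lambda>u. 2 * a * fst u * (snd v \<bullet> snd w))) (at p)"
    by (auto intro!: derivative_eq_intros)
  then have "((\<lambda>q. rw_metric (\<lambda>t. sqrt (2 * a * t)) q v w) has_derivative
      (\<lambda>u. 2 * a * fst u * (snd v \<bullet> snd w))) (at p)"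
    by (rule has_derivative_transform_within_open[OF _ op]) (use assms in \<open>auto simp: rw_metric_radiation\<close>)
  then show ?thesis
    using frechet_derivative_at by metis
qed

text \<open>The Koszul identity is linear in \<open>w\<close>. Testing it on \<open>(1, 0)\<close>
  and on \<open>(0, w)\<close> determines the two components separately, which is the uniqueness
  that the \<open>THE\<close> in \<open>christoffel_def\<close> requires.\<close>

lemma christoffel_radiation:
  fixes p u v :: "real \<times> 'e::euclidean_space"
  assumes "a > 0" "fst p > 0"
  shows "christoffel (rw_metric (\<lambda>t. sqrt (2 * a * t))) p u v =
    (a * (snd u \<bullet> snd v), (1 / (2 * fst p)) *\<^sub>R (fst u *\<^sub>R snd v + fst v *\<^sub>R snd u))"
  unfolding christoffel_def
proof (rule the_equality)
  show "\<forall>w. 2 * rw_metric (\<lambda>t. sqrt (2 * a * t)) p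
        (a * (snd u \<bullet> snd v), (1 / (2 * fst p)) *\<^sub>R (fst u *\<^sub>R snd v + fst v *\<^sub>R snd u)) w =
      frechet_derivative (\<lambda>q. rw_metric (\<lambda>t. sqrt (2 * a * t)) q v w) (at p) u +
      frechet_derivative (\<lambda>q. rw_metric (\<lambda>t. sqrt (2 * a * t)) q u w) (at p) v -
      frechet_derivative (\<lambda>q. rw_metric (\<lambda>t. sqrt (2 * a * t)) q u v) (at p) w"
    unfolding frechet_rw_metric_radiation[OF assms] rw_metric_radiation[OF assms(1) less_imp_le[OF assms(2)]]
    using assms by (simp add: inner_left_distrib field_simps)
next
  fix z assume z: "\<forall>w. 2 * rw_metric (\<lambda>t. sqrt (2 * a * t)) p z w =
      frechet_derivative (\<lambda>q. rw_metric (\<lambda>t. sqrt (2 * a * t)) q v w) (at p) u +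
      frechet_derivative (\<lambda>q. rw_metric (\<lambda>t. sqrt (2 * a * t)) q u w) (at p) v -
      frechet_derivative (\<lambda>q. rw_metric (\<lambda>t. sqrt (2 * a * t)) q u v) (at p) w"
  have eq: "- 2 * fst z * fst w + 4 * a * fst p * (snd z \<bullet> snd w) =
      2 * a * fst u * (snd v \<bullet> snd w) + 2 * a * fst v * (snd u \<bullet> snd w) - 2 * a * fst w * (snd u \<bullet> snd v)" for w
    using z[rule_format, of w] assms by (simp add: frechet_rw_metric_radiation rw_metric_radiation)
  have "fst z = a * (snd u \<bullet> snd v)" using eq[of "(1, 0)"] by simp
  moreover have "snd z = (1 / (2 * fst p)) *\<^sub>R (fst u *\<^sub>R snd v + fst v *\<^sub>R snd u)"
  proof (rule vector_eq_rdot[THEN iffD1], rule allI)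
    fix w
    have "a * (2 * fst p * (snd z \<bullet> w)) = a * (fst u * (snd v \<bullet> w) + fst v * (snd u \<bullet> w))"
      using eq[of "(0, w)"] by (simp add: algebra_simps)
    then have "2 * fst p * (snd z \<bullet> w) = fst u * (snd v \<bullet> w) + fst v * (snd u \<bullet> w)"
      using assms(1) by (simp only: mult_cancel_left) auto
    then show "snd z \<bullet> w = ((1 / (2 * fst p)) *\<^sub>R (fst u *\<^sub>R snd v + fst v *\<^sub>R snd u)) \<bullet> w"
      using assms by (simp add: inner_left_distrib field_simps)
  qed
  ultimately show "z = (a * (snd u \<bullet> snd v), (1 / (2 * fst p)) *\<^sub>R (fst u *\<^sub>R snd v + fst v *\<^sub>R snd u))"
    by (simp add: prod_eq_iff)
qed

text \<open>The hypersurface is locally a graph over \<open>R^n\<close>; \<open>slope\<close> is the Euclidean gradient of the graph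
  function, computed from the differential \<open>D\<close> of an arbitrary parametrisation.\<close>

definition slope :: "(real ^ 'n \<Rightarrow> real \<times> (real ^ 'n)) \<Rightarrow> real ^ 'n" where
  "slope D = cramer_solution (\<chi> i j. snd (D (axis i 1)) $ j) (\<chi> i. fst (D (axis i 1)))"

text \<open>The tangent vectors of a graph with gradient \<open>m\<close> are
  \<open>(m \<bullet> v, v)\<close>, and \<open>(1, m / (2 a t))\<close> is orthogonal to all of
  them. Its square is \<open>- (1 - m \<bullet> m / (2 a t))\<close>, whence the normalising
  factor.\<close>

definition graph_normal :: "real \<Rightarrow> real \<Rightarrow> 'e::real_inner \<Rightarrow> real \<times> 'e" where
  "graph_normal a t m = (1 / sqrt (1 - m \<bullet> m / (2 * a * t))) *\<^sub>R (1, (1 / (2 * a * t)) *\<^sub>R m)"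

section \<open>Linear algebra of a spacelike tangent space\<close>

locale spacelike_tangent =
  fixes a t :: real and D :: "real ^ 'n \<Rightarrow> real \<times> (real ^ 'n)"
  assumes a: "a > 0" and t: "t > 0" and linear: "linear D"
    and spacelike: "\<And>u. u \<noteq> 0 \<Longrightarrow> (fst (D u))\<^sup>2 < 2 * a * t * (snd (D u) \<bullet> snd (D u))"
begin

lemma linear_fst: "linear (\<lambda>u. fst (D u))" and linear_snd: "linear (\<lambda>u. snd (D u))"
  using linear_compose[OF linear linear_fst] linear_compose[OF linear linear_snd] by (auto simp: comp_def)

text \<open>A nonzero vector with vanishing spatial part would not be spacelike. This is what makes
  the projection to \<open>R^n\<close> a local diffeomorphism.\<close>

lemma inj_snd: "inj (\<lambda>u. snd (D u))"
proof (rule injI)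
  fix u v assume "snd (D u) = snd (D v)"
  then have "snd (D (u - v)) = 0" by (simp add: linear_diff[OF linear])
  then show "u = v" using spacelike[of "u - v"] by fastforce
qed

lemma surj_snd: "surj (\<lambda>u. snd (D u))"
  using linear_injective_imp_surjective[OF linear_snd inj_snd] by simp

lemma inj: "inj D"
  using inj_snd by (metis injD injI)

lemma det_slope: "det (\<chi> i j. snd (D (axis i 1)) $ j) \<noteq> 0"
proof -
  have "(\<chi> i j. snd (D (axis i 1)) $ j) = transpose (matrix (\<lambda>u. snd (D u)))"
    by (simp add: transpose_def matrix_def)
  then show ?thesis
    using det_nz_iff_inj[OF linear_snd] inj_snd by (simp add: det_transpose)
qed

lemma slope: "fst (D u) = slope D \<bullet> snd (D u)"
proof -
  have "(\<chi> i j. snd (D (axis i 1)) $ j) *v slope D = (\<chi> i. fst (D (axis i 1)))"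
    using cramer_solution[OF det_slope] unfolding slope_def by blast
  then have "fst (D (axis i 1)) = slope D \<bullet> snd (D (axis i 1))" for i
    by (simp add: vec_eq_iff matrix_vector_mult_def inner_vec_def mult.commute)
  moreover have "linear (\<lambda>u. slope D \<bullet> snd (D u))"
    using linear_snd by (simp add: linear_iff inner_right_distrib)
  ultimately have "(\<lambda>u. fst (D u)) = (\<lambda>u. slope D \<bullet> snd (D u))"
    by (intro linear_eq_stdbasis linear_fst) (auto simp: Basis_vec_def)
  then show ?thesis by metis
qed

text \<open>The slope \<open>m\<close> is itself the spatial part of a tangent vector, whose time
  part is \<open>m \<bullet> m\<close>; on this vector the spacelike condition reads
  \<open>(m \<bullet> m)^2 < 2 a t (m \<bullet> m)\<close>.\<close>

lemma slope_less: "slope D \<bullet> slope D < 2 * a * t"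
proof (cases "slope D = 0")
  case True then show ?thesis using a t by simp
next
  case False
  let ?m = "slope D"
  obtain u where u: "snd (D u) = ?m" using surj_snd by (metis surjD)
  then have "u \<noteq> 0" using False linear_0[OF linear] by force
  then have "(?m \<bullet> ?m) * (?m \<bullet> ?m) < (2 * a * t) * (?m \<bullet> ?m)"
    using spacelike[of u] slope[of u] u by (simp add: power2_eq_square)
  then show ?thesis using False by (simp add: mult_less_cancel_right)
qed

text \<open>Orthogonality ties the spatial part of \<open>N\<close> to \<open>fst N\<close>, the
  norm fixes \<open>(fst N)^2\<close> and the time orientation its sign. The description is thereby
  replaced by a formula that can be differentiated.\<close>

lemma unit_normal_eq:
  assumes "fst p = t"
  shows "(THE N. rw_metric (\<lambda>t. sqrt (2 * a * t)) p N N = -1 \<and>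
       (\<forall>u. rw_metric (\<lambda>t. sqrt (2 * a * t)) p N (D u) = 0) \<and>
       rw_metric (\<lambda>t. sqrt (2 * a * t)) p N (1, 0) < 0) = graph_normal a t (slope D)"
proof -
  let ?m = "slope D" and ?q = "2 * a * t"
  let ?w = "1 - ?m \<bullet> ?m / ?q"
  note rw = rw_metric_radiation[OF a, of p, unfolded assms, OF less_imp_le[OF t]]
  have q: "?q > 0" using a t by simp
  then have w: "?w > 0" using slope_less by simp
  have "(1 / sqrt w)\<^sup>2 * w = 1" if "w > 0" for w :: real
    using that by (simp add: power_divide)
  from this[OF w] have sq: "(1 / sqrt ?w)\<^sup>2 * ?w = 1" .
  show ?thesis
  proof (rule the_equality, intro conjI allI)
    have "- (\<nu> * \<nu>) + ?q * ((\<nu> / ?q) * ((\<nu> / ?q) * (?m \<bullet> ?m))) = - (\<nu>\<^sup>2 * ?w)" for \<nu>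
      using a t by (simp add: power2_eq_square field_simps)
    from this[of "1 / sqrt ?w"]
    have "rw_metric (\<lambda>t. sqrt (2 * a * t)) p (graph_normal a t ?m) (graph_normal a t ?m)
        = - ((1 / sqrt ?w)\<^sup>2 * ?w)"
      unfolding rw graph_normal_def by simp
    then show "rw_metric (\<lambda>t. sqrt (2 * a * t)) p (graph_normal a t ?m) (graph_normal a t ?m) = -1"
      using sq by simp
    show "rw_metric (\<lambda>t. sqrt (2 * a * t)) p (graph_normal a t ?m) (D u) = 0" for u
      using a t slope[of u] by (simp add: rw graph_normal_def)
    show "rw_metric (\<lambda>t. sqrt (2 * a * t)) p (graph_normal a t ?m) (1, 0) < 0"
      using w by (simp add: rw graph_normal_def)
  next
    fix N assume N: "rw_metric (\<lambda>t. sqrt (2 * a * t)) p N N = -1 \<and>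
       (\<forall>u. rw_metric (\<lambda>t. sqrt (2 * a * t)) p N (D u) = 0) \<and>
       rw_metric (\<lambda>t. sqrt (2 * a * t)) p N (1, 0) < 0"
    have snd: "?q *\<^sub>R snd N = fst N *\<^sub>R ?m"
    proof (rule vector_eq_rdot[THEN iffD1], rule allI)
      fix v
      obtain u where "snd (D u) = v" using surj_snd by (metis surjD)
      then show "(?q *\<^sub>R snd N) \<bullet> v = (fst N *\<^sub>R ?m) \<bullet> v"
        using N slope[of u] rw[of N "D u"] by (simp add: algebra_simps)
    qed
    then have snd': "snd N = (fst N / ?q) *\<^sub>R ?m"
      using q by (metis divideR_right less_irrefl scaleR_scaleR divide_inverse_commute inverse_eq_divide mult.commute)
    have pos: "fst N > 0" using N by (simp add: rw)
    have "- (fst N * fst N) + ?q * (snd N \<bullet> snd N) = -1"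
      using N rw[of N N] by simp
    then have "- (fst N * fst N) + ?q * ((fst N / ?q) * ((fst N / ?q) * (?m \<bullet> ?m))) = -1"
      unfolding snd' by simp
    then have "(fst N)\<^sup>2 * ?w = 1"
      using a t by (simp add: power2_eq_square field_simps)
    then have "(fst N)\<^sup>2 = (1 / sqrt ?w)\<^sup>2" using sq w by (metis less_irrefl mult_right_cancel)
    then have "fst N = 1 / sqrt ?w" using pos w by (simp add: power2_eq_iff_nonneg)
    then show "N = graph_normal a t ?m"
      using snd' by (simp add: graph_normal_def prod_eq_iff)
  qed
qed

text \<open>Over the spatial coordinates the induced metric is \<open>f^2 (I - d d^T)\<close> with
  \<open>f = sqrt (2 a t)\<close> and \<open>d\<close> of norm less than 1. Its inverse square root
  is explicit: \<open>P = (1 / f) (I + \<beta> d d^T)\<close>, up to the factor the spatial block of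
  the Lorentz boost with velocity \<open>d\<close>.\<close>

lemma orthonormal_frame:
  obtains Q :: "real ^ 'n \<Rightarrow> real ^ 'n" where "linear Q" "inj Q"
    "\<And>u v. - (fst (D (Q u)) * fst (D (Q v))) + 2 * a * t * (snd (D (Q u)) \<bullet> snd (D (Q v))) = u \<bullet> v"
proof -
  obtain R where R: "linear R" "\<And>x. snd (D (R x)) = x"
    using linear_surjective_right_inverse[OF linear_snd surj_snd] by (auto simp: fun_eq_iff)
  define f where "f = sqrt (2 * a * t)"
  have f: "f > 0" "f * f = 2 * a * t" using a t by (simp_all add: f_def)
  define d where "d = (1 / f) *\<^sub>R slope D"
  have "slope D \<bullet> slope D < f * f" using slope_less f(2) by simp
  then have d: "d \<bullet> d < 1" using f(1) by (simp add: d_def field_simps)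
  define \<gamma> where "\<gamma> = 1 / sqrt (1 - d \<bullet> d)"
  have \<gamma>: "\<gamma> > 0" "\<gamma>\<^sup>2 * (1 - d \<bullet> d) = 1" using d by (simp_all add: \<gamma>_def power_divide)
  \<comment> \<open>The boost coefficient \<open>(\<gamma> - 1) / (d \<bullet> d)\<close>, rewritten
    so that it makes sense for \<open>d = 0\<close>.\<close>
  define \<beta> where "\<beta> = \<gamma>\<^sup>2 / (1 + \<gamma>)"
  have \<beta>: "\<beta> * (1 + \<gamma>) = \<gamma>\<^sup>2" using \<gamma>(1) by (simp add: \<beta>_def)
  have "(1 + \<gamma>) * (1 + \<beta> * (d \<bullet> d)) = 1 + \<gamma> + (\<beta> * (1 + \<gamma>)) * (d \<bullet> d)"
    by (simp only: algebra_simps)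
  also have "\<dots> = 1 + \<gamma> + \<gamma>\<^sup>2 * (d \<bullet> d)" unfolding \<beta> ..
  also have "\<dots> = (1 + \<gamma>) * \<gamma>" using \<gamma>(2) by algebra
  finally have \<beta>d: "1 + \<beta> * (d \<bullet> d) = \<gamma>" using \<gamma>(1) by simp
  define P where "P u = (1 / f) *\<^sub>R (u + (\<beta> * (d \<bullet> u)) *\<^sub>R d)" for u
  have linP: "linear P"
    by (rule linearI) (simp_all add: P_def inner_right_distrib algebra_simps)
  have dP: "d \<bullet> (f *\<^sub>R P u) = \<gamma> * (d \<bullet> u)" for u
    using f(1) by (simp add: P_def inner_right_distrib \<beta>d[symmetric] algebra_simps)
  have isometry: "(f *\<^sub>R P u) \<bullet> (f *\<^sub>R P v) - (d \<bullet> (f *\<^sub>R P u)) * (d \<bullet> (f *\<^sub>R P v)) = u \<bullet> v" for u v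
  proof -
    have "(f *\<^sub>R P u) \<bullet> (f *\<^sub>R P v) = u \<bullet> v + (d \<bullet> u) * (d \<bullet> v) * (\<beta> * (1 + (1 + \<beta> * (d \<bullet> d))))"
      using f(1) by (simp add: P_def inner_left_distrib inner_right_distrib inner_commute algebra_simps)
    also have "\<beta> * (1 + (1 + \<beta> * (d \<bullet> d))) = \<gamma>\<^sup>2" unfolding \<beta>d \<beta> ..
    finally show ?thesis unfolding dP by (simp add: power2_eq_square)
  qed
  have D: "fst (D (R x)) = f * (d \<bullet> x)" for x
    using slope[of "R x"] f(1) by (simp add: R d_def)
  have main: "- (fst (D (R (P u))) * fst (D (R (P v)))) + 2 * a * t * (snd (D (R (P u))) \<bullet> snd (D (R (P v)))) = u \<bullet> v" for u v
    using isometry[of u v] unfolding D R f(2)[symmetric] by (simp add: algebra_simps)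
  show ?thesis
  proof
    show lin: "linear (\<lambda>u. R (P u))" using linear_compose[OF linP R(1)] by (simp add: comp_def)
    show "inj (\<lambda>u. R (P u))"
    proof (rule linear_injective_0[OF lin, THEN iffD2], intro allI impI)
      fix u assume "R (P u) = 0"
      then have "u \<bullet> u = 0" using main[of u u] linear_0[OF linear] by simp
      then show "u = 0" by simp
    qed
  qed (rule main)
qed

text \<open>The hypothesis is orthogonality of \<open>w\<close> to \<open>graph_normal\<close>,
  written without the normalising factor.\<close>

lemma tangent_of_orthogonal:
  assumes "fst w = slope D \<bullet> snd w"
  shows "\<exists>u. D u = w"
proof -
  obtain u where "snd (D u) = snd w" using surj_snd by (metis surjD)
  then show ?thesis using slope[of u] assms by (metis prod_eq_iff)
qed

end

lemma differentiable_sqrt: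
  fixes f :: "'a::real_normed_vector \<Rightarrow> real"
  assumes "f differentiable at x" "f x > 0"
  shows "(\<lambda>x. sqrt (f x)) differentiable at x"
proof -
  obtain f' where "(f has_derivative f') (at x)" using assms unfolding differentiable_def by blast
  then have "((\<lambda>x. sqrt (f x)) has_derivative (\<lambda>h. inverse (sqrt (f x)) / 2 * f' h)) (at x)"
    using assms(2) by (auto intro!: derivative_eq_intros simp: field_simps)
  then show ?thesis unfolding differentiable_def by blast
qed

lemma differentiable_fst_snd:
  assumes "f differentiable at x"
  shows "(\<lambda>x. fst (f x)) differentiable at x" "(\<lambda>x. snd (f x)) differentiable at x"
  using assms unfolding differentiable_def by (auto intro: has_derivative_fst has_derivative_snd)

lemma differentiable_vec_nth_at:
  fixes f :: "'a::real_normed_vector \<Rightarrow> real ^ 'n"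
  assumes "f differentiable at x"
  shows "(\<lambda>x. f x $ i) differentiable at x"
  using assms unfolding differentiable_def by (auto intro: bounded_linear.has_derivative[OF bounded_linear_vec_nth])

lemma differentiable_inner_at:
  assumes "f differentiable at x" "g differentiable at x"
  shows "(\<lambda>x. f x \<bullet> g x) differentiable at x"
  using assms unfolding differentiable_def by (auto intro: has_derivative_inner)

text \<open>In the conformal time \<open>\<eta> = sqrt (2 t / a)\<close> the spacetime is conformal to half of Minkowski space,
  and up to a factor and a constant the barrier is the Lorentzian square of \<open>(\<eta>, x)\<close> with
  respect to the point \<open>(c, x\<^sub>0)\<close>, where \<open>b = c sqrt (2 a)\<close>.\<close>

definition barrier :: "real \<Rightarrow> real \<Rightarrow> 'e::real_inner \<Rightarrow> real \<times> 'e \<Rightarrow> real" where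
  "barrier a b x0 p = b * sqrt (fst p) - fst p + a / 2 * ((snd p - x0) \<bullet> (snd p - x0))"

section \<open>The second fundamental form and its comparison with the barrier\<close>

locale spacelike_immersion =
  fixes a :: real and S :: "(real ^ 'n) set" and F :: "real ^ 'n \<Rightarrow> real \<times> (real ^ 'n)"
    and D :: "real ^ 'n \<Rightarrow> real ^ 'n \<Rightarrow> real \<times> (real ^ 'n)"
  assumes open_dom: "open S"
    and deriv: "\<And>z. z \<in> S \<Longrightarrow> (F has_derivative D z) (at z)"
    and deriv_differentiable: "\<And>z v. z \<in> S \<Longrightarrow> (\<lambda>z. D z v) differentiable at z"
    and tangent: "\<And>z. z \<in> S \<Longrightarrow> spacelike_tangent a (fst (F z)) (D z)"
begin

abbreviation (input) "T z \<equiv> fst (F z)"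
abbreviation (input) "normal z \<equiv> graph_normal a (T z) (slope (D z))"
abbreviation (input) "g \<equiv> rw_metric (\<lambda>t. sqrt (2 * a * t))"

lemma differentiable_normal:
  assumes y: "y \<in> S"
  shows "(\<lambda>z. normal z) differentiable at y"
proof -
  interpret spacelike_tangent a "T y" "D y" by (rule tangent[OF y])
  have m: "(\<lambda>z. slope (D z)) differentiable at y"
    unfolding slope_def using det_slope deriv_differentiable[OF y]
    by (intro differentiable_cramer_solution)
      (auto intro!: differentiable_vec_nth_at differentiable_fst_snd)
  have T: "(\<lambda>z. T z) differentiable at y"
    using deriv[OF y] by (intro differentiable_fst_snd) (auto simp: differentiable_def)
  have inner: "(\<lambda>z. slope (D z) \<bullet> slope (D z)) differentiable at y"
    by (intro differentiable_inner_at m)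
  have pos: "1 - slope (D y) \<bullet> slope (D y) / (2 * a * T y) > 0"
    using slope_less a t by simp
  have sq: "(\<lambda>z. sqrt (1 - slope (D z) \<bullet> slope (D z) / (2 * a * T z))) differentiable at y"
    by (rule differentiable_sqrt)
       (use pos a t in \<open>auto intro!: differentiable_diff differentiable_divide inner T simp del: less_divide_eq_1_pos divide_less_eq_1_pos\<close>)
  have c: "(\<lambda>z. 1 / sqrt (1 - slope (D z) \<bullet> slope (D z) / (2 * a * T z))) differentiable at y"
    using real_sqrt_gt_zero[OF pos] by (intro differentiable_divide sq differentiable_const) linarith
  have "(\<lambda>z. (1 / (2 * a * T z)) *\<^sub>R slope (D z)) differentiable at y"
    using a t by (intro differentiable_scaleR m differentiable_divide differentiable_mult T) auto
  then obtain m' where "((\<lambda>z. (1 / (2 * a * T z)) *\<^sub>R slope (D z)) has_derivative m') (at y)"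
    unfolding differentiable_def by blast
  from has_derivative_Pair[OF has_derivative_const[of "1::real"] this]
  have "(\<lambda>z. (1::real, (1 / (2 * a * T z)) *\<^sub>R slope (D z))) differentiable at y"
    by (rule differentiableI)
  then show ?thesis unfolding graph_normal_def by (intro differentiable_scaleR c)
qed

text \<open>Both parts come from differentiating relations valid on all of \<open>S\<close>:
  \<open>g N N = -1\<close> gives the first and \<open>g N (D z v) = 0\<close> the second. The
  latter trades the derivative of the normal for second derivatives \<open>D2\<close> of the
  immersion, so \<open>N'\<close> never has to be computed; the term with
  \<open>2 * a * fst (D y u)\<close> is the derivative of the metric coefficient.\<close>

lemma cov_deriv_normal:
  fixes y
  defines "N \<equiv> normal y" and "N' \<equiv> frechet_derivative (\<lambda>z. normal z) (at y)"
    and "D2 \<equiv> \<lambda>u v. frechet_derivative (\<lambda>z. D z v) (at y) u"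
  assumes y: "y \<in> S"
  shows cov_deriv_normal_orthogonal:
      "g (F y) (N' u + christoffel g (F y) (D y u) N) N = 0"
    and second_fundamental_form:
      "- g (F y) (N' u + christoffel g (F y) (D y u) N) (D y u) =
         - (fst N * fst (D2 u u)) + 2 * a * T y * (snd N \<bullet> snd (D2 u u))
         + 2 * a * fst (D y u) * (snd N \<bullet> snd (D y u)) - a * fst N * (snd (D y u) \<bullet> snd (D y u))"
proof -
  interpret spacelike_tangent a "T y" "D y" by (rule tangent[OF y])
  have gn: "- (fst (normal z) * fst (normal z)) + 2 * a * T z * (snd (normal z) \<bullet> snd (normal z)) = -1"
    and gt: "- (fst (normal z) * fst (D z v)) + 2 * a * T z * (snd (normal z) \<bullet> snd (D z v)) = 0"
    if z: "z \<in> S" for z v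
  proof -
    interpret z: spacelike_tangent a "T z" "D z" by (rule tangent[OF z])
    let ?m = "slope (D z)"
    have pos: "1 - ?m \<bullet> ?m / (2 * a * T z) > 0" using z.slope_less z.a z.t by simp
    have *: "- (\<nu> * \<nu>) + 2 * a * T z * ((\<nu> / (2 * a * T z)) * ((\<nu> / (2 * a * T z)) * (?m \<bullet> ?m)))
        = - (\<nu>\<^sup>2 * (1 - ?m \<bullet> ?m / (2 * a * T z)))" for \<nu>
      using z.a z.t by (simp add: power2_eq_square field_simps)
    have "(1 / sqrt w)\<^sup>2 * w = 1" if "w > 0" for w :: real
      using that by (simp add: power_divide)
    from *[of "1 / sqrt (1 - ?m \<bullet> ?m / (2 * a * T z))"] this[OF pos]
    show "- (fst (normal z) * fst (normal z)) + 2 * a * T z * (snd (normal z) \<bullet> snd (normal z)) = -1"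
      by (simp add: graph_normal_def)
    show "- (fst (normal z) * fst (D z v)) + 2 * a * T z * (snd (normal z) \<bullet> snd (D z v)) = 0"
      using z.a z.t z.slope[of v] by (simp add: graph_normal_def)
  qed
  have dN: "((\<lambda>z. normal z) has_derivative N') (at y)"
    unfolding N'_def using differentiable_normal[OF y] frechet_derivative_works by blast
  have dD: "((\<lambda>z. D z v) has_derivative (\<lambda>u. D2 u v)) (at y)" for v
    unfolding D2_def using deriv_differentiable[OF y, of v] frechet_derivative_works by force
  have const: "h' u = 0"
    if "(h has_derivative h') (at y)" "\<And>z. z \<in> S \<Longrightarrow> h z = k" for h :: "real ^ 'n \<Rightarrow> real" and h' k
  proof -
    have "(h has_derivative (\<lambda>_. 0)) (at y)"
      using has_derivative_transform_within_open[OF has_derivative_const open_dom y] that(2) by metis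
    then show ?thesis using has_derivative_unique[OF that(1)] by (simp add: fun_eq_iff)
  qed
  have dg: "((\<lambda>z. - (fst (normal z) * fst (V z)) + 2 * a * T z * (snd (normal z) \<bullet> snd (V z)))
      has_derivative (\<lambda>u. - (fst N * fst (V' u) + fst (N' u) * fst (V y))
        + (2 * a * T y * (snd N \<bullet> snd (V' u) + snd (N' u) \<bullet> snd (V y))
        + 2 * a * fst (D y u) * (snd N \<bullet> snd (V y))))) (at y)"
    if "(V has_derivative V') (at y)" for V V'
    unfolding N_def
    by (intro has_derivative_add has_derivative_minus has_derivative_mult has_derivative_inner
        has_derivative_mult_right has_derivative_fst has_derivative_snd dN deriv y that)
  have unit: "- (fst N * fst (N' u) + fst (N' u) * fst N)
        + (2 * a * T y * (snd N \<bullet> snd (N' u) + snd (N' u) \<bullet> snd N)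
        + 2 * a * fst (D y u) * (snd N \<bullet> snd N)) = 0"
    using const[OF dg[OF dN] gn] unfolding N_def .
  have orth: "- (fst N * fst (D2 u v) + fst (N' u) * fst (D y v))
        + (2 * a * T y * (snd N \<bullet> snd (D2 u v) + snd (N' u) \<bullet> snd (D y v))
        + 2 * a * fst (D y u) * (snd N \<bullet> snd (D y v))) = 0" for v
    using const[OF dg[OF dD] gt] .
  note rw = rw_metric_radiation[OF a less_imp_le[OF t]]
  define \<Gamma> where "\<Gamma> = christoffel g (F y) (D y u) N"
  have chr: "fst \<Gamma> = a * (snd (D y u) \<bullet> snd N)"
      "snd \<Gamma> = (1 / (2 * T y)) *\<^sub>R (fst (D y u) *\<^sub>R snd N + fst N *\<^sub>R snd (D y u))"
    by (simp_all add: \<Gamma>_def christoffel_radiation[OF a t])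
  have chr': "2 * a * T y * (snd \<Gamma> \<bullet> w) = a * fst (D y u) * (snd N \<bullet> w) + a * fst N * (snd (D y u) \<bullet> w)" for w
    unfolding chr using t by (simp add: inner_left_distrib field_simps)
  have "g (F y) (N' u + \<Gamma>) N = 0"
    using unit chr'[of "snd N"] unfolding rw
    by (simp add: chr(1) inner_left_distrib inner_commute algebra_simps)
  then show "g (F y) (N' u + christoffel g (F y) (D y u) N) N = 0"
    unfolding \<Gamma>_def .
  have "- g (F y) (N' u + \<Gamma>) (D y u) =
         - (fst N * fst (D2 u u)) + 2 * a * T y * (snd N \<bullet> snd (D2 u u))
         + 2 * a * fst (D y u) * (snd N \<bullet> snd (D y u)) - a * fst N * (snd (D y u) \<bullet> snd (D y u))"
    using orth[of u] chr'[of "snd (D y u)"] unfolding rw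
    by (simp add: chr(1) inner_left_distrib inner_commute algebra_simps)
  then show "- g (F y) (N' u + christoffel g (F y) (D y u) N) (D y u) =
         - (fst N * fst (D2 u u)) + 2 * a * T y * (snd N \<bullet> snd (D2 u u))
         + 2 * a * fst (D y u) * (snd N \<bullet> snd (D y u)) - a * fst N * (snd (D y u) \<bullet> snd (D y u))"
    unfolding \<Gamma>_def .
qed

text \<open>The covariant derivative of the normal is orthogonal to the normal, hence tangent, and
  \<open>D y\<close> is injective. So the \<open>THE\<close> in \<open>shape_operator_def\<close>
  denotes a true preimage, and linearity and the formula for the quadratic form carry over from that
  derivative.\<close>

lemma shape_operator:
  fixes \<psi> :: "'m \<Rightarrow> real \<times> (real ^ 'n)" and c :: "('m, 'n) chart" and y
  defines "N \<equiv> normal y" and "D2 \<equiv> \<lambda>u v. frechet_derivative (\<lambda>z. D z v) (at y) u"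
  assumes F: "F = \<psi> \<circ> param c" and y: "y \<in> S"
  shows "linear (shape_operator (\<lambda>t. sqrt (2 * a * t)) \<psi> c y)"
    and "g (F y) (D y (shape_operator (\<lambda>t. sqrt (2 * a * t)) \<psi> c y u)) (D y u) =
         - (fst N * fst (D2 u u)) + 2 * a * T y * (snd N \<bullet> snd (D2 u u))
         + 2 * a * fst (D y u) * (snd N \<bullet> snd (D y u)) - a * fst N * (snd (D y u) \<bullet> snd (D y u))"
proof -
  interpret spacelike_tangent a "T y" "D y" by (rule tangent[OF y])
  let ?f = "\<lambda>t. sqrt (2 * a * t)"
  define N' where "N' = frechet_derivative (\<lambda>z. normal z) (at y)"
  define E where "E u = N' u + christoffel g (F y) (D y u) N" for u
  have DF: "frechet_derivative (\<psi> \<circ> param c) (at z) = D z" if "z \<in> S" for z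
    using frechet_derivative_at[OF deriv[OF that]] F by simp
  have normal: "unit_normal ?f \<psi> c z = normal z" if "z \<in> S" for z
    using spacelike_tangent.unit_normal_eq[OF tangent[OF that] refl] F
    by (simp add: unit_normal_def DF[OF that])
  have dN: "((\<lambda>z. normal z) has_derivative N') (at y)"
    unfolding N'_def using differentiable_normal[OF y] frechet_derivative_works by blast
  then have "(unit_normal ?f \<psi> c has_derivative N') (at y)"
    by (rule has_derivative_transform_within_open[OF _ open_dom y]) (simp add: normal)
  then have cov: "cov_deriv_along g (\<psi> \<circ> param c) (unit_normal ?f \<psi> c) y u = E u" for u
    using frechet_derivative_at[of _ N' y] F
    by (simp add: cov_deriv_along_def E_def DF[OF y] normal[OF y] N_def del: comp_apply)
  have orth: "g (F y) (E u) N = 0" for u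
    using cov_deriv_normal_orthogonal[OF y] by (simp add: E_def N_def N'_def)
  have tan: "\<exists>w. D y w = - E u" for u
  proof (rule tangent_of_orthogonal)
    have pos: "fst N > 0" using slope_less a t by (simp add: N_def graph_normal_def)
    have "fst N * fst (E u) = fst N * (slope (D y) \<bullet> snd (E u))"
      using orth[of u] a t
      by (auto simp: rw_metric_radiation[OF a less_imp_le[OF t]] N_def graph_normal_def inner_commute)
    then show "fst (- E u) = slope (D y) \<bullet> snd (- E u)" using pos by simp
  qed
  have DA: "D y (shape_operator ?f \<psi> c y u) = - E u" for u
  proof -
    have "\<exists>!w. D y w = - E u" using tan[of u] inj by (metis injD)
    from theI'[OF this] show ?thesis
      unfolding shape_operator_def cov DF[OF y] .
  qed
  have "linear N'" using has_derivative_linear[OF dN] .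
  then have linE: "linear E"
    unfolding E_def christoffel_radiation[OF a t]
    by (intro linearI)
      (simp_all add: linear_add[OF linear] linear_scale[OF linear] linear_add linear_scale prod_eq_iff
        inner_left_distrib algebra_simps)
  show "linear (shape_operator ?f \<psi> c y)"
    by (intro linearI injD[OF inj])
      (simp_all add: DA linear_add[OF linear] linear_scale[OF linear] linear_add[OF linE] linear_scale[OF linE])
  have "g (F y) (- E u) (D y u) = - g (F y) (E u) (D y u)"
    by (simp add: rw_metric_def)
  then show "g (F y) (D y (shape_operator ?f \<psi> c y u)) (D y u) =
         - (fst N * fst (D2 u u)) + 2 * a * T y * (snd N \<bullet> snd (D2 u u))
         + 2 * a * fst (D y u) * (snd N \<bullet> snd (D y u)) - a * fst N * (snd (D y u) \<bullet> snd (D y u))"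
    unfolding DA N_def D2_def using second_fundamental_form[OF y, of u]
    by (simp add: E_def N_def N'_def)
qed

text \<open>At the minimum the vanishing first derivatives make the metric gradient of the barrier a
  multiple of the normal. The second derivatives of the immersion then enter the Hessian of the
  restricted barrier and the second fundamental form in the same combination, so one can be
  exchanged for the other. What remains is \<open>\<mu>\<close> times the induced metric;
  \<open>b > 4 sqrt T\<close>, that is \<open>c > 2 \<eta>\<close>, makes \<open>\<mu>\<close>
  positive.\<close>

lemma no_barrier_minimum:
  fixes \<psi> :: "'m \<Rightarrow> real \<times> (real ^ 'n)" and c :: "('m, 'n) chart"
  assumes F: "F = \<psi> \<circ> param c" and y: "y \<in> S" and b: "b > 4 * sqrt (T y)"
    and "d > 0" and min: "\<And>z. z \<in> ball y d \<Longrightarrow> barrier a b x0 (F y) \<le> barrier a b x0 (F z)"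
  shows "mean_curvature (\<lambda>t. sqrt (2 * a * t)) \<psi> c y \<noteq> 0"
proof
  let ?f = "\<lambda>t. sqrt (2 * a * t)"
  interpret spacelike_tangent a "T y" "D y" by (rule tangent[OF y])
  note T_pos = t
  define A where "A = shape_operator ?f \<psi> c y"
  assume "mean_curvature ?f \<psi> c y = 0"
  then have trA: "trace (matrix A) = 0" by (simp add: mean_curvature_def A_def)
  define N where "N = normal y"
  define D2 where "D2 = (\<lambda>u v. frechet_derivative (\<lambda>z. D z v) (at y) u)"
  define t where "t = T y"
  have t: "t > 0" using T_pos by (simp add: t_def)
  \<comment> \<open>\<open>k1\<close> and \<open>k2\<close> are the first two derivatives of the
    time part \<open>b sqrt t - t\<close> of the barrier.\<close>
  define k1 where "k1 = b / (2 * sqrt t) - 1"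
  define k2 where "k2 = - b / (4 * t * sqrt t)"
  define x where "x = snd (F y) - x0"
  obtain e0 where e0: "e0 > 0" "ball y e0 \<subseteq> S"
    using open_dom y by (meson openE)
  define e where "e = min d e0"
  have e: "e > 0" "e \<le> d" "ball y e \<subseteq> S"
    using e0 \<open>d > 0\<close> by (auto simp: e_def)
  have D2: "((\<lambda>z. D z v) has_derivative (\<lambda>u. D2 u v)) (at y)" for v
    unfolding D2_def using deriv_differentiable[OF y, of v] frechet_derivative_works by force
  \<comment> \<open>First and second derivative at \<open>s = 0\<close> of the barrier along
    \<open>s \<mapsto> F (y + s u)\<close>, a curve with velocity \<open>D y u\<close> and
    acceleration \<open>D2 u u\<close>.\<close>
  have *: "k1 * fst (D y u) + a * (x \<bullet> snd (D y u)) = 0 \<and>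
      k2 * (fst (D y u))\<^sup>2 + k1 * fst (D2 u u) + a * (snd (D y u) \<bullet> snd (D y u)) + a * (x \<bullet> snd (D2 u u)) \<ge> 0" for u
  proof -
    \<comment> \<open>The summand 1 covers \<open>u = 0\<close>.\<close>
    define \<delta> where "\<delta> = e / (norm u + 1)"
    have \<delta>: "\<delta> > 0" using e add_nonneg_pos[OF norm_ge_zero zero_less_one, of u] by (simp add: \<delta>_def)
    have inball: "y + s *\<^sub>R u \<in> ball y e" if "\<bar>s\<bar> < \<delta>" for s
    proof -
      have "\<bar>s\<bar> * norm u \<le> \<bar>s\<bar> * (norm u + 1)" by (simp add: mult_left_mono)
      also have "\<dots> < e" using that by (simp add: \<delta>_def pos_less_divide_eq add_nonneg_pos)
      finally show ?thesis by (simp add: dist_norm)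
    qed
    define \<kappa> where "\<kappa> s = barrier a b x0 (F (y + s *\<^sub>R u))" for s
    define \<kappa>' where "\<kappa>' s = (b / (2 * sqrt (T (y + s *\<^sub>R u))) - 1) * fst (D (y + s *\<^sub>R u) u)
        + a * ((snd (F (y + s *\<^sub>R u)) - x0) \<bullet> snd (D (y + s *\<^sub>R u) u))" for s
    have line: "((\<lambda>s. y + s *\<^sub>R u) has_derivative (\<lambda>h. h *\<^sub>R u)) (at s)" for s
      by (auto intro!: derivative_eq_intros)
    have dF: "((\<lambda>s. F (y + s *\<^sub>R u)) has_derivative (\<lambda>h. h *\<^sub>R D (y + s *\<^sub>R u) u)) (at s)"
      and T: "T (y + s *\<^sub>R u) > 0" if "\<bar>s\<bar> < \<delta>" for s
    proof -
      have z: "y + s *\<^sub>R u \<in> S" using inball[OF that] e by blast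
      interpret z: spacelike_tangent a "T (y + s *\<^sub>R u)" "D (y + s *\<^sub>R u)" by (rule tangent[OF z])
      show "T (y + s *\<^sub>R u) > 0" by (rule z.t)
      show "((\<lambda>s. F (y + s *\<^sub>R u)) has_derivative (\<lambda>h. h *\<^sub>R D (y + s *\<^sub>R u) u)) (at s)"
        using has_derivative_compose[OF line deriv[OF z]] by (simp add: linear_scale[OF z.linear])
    qed
    have dFs: "((\<lambda>s. T (y + s *\<^sub>R u)) has_real_derivative fst (D (y + s *\<^sub>R u) u)) (at s)"
        "((\<lambda>s. snd (F (y + s *\<^sub>R u))) has_vector_derivative snd (D (y + s *\<^sub>R u) u)) (at s)"
      if "\<bar>s\<bar> < \<delta>" for s
      using has_derivative_fst[OF dF[OF that]] has_derivative_snd[OF dF[OF that]]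
      by (simp_all add: has_field_derivative_def has_vector_derivative_def mult_commute_abs)
    have x: "((\<lambda>s. snd (F (y + s *\<^sub>R u)) - x0) has_vector_derivative snd (D (y + s *\<^sub>R u) u)) (at s)"
      if "\<bar>s\<bar> < \<delta>" for s
      using has_vector_derivative_diff[OF dFs(2)[OF that] has_vector_derivative_const[of x0]] by simp
    have \<kappa>: "(\<kappa> has_real_derivative \<kappa>' s) (at s)" if "\<bar>s\<bar> < \<delta>" for s
    proof -
      have "((\<lambda>s. (snd (F (y + s *\<^sub>R u)) - x0) \<bullet> (snd (F (y + s *\<^sub>R u)) - x0)) has_real_derivative
          2 * ((snd (F (y + s *\<^sub>R u)) - x0) \<bullet> snd (D (y + s *\<^sub>R u) u))) (at s)"
        using has_real_derivative_inner[OF x[OF that] x[OF that]] by (simp add: inner_commute)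
      then show ?thesis
        unfolding \<kappa>_def \<kappa>'_def barrier_def using T[OF that]
        by (auto intro!: derivative_eq_intros dFs[OF that] simp: field_simps)
    qed
    have dD: "((\<lambda>s. D (y + s *\<^sub>R u) u) has_derivative (\<lambda>h. h *\<^sub>R D2 u u)) (at 0)"
    proof -
      have "((\<lambda>z. D z u) has_derivative (\<lambda>v. D2 v u)) (at (y + 0 *\<^sub>R u))" using D2 by simp
      from has_derivative_compose[OF line[of 0] this] show ?thesis
        by (simp add: linear_scale[OF has_derivative_linear[OF D2]])
    qed
    have dDs: "((\<lambda>s. fst (D (y + s *\<^sub>R u) u)) has_real_derivative fst (D2 u u)) (at 0)"
        "((\<lambda>s. snd (D (y + s *\<^sub>R u) u)) has_vector_derivative snd (D2 u u)) (at 0)"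
      using has_derivative_fst[OF dD] has_derivative_snd[OF dD]
      by (simp_all add: has_field_derivative_def has_vector_derivative_def mult_commute_abs)
    have inner: "((\<lambda>s. (snd (F (y + s *\<^sub>R u)) - x0) \<bullet> snd (D (y + s *\<^sub>R u) u)) has_real_derivative
        (x \<bullet> snd (D2 u u) + snd (D y u) \<bullet> snd (D y u))) (at 0)"
      using has_real_derivative_inner[OF x dDs(2)] \<delta> by (simp add: x_def)
    have "((\<lambda>s. b / (2 * sqrt (T (y + s *\<^sub>R u))) - 1) has_real_derivative k2 * fst (D y u)) (at 0)"
      using dFs(1)[of 0] \<delta> t unfolding k2_def t_def
      by (auto intro!: derivative_eq_intros simp: field_simps)
    from DERIV_add[OF DERIV_mult[OF this dDs(1)] DERIV_cmult[OF inner, of a]]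
    have \<kappa>': "(\<kappa>' has_real_derivative
        (k2 * fst (D y u)) * fst (D y u) + fst (D2 u u) * k1
        + a * (x \<bullet> snd (D2 u u) + snd (D y u) \<bullet> snd (D y u))) (at 0)"
      by (simp add: \<kappa>'_def[abs_def] k1_def t_def)
    have "\<kappa> 0 \<le> \<kappa> s" if "\<bar>s\<bar> < \<delta>" for s
      unfolding \<kappa>_def using min[of "y + s *\<^sub>R u"] inball[OF that] e by auto
    from local_min_second_derivative[OF \<delta> \<kappa> \<kappa>' this] show ?thesis
      by (simp add: \<kappa>'_def k1_def t_def x_def power2_eq_square algebra_simps)
  qed
  \<comment> \<open>The metric gradient of the barrier is \<open>(- k1, x / (2 t))\<close>; by
    \<open>grad\<close> below it equals \<open>\<Lambda>\<close> times \<open>N\<close>.\<close>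
  define \<Lambda> where "\<Lambda> = - k1 / fst N"
  have N0: "fst N > 0" using slope_less a t by (simp add: N_def graph_normal_def t_def)
  have Ns: "snd N = (fst N / (2 * a * t)) *\<^sub>R slope (D y)"
    by (simp add: N_def graph_normal_def t_def)
  have grad: "a *\<^sub>R x = - k1 *\<^sub>R slope (D y)"
  proof (rule vector_eq_rdot[THEN iffD1], rule allI)
    fix v
    obtain u where "snd (D y u) = v" using surj_snd by (metis surjD)
    then show "(a *\<^sub>R x) \<bullet> v = (- k1 *\<^sub>R slope (D y)) \<bullet> v"
      using *[of u] slope[of u] by simp
  qed
  then have grad': "a * (x \<bullet> v) = - k1 * (slope (D y) \<bullet> v)" for v
    by (metis inner_scaleR_left)
  \<comment> \<open>On vectors tangent to the level set of the barrier, its covariant Hessian is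
    \<open>- \<mu>\<close> times the metric.\<close>
  define \<mu> where "\<mu> = (b / (4 * sqrt t) - 1) / t"
  have \<mu>: "\<mu> > 0" using b t by (simp add: \<mu>_def t_def)
  have pos: "\<Lambda> * g (F y) (D y (A u)) (D y u) > 0" if "u \<noteq> 0" for u
  proof -
    let ?\<alpha> = "fst (D y u)" and ?\<omega> = "snd (D y u)" and ?d0 = "fst (D2 u u)" and ?d1 = "snd (D2 u u)"
    have N1: "2 * a * t * (snd N \<bullet> v) = fst N * (slope (D y) \<bullet> v)" for v
      using a t by (simp add: Ns)
    have gA: "g (F y) (D y (A u)) (D y u) = - (fst N * ?d0) + fst N * (slope (D y) \<bullet> ?d1)
         + fst N * ?\<alpha>\<^sup>2 / t - a * fst N * (?\<omega> \<bullet> ?\<omega>)"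
    proof -
      have "2 * a * t * ?\<alpha> * (snd N \<bullet> ?\<omega>) = fst N * ?\<alpha>\<^sup>2"
        using N1[of ?\<omega>] slope[of u] by (simp add: power2_eq_square)
      then have "2 * a * ?\<alpha> * (snd N \<bullet> ?\<omega>) = fst N * ?\<alpha>\<^sup>2 / t" using t by (simp add: field_simps)
      then show ?thesis
        using shape_operator(2)[OF F y, of u, folded N_def A_def] N1[of ?d1]
        unfolding t_def by (simp add: D2_def)
    qed
    have "\<Lambda> * g (F y) (D y (A u)) (D y u) = - k1 * (- ?d0 + slope (D y) \<bullet> ?d1 + ?\<alpha>\<^sup>2 / t - a * (?\<omega> \<bullet> ?\<omega>))"
      unfolding gA \<Lambda>_def using N0 t by (simp add: field_simps)
    also have "\<dots> = (k2 * ?\<alpha>\<^sup>2 + k1 * ?d0 + a * (?\<omega> \<bullet> ?\<omega>) + a * (x \<bullet> ?d1))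
        + \<mu> * (2 * a * t * (?\<omega> \<bullet> ?\<omega>) - ?\<alpha>\<^sup>2)"
    proof -
      \<comment> \<open>A single \<open>\<mu>\<close> accounts for both the time and the space part;
        this expresses that the level sets of the barrier are umbilic.\<close>
      have "k2 = - k1 / t + \<mu>" and "a + 2 * a * t * \<mu> = a * k1"
        using t by (simp_all add: k1_def k2_def \<mu>_def field_simps)
      then have "k2 * ?\<alpha>\<^sup>2 = (- k1 / t + \<mu>) * ?\<alpha>\<^sup>2"
          "(a + 2 * a * t * \<mu>) * (?\<omega> \<bullet> ?\<omega>) = a * k1 * (?\<omega> \<bullet> ?\<omega>)" by simp_all
      then show ?thesis unfolding grad' by (simp add: algebra_simps)
    qed
    finally have "\<Lambda> * g (F y) (D y (A u)) (D y u) \<ge> \<mu> * (2 * a * t * (?\<omega> \<bullet> ?\<omega>) - ?\<alpha>\<^sup>2)"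
      using *[of u] by simp
    moreover have "2 * a * t * (?\<omega> \<bullet> ?\<omega>) - ?\<alpha>\<^sup>2 > 0"
      using spacelike[OF that] by (simp add: t_def)
    ultimately show ?thesis using \<mu> by (meson mult_pos_pos order_less_le_trans)
  qed
  obtain Q :: "real ^ 'n \<Rightarrow> real ^ 'n" where Q: "linear Q" "inj Q"
      "\<And>u v. - (fst (D y (Q u)) * fst (D y (Q v))) + 2 * a * T y * (snd (D y (Q u)) \<bullet> snd (D y (Q v))) = u \<bullet> v"
    using orthonormal_frame by metis
  have linA: "linear A" using shape_operator(1)[OF F y] by (simp add: A_def)
  have "trace (matrix (\<lambda>u. \<Lambda> *\<^sub>R A u)) > 0"
  proof (rule trace_pos[of _ Q "\<lambda>u v. g (F y) (D y u) (D y v)"])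
    show "linear (\<lambda>u. \<Lambda> *\<^sub>R A u)"
      by (rule linear_compose_scale_right[OF linA])
    show "g (F y) (D y (Q u)) (D y (Q v)) = u \<bullet> v" for u v
      using Q(3) by (simp add: rw_metric_radiation[OF a less_imp_le[OF T_pos]])
    show "g (F y) (D y (\<Lambda> *\<^sub>R A u)) (D y u) > 0" if "u \<noteq> 0" for u
      using pos[OF that] by (simp add: linear_scale[OF linear] rw_metric_def algebra_simps)
  qed (use Q in auto)
  moreover have "trace (matrix (\<lambda>u. \<Lambda> *\<^sub>R A u)) = \<Lambda> * trace (matrix A)"
    by (simp add: trace_def matrix_def sum_distrib_left)
  ultimately show False using trA by simp
qed

end

section \<open>Piecewise smooth curves\<close>

lemma Ck_on_SucD:
  assumes "Ck_on (Suc k) f S" "open S" "x \<in> S"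
  shows "(f has_derivative frechet_derivative f (at x)) (at x)" "Ck_on k (\<lambda>x. frechet_derivative f (at x) v) S"
proof -
  have "f differentiable at x"
    using assms by (auto simp: differentiable_on_def at_within_open[OF assms(3,2)])
  then show "(f has_derivative frechet_derivative f (at x)) (at x)"
    using frechet_derivative_works by blast
qed (use assms in auto)

lemma Ck_on_imp_continuous_on: "Ck_on k f S \<Longrightarrow> continuous_on S f"
  by (cases k) (auto simp: differentiable_imp_continuous_on)

lemma continuous_on_linear_apply:
  fixes L :: "'a::topological_space \<Rightarrow> real ^ 'n \<Rightarrow> 'b::real_normed_vector"
  assumes lin: "\<And>x. x \<in> S \<Longrightarrow> linear (L x)" and L: "\<And>v. continuous_on S (\<lambda>x. L x v)"
    and d: "continuous_on S d"
  shows "continuous_on S (\<lambda>x. L x (d x))"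
proof -
  have "L x (d x) = (\<Sum>i\<in>UNIV. (d x $ i) *\<^sub>R L x (axis i 1))" if "x \<in> S" for x
  proof -
    have "L x (d x) = L x (\<Sum>i\<in>UNIV. (d x $ i) *\<^sub>R axis i 1)"
      by (simp add: scalar_mult_eq_scaleR[symmetric] basis_expansion)
    then show ?thesis
      by (simp add: linear_sum[OF lin[OF that]] linear_scale[OF lin[OF that]])
  qed
  moreover have "continuous_on S (\<lambda>x. \<Sum>i\<in>UNIV. (d x $ i) *\<^sub>R L x (axis i 1))"
    by (intro continuous_intros d L)
  ultimately show ?thesis by (simp cong: continuous_on_cong)
qed

lemma has_vector_derivative_transform_openin:
  assumes "openin (top_of_set S) V" "V \<subseteq> S" "s \<in> V" "\<And>r. r \<in> V \<Longrightarrow> f r = g r"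
    and "(f has_vector_derivative D) (at s within S)"
  shows "(g has_vector_derivative D) (at s within S)"
proof -
  obtain e where e: "e > 0" "\<And>r. r \<in> S \<Longrightarrow> dist r s < e \<Longrightarrow> r \<in> V"
    using assms(1,3) unfolding openin_euclidean_subtopology_iff by blast
  show ?thesis
    unfolding has_vector_derivative_def
    by (rule has_derivative_transform_within[OF assms(5)[unfolded has_vector_derivative_def] e(1)])
      (use assms e in auto)
qed

lemma integrable_on_partition:
  fixes f :: "real \<Rightarrow> 'a::banach"
  assumes "finite K" "0 \<in> K" "K \<subseteq> {0..1}" and "b \<in> K"
    and piece: "\<And>a b. a \<in> K \<Longrightarrow> b \<in> K \<Longrightarrow> a < b \<Longrightarrow> K \<inter> {a<..<b} = {} \<Longrightarrow> f integrable_on {a..b}"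
  shows "f integrable_on {0..b}"
  using \<open>b \<in> K\<close>
proof (induction "card {k \<in> K. k < b}" arbitrary: b rule: less_induct)
  case less
  show ?case
  proof (cases "b = 0")
    case False
    define J where "J = {k \<in> K. k < b}"
    have "b > 0" using less.prems False \<open>K \<subseteq> {0..1}\<close> by force
    then have J: "finite J" "J \<noteq> {}" using assms by (auto simp: J_def)
    define c where "c = Max J"
    have c: "c \<in> K" "c < b" using Max_in[OF J] by (auto simp: c_def J_def)
    have "K \<inter> {c<..<b} = {}"
      using Max_ge[OF J(1)] by (force simp: c_def J_def)
    then have 2: "f integrable_on {c..b}" using piece c less.prems by blast
    have "{k \<in> K. k < c} \<subset> {k \<in> K. k < b}" using c by force
    then have 1: "f integrable_on {0..c}"
      using less.hyps[of c] c \<open>finite K\<close> by (simp add: psubset_card_mono)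
    have "0 \<le> c" using c \<open>K \<subseteq> {0..1}\<close> by auto
    then show ?thesis
      using Henstock_Kurzweil_Integration.integrable_combine[OF _ _ 1 2] c by simp
  qed (use integrable_on_refl[of f 0] in simp)
qed

text \<open>Squaring removes the corner of the truncation at 0. This makes the bump function that
  bounds lengths from below differentiable across the edge of its support.\<close>

lemma DERIV_max0_power2: "((\<lambda>x::real. (max 0 x)\<^sup>2) has_real_derivative 2 * max 0 x) (at x)"
proof -
  consider "x < 0" | "x = 0" | "x > 0" by linarith
  then show ?thesis
  proof cases
    case 1
    have "((\<lambda>x::real. 0) has_real_derivative 0) (at x)" by simp
    then have "((\<lambda>x::real. (max 0 x)\<^sup>2) has_real_derivative 0) (at x)"
      by (rule has_field_derivative_transform_within_open[where S = "{..<0}"]) (use 1 in auto)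
    then show ?thesis using 1 by simp
  next
    case 3
    have "((\<lambda>x::real. x\<^sup>2) has_real_derivative 2 * x) (at x)" by (auto intro!: derivative_eq_intros)
    then have "((\<lambda>x::real. (max 0 x)\<^sup>2) has_real_derivative 2 * x) (at x)"
      by (rule has_field_derivative_transform_within_open[where S = "{0<..}"]) (use 3 in auto)
    then show ?thesis using 3 by simp
  next
    case 2
    have "(\<lambda>h::real. (max 0 h)\<^sup>2 / h) \<midarrow>0\<rightarrow> 0"
    proof (rule Lim_null_comparison)
      show "\<forall>\<^sub>F h in at 0. norm ((max 0 h)\<^sup>2 / h) \<le> \<bar>h\<bar>" for h :: real
        by (intro always_eventually allI) (auto simp: max_def power2_eq_square)
      show "(\<lambda>h::real. \<bar>h\<bar>) \<midarrow>0\<rightarrow> 0" by (intro tendsto_eq_intros) auto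
    qed
    then show ?thesis using 2 by (simp add: DERIV_def)
  qed
qed

lemma C1_curve_on_cong:
  assumes "C1_curve_on A a b \<gamma>" "\<And>s. s \<in> {a..b} \<Longrightarrow> \<delta> s = \<gamma> s"
  shows "C1_curve_on A a b \<delta>"
  unfolding C1_curve_on_def
proof
  fix c assume "c \<in> A"
  then obtain d where d: "continuous_on {s \<in> {a..b}. \<gamma> s \<in> fst c} d"
      "\<And>s. s \<in> {a..b} \<Longrightarrow> \<gamma> s \<in> fst c \<Longrightarrow> ((snd c \<circ> \<gamma>) has_vector_derivative d s) (at s within {a..b})"
    using assms(1) unfolding C1_curve_on_def by blast
  have "{s \<in> {a..b}. \<delta> s \<in> fst c} = {s \<in> {a..b}. \<gamma> s \<in> fst c}" using assms(2) by auto
  moreover have "((snd c \<circ> \<delta>) has_vector_derivative d s) (at s within {a..b})"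
    if "s \<in> {a..b}" "\<delta> s \<in> fst c" for s
    by (rule has_vector_derivative_transform[OF that(1) _ d(2)]) (use that assms(2) in auto)
  ultimately show "\<exists>d. continuous_on {s \<in> {a..b}. \<delta> s \<in> fst c} d \<and>
      (\<forall>s\<in>{a..b}. \<delta> s \<in> fst c \<longrightarrow> ((snd c \<circ> \<delta>) has_vector_derivative d s) (at s within {a..b}))"
    using d(1) by metis
qed

lemma C1_curve_on_affine:
  assumes "C1_curve_on A (m * a + k) (m * b + k) \<gamma>" "m > 0"
  shows "C1_curve_on A a b (\<lambda>s. \<gamma> (m * s + k))"
  unfolding C1_curve_on_def
proof
  let ?h = "\<lambda>s. m * s + k"
  fix c assume "c \<in> A"
  then obtain d where d: "continuous_on {s \<in> {?h a..?h b}. \<gamma> s \<in> fst c} d"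
      "\<And>s. s \<in> {?h a..?h b} \<Longrightarrow> \<gamma> s \<in> fst c \<Longrightarrow>
        ((snd c \<circ> \<gamma>) has_vector_derivative d s) (at s within {?h a..?h b})"
    using assms(1) unfolding C1_curve_on_def by blast
  have sub: "?h ` {a..b} \<subseteq> {?h a..?h b}" using \<open>m > 0\<close> by auto
  have "continuous_on {s \<in> {a..b}. \<gamma> (?h s) \<in> fst c} (\<lambda>s. m *\<^sub>R d (?h s))"
    by (intro continuous_intros continuous_on_compose2[OF d(1)]) (use sub in \<open>auto simp: image_subset_iff\<close>)
  moreover have "((snd c \<circ> (\<lambda>s. \<gamma> (?h s))) has_vector_derivative m *\<^sub>R d (?h s)) (at s within {a..b})"
    if s: "s \<in> {a..b}" "\<gamma> (?h s) \<in> fst c" for s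
  proof -
    have "(?h has_vector_derivative m) (at s within {a..b})"
      unfolding has_real_derivative_iff_has_vector_derivative[symmetric]
      by (auto intro!: derivative_eq_intros)
    moreover have "((snd c \<circ> \<gamma>) has_vector_derivative d (?h s)) (at (?h s) within ?h ` {a..b})"
      using has_vector_derivative_within_subset[OF d(2) sub] s sub by blast
    ultimately show ?thesis
      using vector_diff_chain_within[of ?h m s "{a..b}" "snd c \<circ> \<gamma>"] by (simp add: comp_def)
  qed
  ultimately show "\<exists>d. continuous_on {s \<in> {a..b}. \<gamma> (?h s) \<in> fst c} d \<and>
      (\<forall>s\<in>{a..b}. \<gamma> (?h s) \<in> fst c \<longrightarrow>
        ((snd c \<circ> (\<lambda>s. \<gamma> (?h s))) has_vector_derivative d s) (at s within {a..b}))"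
    by (intro exI[of _ "\<lambda>s. m *\<^sub>R d (?h s)"]) auto
qed

lemma piecewise_C1_curveE:
  assumes "piecewise_C1_curve X A \<gamma>"
  obtains K where "finite K" "{0, 1} \<subseteq> K" "K \<subseteq> {0..1}"
    "\<And>a b. a \<in> K \<Longrightarrow> b \<in> K \<Longrightarrow> a < b \<Longrightarrow> K \<inter> {a<..<b} = {} \<Longrightarrow> C1_curve_on A a b \<gamma>"
proof -
  from assms obtain K where K: "finite K" "{0, 1} \<subseteq> K" "K \<subseteq> {0..1}"
      "\<forall>a\<in>K. \<forall>b\<in>K. a < b \<and> K \<inter> {a<..<b} = {} \<longrightarrow> C1_curve_on A a b \<gamma>"
    unfolding piecewise_C1_curve_def by (elim conjE exE)
  show ?thesis by (rule that[OF K(1-3)]) (use K(4) in simp)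
qed

lemma piecewise_C1_curve_join:
  fixes \<gamma> \<delta> :: "real \<Rightarrow> 'm"
  assumes \<gamma>: "piecewise_C1_curve X A \<gamma>" and \<delta>: "piecewise_C1_curve X A \<delta>" and eq: "\<gamma> 1 = \<delta> 0"
  shows "piecewise_C1_curve X A (\<lambda>s. if s \<le> 1/2 then \<gamma> (2 * s) else \<delta> (2 * s - 1))" (is "piecewise_C1_curve X A ?j")
proof -
  obtain K where K: "finite K" "{0, 1} \<subseteq> K" "K \<subseteq> {0..1}"
      "\<And>a b. a \<in> K \<Longrightarrow> b \<in> K \<Longrightarrow> a < b \<Longrightarrow> K \<inter> {a<..<b} = {} \<Longrightarrow> C1_curve_on A a b \<gamma>"
    using piecewise_C1_curveE[OF \<gamma>] by metis
  obtain L where L: "finite L" "{0, 1} \<subseteq> L" "L \<subseteq> {0..1}"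
      "\<And>a b. a \<in> L \<Longrightarrow> b \<in> L \<Longrightarrow> a < b \<Longrightarrow> L \<inter> {a<..<b} = {} \<Longrightarrow> C1_curve_on A a b \<delta>"
    using piecewise_C1_curveE[OF \<delta>] by metis
  have "continuous_map (top_of_set {0..1}) X ?j"
  proof -
    have c1: "continuous_map (top_of_set {0..1}) X \<gamma>" and c2: "continuous_map (top_of_set {0..1}) X \<delta>"
      using \<gamma> \<delta> by (auto simp: piecewise_C1_curve_def pathin_def)
    have "continuous_map (top_of_set {0..1}) X (\<lambda>s. if s \<le> 1/2 then (\<lambda>s. \<gamma> (2 * s)) s else (\<lambda>s. \<delta> (2 * s - 1)) s)"
    proof (rule continuous_map_cases_le)
      show "continuous_map (subtopology (top_of_set {0..1}) {x \<in> topspace (top_of_set {0..1}). x \<le> 1/2}) X (\<lambda>s. \<gamma> (2 * s))"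
        by (rule continuous_map_compose[OF _ c1, unfolded comp_def])
          (auto simp: subtopology_subtopology intro!: continuous_intros)
      show "continuous_map (subtopology (top_of_set {0..1}) {x \<in> topspace (top_of_set {0..1}). 1/2 \<le> x}) X (\<lambda>s. \<delta> (2 * s - 1))"
        by (rule continuous_map_compose[OF _ c2, unfolded comp_def])
          (auto simp: subtopology_subtopology intro!: continuous_intros)
      show "\<gamma> (2 * s) = \<delta> (2 * s - 1)" if "s = 1/2" for s
        unfolding that using eq by simp
    qed auto
    then show ?thesis by simp
  qed
  then have "pathin X ?j" by (simp add: pathin_def)
  define M where "M = (\<lambda>x. x / 2) ` K \<union> (\<lambda>x. (x + 1) / 2) ` L"
  \<comment> \<open>Since the junction parameter belongs to \<open>M\<close>, no interval of the
    partition straddles it and each piece lies on one of the two curves.\<close>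
  have half: "1/2 \<in> M" using K(2) unfolding M_def by force
  have low: "2 * x \<in> K" if "x \<in> M" "x \<le> 1/2" for x
    using that K(2) L(3) unfolding M_def by force
  have high: "2 * x - 1 \<in> L" if "x \<in> M" "x \<ge> 1/2" for x
  proof -
    from that consider k where "k \<in> K" "x = k / 2" | l where "l \<in> L" "x = (l + 1) / 2"
      unfolding M_def by blast
    then show ?thesis
    proof cases
      case 1
      then have "k = 1" using that K(3) by force
      then have "2 * x - 1 = 0" using 1 by simp
      then show ?thesis using L(2) by simp
    next
      case 2
      then have "2 * x - 1 = l" by simp
      then show ?thesis using 2(1) by metis
    qed
  qed
  have "C1_curve_on A a b ?j" if ab: "a \<in> M" "b \<in> M" "a < b" "M \<inter> {a<..<b} = {}" for a b
  proof (cases "b \<le> 1/2")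
    case True
    have "K \<inter> {2 * a<..<2 * b} = {}"
    proof (rule ccontr)
      assume "\<not> ?thesis"
      then obtain k where "k \<in> K" "2 * a < k" "k < 2 * b" by auto
      then have "k / 2 \<in> M \<inter> {a<..<b}" by (auto simp: M_def)
      then show False using ab by blast
    qed
    then have "C1_curve_on A (2 * a + 0) (2 * b + 0) \<gamma>"
      using K(4)[OF low low] ab True by simp
    from C1_curve_on_affine[OF this] show ?thesis
      by (rule C1_curve_on_cong) (use True in auto)
  next
    case False
    then have a: "a \<ge> 1/2" using ab half by (metis Int_iff empty_iff greaterThanLessThan_iff not_le)
    have "L \<inter> {2 * a - 1<..<2 * b - 1} = {}"
    proof (rule ccontr)
      assume "\<not> ?thesis"
      then obtain k where "k \<in> L" "2 * a - 1 < k" "k < 2 * b - 1" by auto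
      then have "(k + 1) / 2 \<in> M \<inter> {a<..<b}" by (auto simp: M_def)
      then show False using ab by blast
    qed
    then have "C1_curve_on A (2 * a + - 1) (2 * b + - 1) \<delta>"
      using L(4)[OF high high] ab False a by simp
    from C1_curve_on_affine[OF this] show ?thesis
    proof (rule C1_curve_on_cong)
      show "?j s = \<delta> (2 * s + - 1)" if "s \<in> {a..b}" for s
      \<comment> \<open>At the junction the conditional still takes its first branch, and
        \<open>eq\<close> identifies the two values.\<close>
      proof (cases "s = 1/2")
        case True then show ?thesis unfolding True using eq by simp
      qed (use that a in auto)
    qed simp
  qed
  moreover have "finite M" "{0, 1} \<subseteq> M" "M \<subseteq> {0..1}"
    using K L unfolding M_def by (auto simp: image_iff intro: bexI[of _ 0] bexI[of _ 1])
  ultimately show ?thesis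
    using \<open>pathin X ?j\<close> unfolding piecewise_C1_curve_def by blast
qed

section \<open>Manifolds and their charts\<close>

locale manifold =
  fixes X :: "'m topology" and A :: "('m, 'n::finite) chart set"
  assumes manifold: "smooth_manifold X A"
begin

lemma Hausdorff: "Hausdorff_space X"
  using manifold by (simp add: smooth_manifold_def)

lemma charts_cover: "p \<in> topspace X \<Longrightarrow> \<exists>c\<in>A. p \<in> fst c"
  using manifold by (auto simp: smooth_manifold_def)

lemma chart_at: "p \<in> topspace X \<Longrightarrow> chart_at A p \<in> A \<and> p \<in> fst (chart_at A p)"
  unfolding chart_at_def using charts_cover[of p] by (metis (mono_tags, lifting) someI_ex)

context
  fixes c assumes c: "c \<in> A"
begin

lemma chart: "is_chart X c"
  using manifold c by (simp add: smooth_manifold_def)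

lemma openin_chart: "openin X (fst c)" and open_coords: "open (coords c)"
  using chart by (auto simp: is_chart_def)

lemma chart_subset: "fst c \<subseteq> topspace X"
  using openin_chart openin_subset by blast

lemma topspace_chart: "topspace (subtopology X (fst c)) = fst c"
  using chart_subset by auto

lemma chart_homeomorphic_map: "homeomorphic_map (subtopology X (fst c)) (top_of_set (coords c)) (snd c)"
  using chart by (simp add: is_chart_def)

lemma inj_on_chart: "inj_on (snd c) (fst c)"
  using homeomorphic_imp_injective_map[OF chart_homeomorphic_map] topspace_chart by simp

lemma param_chart: "p \<in> fst c \<Longrightarrow> param c (snd c p) = p"
  by (simp add: param_def inj_on_chart)

lemma chart_in_coords: "p \<in> fst c \<Longrightarrow> snd c p \<in> coords c"
  by (simp add: coords_def)

lemma chart_param: "y \<in> coords c \<Longrightarrow> snd c (param c y) = y"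
  by (simp add: coords_def param_def f_inv_into_f)

lemma param_in_chart: "y \<in> coords c \<Longrightarrow> param c y \<in> fst c"
  by (simp add: coords_def param_def inv_into_into)

lemma continuous_map_chart: "continuous_map (subtopology X (fst c)) euclidean (snd c)"
  using homeomorphic_imp_continuous_map[OF chart_homeomorphic_map] continuous_map_into_fulltopology
  by blast

lemma continuous_map_param: "continuous_map (top_of_set (coords c)) X (param c)"
proof -
  obtain g where g: "homeomorphic_maps (subtopology X (fst c)) (top_of_set (coords c)) (snd c) g"
    using chart_homeomorphic_map homeomorphic_map_maps by blast
  then have "continuous_map (top_of_set (coords c)) (subtopology X (fst c)) g"
    by (simp add: homeomorphic_maps_def)
  moreover have "g y = param c y" if "y \<in> coords c" for y
  proof -
    have "g (snd c (param c y)) = param c y"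
      using g param_in_chart[OF that] topspace_chart by (auto simp: homeomorphic_maps_def)
    then show ?thesis using chart_param[OF that] by simp
  qed
  ultimately have "continuous_map (top_of_set (coords c)) (subtopology X (fst c)) (param c)"
    by (rule continuous_map_eq) simp
  then show ?thesis using continuous_map_into_fulltopology by blast
qed

lemma openin_chart_preimage:
  assumes "open W" shows "openin X {p \<in> fst c. snd c p \<in> W}"
proof -
  have "openin (subtopology X (fst c)) {p \<in> topspace (subtopology X (fst c)). snd c p \<in> W}"
    using openin_continuous_map_preimage[OF continuous_map_chart] assms by simp
  then show ?thesis
    using topspace_chart openin_chart openin_trans_full by fastforce
qed

lemma openin_param_image:
  assumes "open W" "W \<subseteq> coords c" shows "openin X (param c ` W)"
proof -
  have "param c ` W = {p \<in> fst c. snd c p \<in> W}"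
  proof safe
    fix y assume "y \<in> W"
    then show "param c y \<in> fst c" "snd c (param c y) \<in> W"
      using assms(2) param_in_chart chart_param by auto
  next
    fix p assume "p \<in> fst c" "snd c p \<in> W"
    then show "p \<in> param c ` W" using param_chart by (metis image_eqI)
  qed
  then show ?thesis using openin_chart_preimage[OF assms(1)] by simp
qed

end

text \<open>The common ground of chart parametrisations and of sections of the projection to
  \<open>R^n\<close>: both turn line segments into admissible curves. Regularity is demanded in
  every chart that the image meets, as in \<open>C1_curve_on\<close>.\<close>

definition C1_map :: "(real ^ 'k \<Rightarrow> 'm) \<Rightarrow> (real ^ 'k) set \<Rightarrow> bool" where
  "C1_map \<sigma> S \<longleftrightarrow> continuous_map (top_of_set S) X \<sigma> \<and>
     (\<forall>c\<in>A. \<exists>D. \<forall>z\<in>S. \<sigma> z \<in> fst c \<longrightarrow> ((snd c \<circ> \<sigma>) has_derivative D z) (at z) \<and>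
        (\<forall>v. continuous_on {z \<in> S. \<sigma> z \<in> fst c} (\<lambda>z. D z v)))"

lemma C1_map_param:
  assumes c: "c \<in> A"
  shows "C1_map (param c) (coords c)"
  unfolding C1_map_def
proof (intro conjI ballI continuous_map_param c)
  fix d assume d: "d \<in> A"
  let ?W = "snd c ` (fst c \<inter> fst d)"
  have W: "{z \<in> coords c. param c z \<in> fst d} = ?W"
    using param_in_chart[OF c] chart_param[OF c] param_chart[OF c] chart_in_coords[OF c] by force
  have "open ?W"
  proof -
    have "openin (top_of_set (coords c)) {z \<in> topspace (top_of_set (coords c)). param c z \<in> fst d}"
      using openin_continuous_map_preimage[OF continuous_map_param[OF c]] openin_chart[OF d] by blast
    then show ?thesis using open_coords[OF c] W openin_open_trans by auto
  qed
  have ck: "Ck_on (Suc 0) (snd d \<circ> param c) ?W"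
    using manifold c d unfolding smooth_manifold_def smooth_on_def by blast
  show "\<exists>D. \<forall>z\<in>coords c. param c z \<in> fst d \<longrightarrow> ((snd d \<circ> param c) has_derivative D z) (at z) \<and>
        (\<forall>v. continuous_on {z \<in> coords c. param c z \<in> fst d} (\<lambda>z. D z v))"
  proof (intro exI ballI impI)
    fix z assume "z \<in> coords c" "param c z \<in> fst d"
    then have z: "z \<in> ?W" using W by blast
    show "((snd d \<circ> param c) has_derivative frechet_derivative (snd d \<circ> param c) (at z)) (at z) \<and>
        (\<forall>v. continuous_on {z \<in> coords c. param c z \<in> fst d} (\<lambda>z. frechet_derivative (snd d \<circ> param c) (at z) v))"
      unfolding W using Ck_on_SucD[OF ck \<open>open ?W\<close> z] by simp
  qed
qed

lemma C1_map_segment: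
  assumes \<sigma>: "C1_map \<sigma> S" and sub: "closed_segment x y \<subseteq> S"
  shows "piecewise_C1_curve X A (\<lambda>s. \<sigma> (x + s *\<^sub>R (y - x)))"
proof -
  let ?l = "\<lambda>s. x + s *\<^sub>R (y - x)" let ?\<gamma> = "\<lambda>s. \<sigma> (?l s)"
  have l: "?l s \<in> S" if "s \<in> {0..1}" for s
    using that sub unfolding closed_segment_def by (force simp: algebra_simps)
  have contl: "continuous_on T ?l" for T by (intro continuous_intros)
  have "continuous_map (top_of_set {0..1}) X ?\<gamma>"
  proof -
    have "continuous_map (top_of_set {0..1}) (top_of_set S) ?l"
      using l contl by (auto simp: image_subset_iff)
    moreover have "continuous_map (top_of_set S) X \<sigma>" using \<sigma> by (simp add: C1_map_def)
    ultimately have "continuous_map (top_of_set {0..1}) X (\<sigma> \<circ> ?l)" by (rule continuous_map_compose)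
    then show ?thesis by (simp only: comp_def)
  qed
  moreover have "C1_curve_on A 0 1 ?\<gamma>"
    unfolding C1_curve_on_def
  proof
    fix c assume "c \<in> A"
    then have "\<exists>D. \<forall>z\<in>S. \<sigma> z \<in> fst c \<longrightarrow> ((snd c \<circ> \<sigma>) has_derivative D z) (at z) \<and>
        (\<forall>v. continuous_on {z \<in> S. \<sigma> z \<in> fst c} (\<lambda>z. D z v))"
      using \<sigma> by (simp add: C1_map_def)
    then obtain D where "\<forall>z\<in>S. \<sigma> z \<in> fst c \<longrightarrow> ((snd c \<circ> \<sigma>) has_derivative D z) (at z) \<and>
        (\<forall>v. continuous_on {z \<in> S. \<sigma> z \<in> fst c} (\<lambda>z. D z v))" ..
    then have D: "z \<in> S \<Longrightarrow> \<sigma> z \<in> fst c \<Longrightarrow> ((snd c \<circ> \<sigma>) has_derivative D z) (at z)"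
        "z \<in> S \<Longrightarrow> \<sigma> z \<in> fst c \<Longrightarrow> continuous_on {z \<in> S. \<sigma> z \<in> fst c} (\<lambda>z. D z v)" for z v
      by auto
    show "\<exists>d. continuous_on {s \<in> {0..1}. ?\<gamma> s \<in> fst c} d \<and>
      (\<forall>s\<in>{0..1}. ?\<gamma> s \<in> fst c \<longrightarrow> ((snd c \<circ> ?\<gamma>) has_vector_derivative d s) (at s within {0..1}))"
    proof (intro exI conjI ballI impI)
      show "continuous_on {s \<in> {0..1}. ?\<gamma> s \<in> fst c} (\<lambda>s. D (?l s) (y - x))"
      proof (cases "{s \<in> {0..1}. ?\<gamma> s \<in> fst c} = {}")
        case False
        then have "continuous_on {z \<in> S. \<sigma> z \<in> fst c} (\<lambda>z. D z (y - x))" using D(2) l by blast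
        from continuous_on_compose2[OF this contl[of "{s \<in> {0..1}. ?\<gamma> s \<in> fst c}"]] show ?thesis
          using l by (simp add: image_subset_iff)
      qed (simp only: continuous_on_empty)
      fix s :: real assume s: "s \<in> {0..1}" "?\<gamma> s \<in> fst c"
      have "(?l has_derivative (\<lambda>h. h *\<^sub>R (y - x))) (at s within {0..1})"
        by (auto intro!: derivative_eq_intros)
      from has_derivative_compose[OF this D(1)[OF l[OF s(1)] s(2)]]
      show "((snd c \<circ> ?\<gamma>) has_vector_derivative D (?l s) (y - x)) (at s within {0..1})"
        using linear_scale[OF has_derivative_linear[OF D(1)[OF l[OF s(1)] s(2)]]]
        by (simp add: has_vector_derivative_def comp_def)
    qed
  qed
  ultimately show ?thesis
    unfolding piecewise_C1_curve_def pathin_def by (intro conjI exI[of _ "{0, 1}"]) (auto split: if_splits)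
qed

text \<open>The points reachable from \<open>p\<close> form an open and closed set, since the image
  of a coordinate ball is a neighbourhood in which any two points are joined by the image of a
  segment. It ensures that the infimum in \<open>riemannian_dist\<close> ranges over a nonempty
  set.\<close>

lemma connected_by_curve:
  assumes "connected_space X" and p: "p \<in> topspace X" and q: "q \<in> topspace X"
  shows "\<exists>\<gamma>. piecewise_C1_curve X A \<gamma> \<and> \<gamma> 0 = p \<and> \<gamma> 1 = q"
proof -
  define R where "R = {q \<in> topspace X. \<exists>\<gamma>. piecewise_C1_curve X A \<gamma> \<and> \<gamma> 0 = p \<and> \<gamma> 1 = q}"
  have local: "\<exists>V. openin X V \<and> q \<in> V \<and>
      (\<forall>u\<in>V. \<forall>v\<in>V. \<exists>\<gamma>. piecewise_C1_curve X A \<gamma> \<and> \<gamma> 0 = u \<and> \<gamma> 1 = v)" if q: "q \<in> topspace X" for q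
  proof -
    obtain c where c: "c \<in> A" "q \<in> fst c" using charts_cover[OF q] by blast
    obtain r where r: "r > 0" "ball (snd c q) r \<subseteq> coords c"
      using open_coords[OF c(1)] chart_in_coords[OF c] by (meson openE)
    let ?V = "param c ` ball (snd c q) r"
    have "\<exists>\<gamma>. piecewise_C1_curve X A \<gamma> \<and> \<gamma> 0 = param c y \<and> \<gamma> 1 = param c z"
      if "y \<in> ball (snd c q) r" "z \<in> ball (snd c q) r" for y z
    proof -
      have "closed_segment y z \<subseteq> coords c"
        using closed_segment_subset[OF that convex_ball] r(2) by blast
      from C1_map_segment[OF C1_map_param[OF c(1)] this] show ?thesis
        by (intro exI[of _ "\<lambda>s. param c (y + s *\<^sub>R (z - y))"]) simp
    qed
    moreover have "q \<in> ?V" using r(1) param_chart[OF c] by (metis centre_in_ball image_eqI)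
    ultimately show ?thesis
      using openin_param_image[OF c(1) open_ball r(2)] by (intro exI[of _ ?V]) blast
  qed
  have trans: "\<exists>\<gamma>. piecewise_C1_curve X A \<gamma> \<and> \<gamma> 0 = u \<and> \<gamma> 1 = w"
    if "piecewise_C1_curve X A \<gamma> \<and> \<gamma> 0 = u \<and> \<gamma> 1 = v" "piecewise_C1_curve X A \<delta> \<and> \<delta> 0 = v \<and> \<delta> 1 = w"
    for \<gamma> \<delta> u v w
    by (intro exI[of _ "\<lambda>s. if s \<le> 1/2 then \<gamma> (2 * s) else \<delta> (2 * s - 1)"] conjI piecewise_C1_curve_join)
      (use that in auto)
  have sub: "V \<subseteq> topspace X" if "openin X V" for V using that openin_subset by blast
  have "openin X R"
  proof (subst openin_subopen, intro ballI)
    fix q assume q: "q \<in> R"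
    then obtain V where V: "openin X V" "q \<in> V"
        "\<And>u v. u \<in> V \<Longrightarrow> v \<in> V \<Longrightarrow> \<exists>\<gamma>. piecewise_C1_curve X A \<gamma> \<and> \<gamma> 0 = u \<and> \<gamma> 1 = v"
      using local[of q] unfolding R_def by blast
    have "V \<subseteq> R"
    proof
      fix v assume v: "v \<in> V"
      obtain \<delta> where "piecewise_C1_curve X A \<delta> \<and> \<delta> 0 = q \<and> \<delta> 1 = v" using V v by meson
      moreover obtain \<gamma> where "piecewise_C1_curve X A \<gamma> \<and> \<gamma> 0 = p \<and> \<gamma> 1 = q" using q R_def by blast
      ultimately show "v \<in> R" using trans v sub[OF V(1)] unfolding R_def by blast
    qed
    then show "\<exists>T. openin X T \<and> q \<in> T \<and> T \<subseteq> R" using V by blast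
  qed
  moreover have "openin X (topspace X - R)"
  proof (subst openin_subopen, intro ballI)
    fix q assume q: "q \<in> topspace X - R"
    then obtain V where V: "openin X V" "q \<in> V"
        "\<And>u v. u \<in> V \<Longrightarrow> v \<in> V \<Longrightarrow> \<exists>\<gamma>. piecewise_C1_curve X A \<gamma> \<and> \<gamma> 0 = u \<and> \<gamma> 1 = v"
      using local[of q] by blast
    have "V \<inter> R = {}"
    proof (rule ccontr)
      assume "V \<inter> R \<noteq> {}"
      then obtain v where v: "v \<in> V" "v \<in> R" by blast
      obtain \<delta> where "piecewise_C1_curve X A \<delta> \<and> \<delta> 0 = v \<and> \<delta> 1 = q" using V v by meson
      moreover obtain \<gamma> where "piecewise_C1_curve X A \<gamma> \<and> \<gamma> 0 = p \<and> \<gamma> 1 = v" using v R_def by blast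
      ultimately show False using trans q unfolding R_def by blast
    qed
    then show "\<exists>T. openin X T \<and> q \<in> T \<and> T \<subseteq> topspace X - R" using V sub[OF V(1)] by blast
  qed
  moreover have "p \<in> R"
  proof -
    obtain V where "p \<in> V"
        "\<forall>u\<in>V. \<forall>v\<in>V. \<exists>\<gamma>. piecewise_C1_curve X A \<gamma> \<and> \<gamma> 0 = u \<and> \<gamma> 1 = v"
      using local[OF p] by blast
    then show ?thesis using p unfolding R_def by blast
  qed
  ultimately have "R = topspace X"
    using \<open>connected_space X\<close> R_def unfolding connected_space_def by blast
  then show ?thesis using q R_def by blast
qed

end

section \<open>Length and distance on the hypersurface\<close>

lemma partition_interval:
  fixes K :: "real set"
  assumes "finite K" "{0, 1} \<subseteq> K" "K \<subseteq> {0..1}" "s \<in> {0..1} - K"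
  obtains a b where "a \<in> K" "b \<in> K" "a < s" "s < b" "K \<inter> {a<..<b} = {}"
proof -
  have s: "0 < s" "s < 1" using assms by (auto simp: less_le)
  let ?L = "{k \<in> K. k < s}" and ?R = "{k \<in> K. s < k}"
  have L: "finite ?L" "?L \<noteq> {}" and R: "finite ?R" "?R \<noteq> {}" using assms s by auto
  show ?thesis
  proof (rule that)
    show "Max ?L \<in> K" "Max ?L < s" using Max_in[OF L] by auto
    show "Min ?R \<in> K" "s < Min ?R" using Min_in[OF R] by auto
    show "K \<inter> {Max ?L<..<Min ?R} = {}"
    proof (rule ccontr)
      assume "\<not> ?thesis"
      then obtain k where k: "k \<in> K" "Max ?L < k" "k < Min ?R" by auto
      then have "k \<noteq> s" using assms by auto
      then consider "k \<in> ?L" | "k \<in> ?R" using k by fastforce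
      then show False
      proof cases
        case 1 then show False using Max_ge[OF L(1)] k by force
      next
        case 2 then show False using Min_le[OF R(1)] k by force
      qed
    qed
  qed
qed

locale radiation_hypersurface =
  fixes a :: real and X :: "'m topology" and A :: "('m, 'n::finite) chart set"
    and \<psi> :: "'m \<Rightarrow> real \<times> (real ^ 'n)"
  assumes a: "a > 0" and hypersurface: "spacelike_hypersurface {0<..} (\<lambda>t. sqrt (2 * a * t)) X A \<psi>"

sublocale radiation_hypersurface \<subseteq> manifold X A
  by unfold_locales (use hypersurface in \<open>simp add: spacelike_hypersurface_def\<close>)

context radiation_hypersurface
begin

abbreviation g :: "real \<times> (real ^ 'n) \<Rightarrow> real \<times> (real ^ 'n) \<Rightarrow> real \<times> (real ^ 'n) \<Rightarrow> real" where
  "g \<equiv> rw_metric (\<lambda>t. sqrt (2 * a * t))"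

abbreviation G :: "('m, 'n) chart_metric" where "G \<equiv> induced_metric g \<psi>"

abbreviation D :: "('m, 'n) chart \<Rightarrow> real ^ 'n \<Rightarrow> real ^ 'n \<Rightarrow> real \<times> (real ^ 'n)" where
  "D c z \<equiv> frechet_derivative (\<psi> \<circ> param c) (at z)"

lemma time_pos: "p \<in> topspace X \<Longrightarrow> fst (\<psi> p) > 0"
  using hypersurface by (force simp: spacelike_hypersurface_def)

lemma Ck_embedding: "c \<in> A \<Longrightarrow> Ck_on k (\<psi> \<circ> param c) (coords c)"
  using hypersurface by (simp add: spacelike_hypersurface_def immersion_def smooth_on_def)

lemma induced_metric_pos: "c \<in> A \<Longrightarrow> z \<in> coords c \<Longrightarrow> u \<noteq> 0 \<Longrightarrow> G c z u u > 0"
  using hypersurface by (simp add: spacelike_hypersurface_def riemannian_metric_def)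

lemma spacelike_immersion:
  assumes c: "c \<in> A"
  shows "spacelike_immersion a (coords c) (\<psi> \<circ> param c) (D c)"
proof (rule spacelike_immersion.intro)
  show "open (coords c)" by (rule open_coords[OF c])
  note ck = Ck_on_SucD[OF Ck_embedding[OF c] open_coords[OF c]]
  fix z assume z: "z \<in> coords c"
  show "((\<psi> \<circ> param c) has_derivative D c z) (at z)" by (rule ck(1)[OF z])
  show "(\<lambda>z. D c z v) differentiable at z" for v
    using Ck_on_SucD(1)[OF ck(2)[OF z] open_coords[OF c] z] by (rule differentiableI)
  show "spacelike_tangent a (fst ((\<psi> \<circ> param c) z)) (D c z)"
  proof (rule spacelike_tangent.intro)
    show "a > 0" by (rule a)
    have "param c z \<in> topspace X" using param_in_chart[OF c z] chart_subset[OF c] by blast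
    then show t: "fst ((\<psi> \<circ> param c) z) > 0" using time_pos by simp
    show "linear (D c z)" by (rule has_derivative_linear[OF ck(1)[OF z]])
    show "(fst (D c z u))\<^sup>2 < 2 * a * fst ((\<psi> \<circ> param c) z) * (snd (D c z u) \<bullet> snd (D c z u))"
      if "u \<noteq> 0" for u
      using induced_metric_pos[OF c z that] a t
      by (simp add: induced_metric_def rw_metric_radiation power2_eq_square)
  qed
qed

lemma embedding_has_derivative: "c \<in> A \<Longrightarrow> z \<in> coords c \<Longrightarrow> ((\<psi> \<circ> param c) has_derivative D c z) (at z)"
  using spacelike_immersion.deriv spacelike_immersion by blast

lemma continuous_on_D: "c \<in> A \<Longrightarrow> continuous_on (coords c) (\<lambda>z. D c z v)"
  using spacelike_immersion.deriv_differentiable[OF spacelike_immersion]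
  by (simp add: differentiable_imp_continuous_on differentiable_on_def differentiable_at_withinI)

lemma linear_D: "c \<in> A \<Longrightarrow> z \<in> coords c \<Longrightarrow> linear (D c z)"
  by (rule has_derivative_linear[OF embedding_has_derivative])

lemma continuous_map_embedding: "continuous_map X euclidean \<psi>"
proof (rule pasting_lemma[where I = A and T = fst and f = "\<lambda>_. \<psi>"])
  fix c assume c: "c \<in> A"
  have "continuous_map (subtopology X (fst c)) (top_of_set (coords c)) (snd c)"
    by (rule homeomorphic_imp_continuous_map[OF chart_homeomorphic_map[OF c]])
  moreover have "continuous_map (top_of_set (coords c)) euclidean (\<psi> \<circ> param c)"
    using Ck_on_imp_continuous_on[OF Ck_embedding[OF c]] by simp
  ultimately have "continuous_map (subtopology X (fst c)) euclidean (\<psi> \<circ> param c \<circ> snd c)"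
    by (rule continuous_map_compose)
  then show "continuous_map (subtopology X (fst c)) euclidean \<psi>"
    by (rule continuous_map_eq) (simp add: param_chart[OF c])
  show "openin X (fst c)" by (rule openin_chart[OF c])
qed (use charts_cover in fastforce)+

section \<open>Speed of curves, computed through the embedding\<close>

lemma curve_embedding_derivative:
  assumes c: "c \<in> A" and "openin (top_of_set I) V" "s \<in> V" and V: "\<And>r. r \<in> V \<Longrightarrow> \<gamma> r \<in> fst c"
    and v: "((snd c \<circ> \<gamma>) has_vector_derivative v) (at s within I)"
  shows "((\<psi> \<circ> \<gamma>) has_vector_derivative D c (snd c (\<gamma> s)) v) (at s within I)"
proof (rule has_vector_derivative_transform_openin[OF assms(2) _ assms(3)])
  show "V \<subseteq> I" using assms(2) openin_imp_subset by blast
  have y: "snd c (\<gamma> s) \<in> coords c" using chart_in_coords[OF c V[OF assms(3)]] .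
  show "((\<psi> \<circ> param c) \<circ> (snd c \<circ> \<gamma>) has_vector_derivative D c (snd c (\<gamma> s)) v) (at s within I)"
    using has_derivative_compose[OF v[unfolded has_vector_derivative_def comp_def] embedding_has_derivative[OF c y]]
      linear_scale[OF linear_D[OF c y]]
    by (simp add: has_vector_derivative_def comp_def)
  show "((\<psi> \<circ> param c) \<circ> (snd c \<circ> \<gamma>)) r = (\<psi> \<circ> \<gamma>) r" if "r \<in> V" for r
    using param_chart[OF c V[OF that]] by simp
qed

text \<open>In whatever chart it is computed, the speed is the length of the derivative of
  \<open>\<psi> \<circ> \<gamma>\<close>, which mentions no chart. So the arbitrary choice in
  \<open>chart_at\<close> does not affect it, and no transition map has to be
  differentiated.\<close>

lemma curve_speed_eq:
  assumes c: "c \<in> A" "\<gamma> s \<in> fst c" and \<gamma>: "continuous_map (top_of_set I) X \<gamma>" "s \<in> interior I"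
    and v: "\<And>d. d \<in> A \<Longrightarrow> \<gamma> s \<in> fst d \<Longrightarrow> ((snd d \<circ> \<gamma>) has_vector_derivative v d) (at s)"
  shows "((\<psi> \<circ> \<gamma>) has_vector_derivative D c (snd c (\<gamma> s)) (v c)) (at s)"
    and "curve_speed A G \<gamma> s = sqrt (G c (snd c (\<gamma> s)) (v c) (v c))"
proof -
  have deriv: "((\<psi> \<circ> \<gamma>) has_vector_derivative D d (snd d (\<gamma> s)) (v d)) (at s)"
    if d: "d \<in> A" "\<gamma> s \<in> fst d" for d
  proof -
    have "s \<in> I" using \<gamma>(2) interior_subset by blast
    have "openin (top_of_set I) {r \<in> topspace (top_of_set I). \<gamma> r \<in> fst d}"
      by (rule openin_continuous_map_preimage[OF \<gamma>(1) openin_chart[OF d(1)]])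
    then have "openin (top_of_set I) {r \<in> I. \<gamma> r \<in> fst d}" by simp
    then have "((\<psi> \<circ> \<gamma>) has_vector_derivative D d (snd d (\<gamma> s)) (v d)) (at s within I)"
      by (rule curve_embedding_derivative[OF d(1) _ _ _ has_vector_derivative_at_within[OF v[OF d]]])
        (use d \<open>s \<in> I\<close> in simp_all)
    then show ?thesis unfolding at_within_interior[OF \<gamma>(2)] .
  qed
  show "((\<psi> \<circ> \<gamma>) has_vector_derivative D c (snd c (\<gamma> s)) (v c)) (at s)" by (rule deriv[OF c])
  have "\<gamma> s \<in> topspace X" using c chart_subset by blast
  define e where "e = chart_at A (\<gamma> s)"
  have e: "e \<in> A" "\<gamma> s \<in> fst e" using chart_at[OF \<open>\<gamma> s \<in> topspace X\<close>] by (auto simp: e_def)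
  have "D e (snd e (\<gamma> s)) (v e) = D c (snd c (\<gamma> s)) (v c)"
    using vector_derivative_unique_at[OF deriv[OF e] deriv[OF c]] .
  moreover have "vector_derivative (snd e \<circ> \<gamma>) (at s) = v e"
    by (rule vector_derivative_at[OF v[OF e]])
  ultimately show "curve_speed A G \<gamma> s = sqrt (G c (snd c (\<gamma> s)) (v c) (v c))"
    using e c by (simp add: curve_speed_def Let_def induced_metric_def param_chart flip: e_def)
qed

lemma continuous_on_metric:
  assumes "continuous_on S p" "continuous_on S u" "continuous_on S v"
  shows "continuous_on S (\<lambda>x. g (p x) (u x) (v x))"
  unfolding rw_metric_def by (intro continuous_intros assms)

text \<open>The chart chosen by \<open>curve_speed\<close> may jump from point to point, so
  continuity is obtained for \<open>W\<close>, the derivative of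
  \<open>\<psi> \<circ> \<gamma>\<close>, one-sided at the endpoints. The length of \<open>W\<close>
  is continuous on the closed interval and equals the speed except possibly at the two
  endpoints.\<close>

lemma C1_curve_speed_integrable:
  assumes C1: "C1_curve_on A \<alpha> \<beta> \<gamma>" and \<gamma>: "continuous_map (top_of_set {\<alpha>..\<beta>}) X \<gamma>"
  shows "curve_speed A G \<gamma> integrable_on {\<alpha>..\<beta>}"
proof (cases "\<alpha> < \<beta>")
  case True
  let ?I = "{\<alpha>..\<beta>}"
  define W where "W s = vector_derivative (\<psi> \<circ> \<gamma>) (at s within ?I)" for s
  have op: "openin (top_of_set ?I) {r \<in> ?I. \<gamma> r \<in> fst c}" if "c \<in> A" for c
    using openin_continuous_map_preimage[OF \<gamma> openin_chart[OF that]] by simp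
  have C1': "\<exists>d. continuous_on {s \<in> ?I. \<gamma> s \<in> fst c} d \<and>
      (\<forall>s\<in>?I. \<gamma> s \<in> fst c \<longrightarrow> ((snd c \<circ> \<gamma>) has_vector_derivative d s) (at s within ?I))" if "c \<in> A" for c
    using C1 that by (simp add: C1_curve_on_def)
  have W: "W s = D c (snd c (\<gamma> s)) v"
    if "c \<in> A" "s \<in> ?I" "\<gamma> s \<in> fst c" "((snd c \<circ> \<gamma>) has_vector_derivative v) (at s within ?I)" for c s v
  proof -
    have "((\<psi> \<circ> \<gamma>) has_vector_derivative D c (snd c (\<gamma> s)) v) (at s within ?I)"
      by (rule curve_embedding_derivative[OF that(1) op[OF that(1)] _ _ that(4)]) (use that in simp_all)
    then show ?thesis
      unfolding W_def by (rule vector_derivative_within_closed_interval[OF True that(2)])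
  qed
  have contW: "continuous_on ?I W"
    unfolding continuous_on_eq_continuous_within
  proof
    fix s assume s: "s \<in> ?I"
    then have "\<gamma> s \<in> topspace X" using \<gamma> by (auto simp: continuous_map_def)
    then obtain c where c: "c \<in> A" "\<gamma> s \<in> fst c" using charts_cover by blast
    let ?V = "{r \<in> ?I. \<gamma> r \<in> fst c}"
    obtain d where d: "continuous_on ?V d"
        "\<forall>s\<in>?I. \<gamma> s \<in> fst c \<longrightarrow> ((snd c \<circ> \<gamma>) has_vector_derivative d s) (at s within ?I)"
      using C1'[OF c(1)] by (elim exE conjE)
    have y: "continuous_on ?V (\<lambda>r. snd c (\<gamma> r))"
      unfolding continuous_on_eq_continuous_within
    proof
      fix r assume r: "r \<in> ?V"
      then have "((snd c \<circ> \<gamma>) has_vector_derivative d r) (at r within ?I)" using d(2) by blast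
      then have "continuous (at r within ?I) (snd c \<circ> \<gamma>)" by (rule has_vector_derivative_continuous)
      then show "continuous (at r within ?V) (\<lambda>r. snd c (\<gamma> r))"
        unfolding comp_def by (rule continuous_within_subset) auto
    qed
    have "continuous_on ?V (\<lambda>r. D c (snd c (\<gamma> r)) (d r))"
    proof (rule continuous_on_linear_apply[OF _ _ d(1)])
      show "linear (D c (snd c (\<gamma> r)))" if "r \<in> ?V" for r
        using that by (intro linear_D[OF c(1)] chart_in_coords[OF c(1)]) simp
      show "continuous_on ?V (\<lambda>r. D c (snd c (\<gamma> r)) v)" for v
        by (rule continuous_on_compose2[OF continuous_on_D[OF c(1)] y]) (use chart_in_coords[OF c(1)] in auto)
    qed
    then have "continuous_on ?V W"
    proof (rule continuous_on_eq)
      show "D c (snd c (\<gamma> r)) (d r) = W r" if "r \<in> ?V" for r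
        using W[OF c(1)] that d(2) by auto
    qed
    moreover have "at s within ?V = at s within ?I"
    proof -
      obtain T where T: "open T" "?V = ?I \<inter> T" using op[OF c(1)] by (auto simp: openin_open)
      have "s \<in> ?V" using s c(2) by simp
      then have "s \<in> T" using T(2) by blast
      then show ?thesis
        using at_within_nhd[of s T ?V ?I] T by auto
    qed
    ultimately show "continuous (at s within ?I) W"
      using s c(2) continuous_on_eq_continuous_within[of ?V W] by auto
  qed
  have "continuous_on ?I (\<lambda>s. \<psi> (\<gamma> s))"
    using continuous_map_compose[OF \<gamma> continuous_map_embedding] by (simp add: comp_def)
  then have "continuous_on ?I (\<lambda>s. sqrt (g (\<psi> (\<gamma> s)) (W s) (W s)))"
    by (intro continuous_intros continuous_on_metric contW)
  then have "(\<lambda>s. sqrt (g (\<psi> (\<gamma> s)) (W s) (W s))) integrable_on ?I"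
    by (rule integrable_continuous_real)
  then show ?thesis
  proof (rule integrable_spike_finite[of "{\<alpha>, \<beta>}", rotated 2])
    fix s assume s: "s \<in> ?I - {\<alpha>, \<beta>}"
    then have int: "s \<in> interior ?I" by auto
    have "\<gamma> s \<in> topspace X" using \<gamma> s by (auto simp: continuous_map_def)
    then obtain c where c: "c \<in> A" "\<gamma> s \<in> fst c" using charts_cover by blast
    have "\<exists>v. ((snd d \<circ> \<gamma>) has_vector_derivative v) (at s within ?I)" if "d \<in> A" "\<gamma> s \<in> fst d" for d
      using C1'[OF that(1)] that s by auto
    then obtain v where v: "\<And>d. d \<in> A \<Longrightarrow> \<gamma> s \<in> fst d \<Longrightarrow> ((snd d \<circ> \<gamma>) has_vector_derivative v d) (at s within ?I)"
      by metis
    have "curve_speed A G \<gamma> s = sqrt (G c (snd c (\<gamma> s)) (v c) (v c))"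
      by (rule curve_speed_eq(2)[OF c \<gamma> int]) (rule v[unfolded at_within_interior[OF int]])
    also have "G c (snd c (\<gamma> s)) (v c) (v c) = g (\<psi> (\<gamma> s)) (W s) (W s)"
      using W[OF c(1) _ c(2) v[OF c]] s by (simp add: induced_metric_def param_chart[OF c])
    finally show "curve_speed A G \<gamma> s = sqrt (g (\<psi> (\<gamma> s)) (W s) (W s))" .
  qed simp
next
  case False
  then have "{\<alpha>..\<beta>} = {} \<or> {\<alpha>..\<beta>} = {\<alpha>}" by auto
  then show ?thesis using integrable_on_refl[of _ \<alpha>] by auto
qed

lemma curve_speed_nonneg: "\<gamma> s \<in> topspace X \<Longrightarrow> curve_speed A G \<gamma> s \<ge> 0"
proof -
  assume "\<gamma> s \<in> topspace X"
  define c where "c = chart_at A (\<gamma> s)"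
  have c: "c \<in> A" "\<gamma> s \<in> fst c" using chart_at[OF \<open>\<gamma> s \<in> topspace X\<close>] by (auto simp: c_def)
  have "G c (snd c (\<gamma> s)) v v \<ge> 0" for v
    using induced_metric_pos[OF c(1) chart_in_coords[OF c], of v]
      linear_0[OF linear_D[OF c(1) chart_in_coords[OF c]]]
    by (cases "v = 0") (auto simp: induced_metric_def rw_metric_def)
  then show ?thesis by (simp add: curve_speed_def Let_def flip: c_def)
qed

lemma piecewise_C1_curve_speed:
  assumes \<gamma>: "piecewise_C1_curve X A \<gamma>"
  shows "curve_speed A G \<gamma> integrable_on {0..1}"
    and "\<exists>K. finite K \<and> (\<forall>s\<in>{0..1} - K. s \<in> {0<..<1} \<and> (\<forall>c\<in>A. \<gamma> s \<in> fst c \<longrightarrow>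
           (\<exists>v. ((snd c \<circ> \<gamma>) has_vector_derivative v) (at s) \<and>
             curve_speed A G \<gamma> s = sqrt (G c (snd c (\<gamma> s)) v v))))"
proof -
  obtain K where K: "finite K" "{0, 1} \<subseteq> K" "K \<subseteq> {0..1}"
      "\<And>a b. a \<in> K \<Longrightarrow> b \<in> K \<Longrightarrow> a < b \<Longrightarrow> K \<inter> {a<..<b} = {} \<Longrightarrow> C1_curve_on A a b \<gamma>"
    using piecewise_C1_curveE[OF \<gamma>] by metis
  have cont: "continuous_map (top_of_set {0..1}) X \<gamma>"
    using \<gamma> by (simp add: piecewise_C1_curve_def pathin_def)
  have cont': "continuous_map (top_of_set {b..d}) X \<gamma>" if "b \<in> K" "d \<in> K" for b d
  proof (rule continuous_map_from_subtopology_mono[OF cont])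
    show "{b..d} \<subseteq> {0..1}" using that K(3) by auto
  qed
  have "0 \<in> K" "1 \<in> K" using K(2) by auto
  show "curve_speed A G \<gamma> integrable_on {0..1}"
    by (rule integrable_on_partition[OF K(1) \<open>0 \<in> K\<close> K(3) \<open>1 \<in> K\<close>])
      (rule C1_curve_speed_integrable[OF K(4) cont'])
  have "s \<in> {0<..<1} \<and> (\<forall>c\<in>A. \<gamma> s \<in> fst c \<longrightarrow>
           (\<exists>v. ((snd c \<circ> \<gamma>) has_vector_derivative v) (at s) \<and>
             curve_speed A G \<gamma> s = sqrt (G c (snd c (\<gamma> s)) v v)))" if s: "s \<in> {0..1} - K" for s
  proof (intro conjI ballI impI)
    obtain b d where bd: "b \<in> K" "d \<in> K" "b < s" "s < d" "K \<inter> {b<..<d} = {}"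
      using partition_interval[OF K(1-3) s] by metis
    show "s \<in> {0<..<1}" using s K(2) by (auto simp: less_le)
    have C1: "C1_curve_on A b d \<gamma>" using K(4) bd by auto
    have int: "s \<in> interior {b..d}" using bd by auto
    have "\<exists>v. ((snd c \<circ> \<gamma>) has_vector_derivative v) (at s)" if c: "c \<in> A" "\<gamma> s \<in> fst c" for c
    proof -
      have "\<exists>e. \<forall>s\<in>{b..d}. \<gamma> s \<in> fst c \<longrightarrow> ((snd c \<circ> \<gamma>) has_vector_derivative e s) (at s within {b..d})"
        using C1 c(1) unfolding C1_curve_on_def by blast
      then obtain e where "((snd c \<circ> \<gamma>) has_vector_derivative e s) (at s within {b..d})"
        using c(2) bd by auto
      then show ?thesis unfolding at_within_interior[OF int] by blast
    qed
    then obtain v where v: "\<And>c. c \<in> A \<Longrightarrow> \<gamma> s \<in> fst c \<Longrightarrow> ((snd c \<circ> \<gamma>) has_vector_derivative v c) (at s)"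
      by metis
    fix c assume c: "c \<in> A" "\<gamma> s \<in> fst c"
    show "\<exists>v. ((snd c \<circ> \<gamma>) has_vector_derivative v) (at s) \<and>
             curve_speed A G \<gamma> s = sqrt (G c (snd c (\<gamma> s)) v v)"
      using v[OF c] curve_speed_eq(2)[OF c cont'[OF bd(1,2)] int v] by blast
  qed
  then show "\<exists>K. finite K \<and> (\<forall>s\<in>{0..1} - K. s \<in> {0<..<1} \<and> (\<forall>c\<in>A. \<gamma> s \<in> fst c \<longrightarrow>
           (\<exists>v. ((snd c \<circ> \<gamma>) has_vector_derivative v) (at s) \<and>
             curve_speed A G \<gamma> s = sqrt (G c (snd c (\<gamma> s)) v v))))"
    using K(1) by blast
qed

lemma curve_length_nonneg:
  assumes \<gamma>: "piecewise_C1_curve X A \<gamma>" shows "curve_length A G \<gamma> \<ge> 0"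
  unfolding curve_length_def
proof (rule integral_nonneg[OF piecewise_C1_curve_speed(1)[OF \<gamma>]])
  show "curve_speed A G \<gamma> s \<ge> 0" if "s \<in> {0..1}" for s
    using \<gamma> that by (intro curve_speed_nonneg) (auto simp: piecewise_C1_curve_def pathin_def continuous_map_def)
qed

lemma riemannian_dist_le:
  assumes "piecewise_C1_curve X A \<gamma>" "\<gamma> 0 = p" "\<gamma> 1 = q"
  shows "riemannian_dist X A G p q \<le> curve_length A G \<gamma>"
  unfolding riemannian_dist_def
  by (rule cInf_lower) (use assms curve_length_nonneg in \<open>auto intro!: bdd_belowI[of _ 0]\<close>)

text \<open>By compactness the induced metric attains a positive minimum on \<open>K\<close> times
  the unit sphere, and homogeneity passes the bound to all vectors.\<close>

lemma metric_lower_bound: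
  assumes c: "c \<in> A" and K: "compact K" "K \<noteq> {}" "K \<subseteq> coords c"
  obtains k where "k > 0" "\<And>z v. z \<in> K \<Longrightarrow> k * norm v \<le> sqrt (G c z v v)"
proof -
  let ?S = "K \<times> sphere (0 :: real ^ 'n) 1"
  have "axis undefined 1 \<in> sphere (0 :: real ^ 'n) 1" by simp
  then have S: "compact ?S" "?S \<noteq> {}" using K by (auto intro: compact_Times)
  have "continuous_on ?S (\<lambda>p. (\<psi> \<circ> param c) (fst p))"
    by (intro continuous_on_compose2[OF Ck_on_imp_continuous_on[OF Ck_embedding[OF c]]] continuous_intros)
      (use K in auto)
  moreover have "continuous_on ?S (\<lambda>p. D c (fst p) (snd p))"
  proof (rule continuous_on_linear_apply)
    show "linear (D c (fst p))" if "p \<in> ?S" for p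
      using that K by (intro linear_D[OF c]) auto
    show "continuous_on ?S (\<lambda>p. D c (fst p) v)" for v
      by (intro continuous_on_compose2[OF continuous_on_D[OF c]] continuous_intros) (use K in auto)
  qed (intro continuous_intros)
  ultimately have "continuous_on ?S (\<lambda>p. G c (fst p) (snd p) (snd p))"
    unfolding induced_metric_def comp_def by (intro continuous_on_metric)
  from continuous_attains_inf[OF S this] obtain p where p: "p \<in> ?S"
      "\<And>q. q \<in> ?S \<Longrightarrow> G c (fst p) (snd p) (snd p) \<le> G c (fst q) (snd q) (snd q)"
    by blast
  define m where "m = G c (fst p) (snd p) (snd p)"
  have "m > 0"
    unfolding m_def by (rule induced_metric_pos[OF c]) (use p K in auto)
  show ?thesis
  proof (rule that)
    show "sqrt m > 0" using \<open>m > 0\<close> by simp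
    fix z v assume z: "z \<in> K"
    have lin: "linear (D c z)" using linear_D[OF c] z K by blast
    show "sqrt m * norm v \<le> sqrt (G c z v v)"
    proof (cases "v = 0")
      case False
      let ?u = "(1 / norm v) *\<^sub>R v"
      have v: "v = norm v *\<^sub>R ?u" using False by simp
      have "G c z v v = (norm v)\<^sup>2 * G c z ?u ?u"
        by (subst (1 2) v)
          (simp only: induced_metric_def rw_metric_def linear_scale[OF lin] fst_scaleR snd_scaleR,
            simp add: power2_eq_square algebra_simps)
      moreover have "(norm v)\<^sup>2 * m \<le> (norm v)\<^sup>2 * G c z ?u ?u"
      proof (rule mult_left_mono)
        show "m \<le> G c z ?u ?u"
        unfolding m_def using p(2)[of "(z, ?u)"] z False by simp
      qed simp
      ultimately have "m * (norm v)\<^sup>2 \<le> G c z v v"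
        by (simp only: mult.commute)
      then have "sqrt (m * (norm v)\<^sup>2) \<le> sqrt (G c z v v)" by (rule real_sqrt_le_mono)
      then show ?thesis by (simp add: real_sqrt_mult)
    qed (simp add: linear_0[OF lin] induced_metric_def rw_metric_def)
  qed
qed

text \<open>A bump function supported in a chart bounds the length of every curve leaving it from below.\<close>

lemma curve_length_lower_bound:
  assumes p: "p \<in> topspace X" and U: "openin X U" "p \<in> U"
  obtains \<epsilon> where "\<epsilon> > 0"
    "\<And>\<gamma>. piecewise_C1_curve X A \<gamma> \<Longrightarrow> \<gamma> 0 \<notin> U \<Longrightarrow> \<gamma> 1 = p \<Longrightarrow> \<epsilon> \<le> curve_length A G \<gamma>"
proof -
  obtain c where c: "c \<in> A" "p \<in> fst c" using charts_cover[OF p] by blast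
  define y0 where "y0 = snd c p"
  have y0: "y0 \<in> coords c" using chart_in_coords[OF c] by (simp add: y0_def)
  have "openin (top_of_set (coords c)) {y \<in> topspace (top_of_set (coords c)). param c y \<in> U}"
    by (rule openin_continuous_map_preimage[OF continuous_map_param[OF c(1)] U(1)])
  then have "open {y \<in> coords c. param c y \<in> U}"
    using openin_open_trans[OF _ open_coords[OF c(1)]] by simp
  moreover have "y0 \<in> {y \<in> coords c. param c y \<in> U}"
    using y0 U(2) param_chart[OF c] by (simp add: y0_def)
  ultimately obtain r where r: "r > 0" "cball y0 r \<subseteq> {y \<in> coords c. param c y \<in> U}"
    using open_contains_cball by blast
  let ?B = "cball y0 r"
  have B: "?B \<subseteq> coords c" using r(2) by blast
  have "?B \<noteq> {}" using r(1) by simp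
  then obtain k where k: "k > 0" "\<And>z v. z \<in> ?B \<Longrightarrow> k * norm v \<le> sqrt (G c z v v)"
    using metric_lower_bound[OF c(1) compact_cball _ B] by metis
  \<comment> \<open>A bump with value \<open>r ^ 4\<close> at \<open>y0\<close> that vanishes
    outside \<open>?B\<close>; the outer square makes it continuously differentiable at the
    edge.\<close>
  define b where "b y = (max 0 (r\<^sup>2 - (y - y0) \<bullet> (y - y0)))\<^sup>2" for y
  define \<phi> where "\<phi> q = (if q \<in> fst c then b (snd c q) else 0)" for q
  have b0: "b y = 0" if "y \<notin> ?B" for y
  proof -
    have "r < norm (y - y0)" using that by (simp add: dist_norm norm_minus_commute)
    then have "r\<^sup>2 < (norm (y - y0))\<^sup>2" using r(1) by (simp add: power_strict_mono)
    then show ?thesis by (simp add: b_def dot_square_norm)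
  qed
  have contb: "continuous_on UNIV b" unfolding b_def by (intro continuous_intros)
  \<comment> \<open>\<open>C\<close> is open because compact sets in a Hausdorff space are closed.
    It covers \<open>X\<close> together with the chart domain, and \<open>\<phi>\<close> is
    \<open>b\<close> in the chart and 0 on \<open>C\<close>.\<close>
  define C where "C = topspace X - param c ` ?B"
  have "continuous_map (top_of_set ?B) X (param c)"
    by (rule continuous_map_from_subtopology_mono[OF continuous_map_param[OF c(1)] B])
  then have "compactin X (param c ` ?B)"
    by (rule image_compactin[rotated]) (simp add: compactin_subtopology)
  then have openC: "openin X C"
    unfolding C_def using compactin_imp_closedin[OF Hausdorff] by blast
  have \<phi>C: "\<phi> q = 0" if "q \<in> C" for q
  proof (cases "q \<in> fst c")
    case True
    then have "snd c q \<notin> ?B" using that param_chart[OF c(1) True] by (force simp: C_def)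
    then show ?thesis using b0 by (simp add: \<phi>_def)
  qed (simp add: \<phi>_def)
  have cover: "q \<in> fst c \<or> q \<in> C" if "q \<in> topspace X" for q
    using that param_in_chart[OF c(1)] B by (auto simp: C_def)
  have cont\<phi>: "continuous_map X euclideanreal \<phi>"
  proof (rule pasting_lemma[where I = UNIV and T = "\<lambda>i. if i then fst c else C" and f = "\<lambda>_. \<phi>"])
    show "openin X (if i then fst c else C)" for i
      using openC openin_chart[OF c(1)] by simp
    show "continuous_map (subtopology X (if i then fst c else C)) euclideanreal \<phi>" for i
    proof (cases i)
      case True
      have "continuous_map (subtopology X (fst c)) euclideanreal (b \<circ> snd c)"
        by (rule continuous_map_compose[OF continuous_map_chart[OF c(1)]]) (use contb in simp)
      then have "continuous_map (subtopology X (fst c)) euclideanreal \<phi>"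
        by (rule continuous_map_eq) (simp add: \<phi>_def)
      then show ?thesis using True by simp
    next
      case False
      have "continuous_map (subtopology X C) euclideanreal (\<lambda>_. 0)" by simp
      then have "continuous_map (subtopology X C) euclideanreal \<phi>"
        by (rule continuous_map_eq) (simp add: \<phi>C)
      then show ?thesis using False by simp
    qed
  qed (use cover in \<open>auto simp: UNIV_bool\<close>)
  \<comment> \<open>Lipschitz constant of the bump for the induced metric: along a coordinate
    velocity \<open>v\<close> it changes at rate at most \<open>4 * r ^ 3 * norm v\<close>, and
    \<open>k * norm v\<close> is at most the speed.\<close>
  define L where "L = 4 * r ^ 3 / k"
  have "L > 0" using r(1) k(1) by (simp add: L_def)
  have main: "r ^ 4 / L \<le> curve_length A G \<gamma>"
    if \<gamma>: "piecewise_C1_curve X A \<gamma>" "\<gamma> 0 \<notin> U" "\<gamma> 1 = p" for \<gamma>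
  proof -
    have path: "continuous_map (top_of_set {0..1}) X \<gamma>"
      using \<gamma>(1) by (simp add: piecewise_C1_curve_def pathin_def)
    then have \<gamma>X: "\<gamma> s \<in> topspace X" if "s \<in> {0..1}" for s
      using that by (auto simp: continuous_map_def)
    obtain K where K: "finite K" "\<forall>s\<in>{0..1} - K. s \<in> {0<..<1} \<and> (\<forall>c\<in>A. \<gamma> s \<in> fst c \<longrightarrow>
           (\<exists>v. ((snd c \<circ> \<gamma>) has_vector_derivative v) (at s) \<and>
             curve_speed A G \<gamma> s = sqrt (G c (snd c (\<gamma> s)) v v)))"
      using piecewise_C1_curve_speed(2)[OF \<gamma>(1)] by (elim exE conjE)
    have "\<exists>h. ((\<phi> \<circ> \<gamma>) has_vector_derivative h) (at s) \<and> \<bar>h\<bar> \<le> L * curve_speed A G \<gamma> s"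
      if s: "s \<in> {0..1} - K" for s
    proof -
      have s01: "s \<in> {0<..<1}" using K(2) s by blast
      have op: "open {r \<in> {0<..<1}. \<gamma> r \<in> W}" if "openin X W" for W
      proof -
        have "continuous_map (top_of_set {0<..<1}) X \<gamma>"
          by (rule continuous_map_from_subtopology_mono[OF path]) auto
        from openin_continuous_map_preimage[OF this that] show ?thesis
          using openin_open_trans[OF _ open_greaterThanLessThan] by simp
      qed
      show ?thesis
      proof (cases "\<gamma> s \<in> fst c")
        case True
        then obtain v where v: "((snd c \<circ> \<gamma>) has_vector_derivative v) (at s)"
            "curve_speed A G \<gamma> s = sqrt (G c (snd c (\<gamma> s)) v v)"
          using K(2) s c(1) by blast
        let ?y = "snd c (\<gamma> s)"
        define h where "h = 2 * max 0 (r\<^sup>2 - (?y - y0) \<bullet> (?y - y0)) * (- (2 * ((?y - y0) \<bullet> v)))"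
        have "((\<lambda>s. (snd c \<circ> \<gamma>) s - y0) has_vector_derivative v) (at s)"
          using has_vector_derivative_diff[OF v(1) has_vector_derivative_const[of y0]] by simp
        from has_real_derivative_inner[OF this this]
        have "((\<lambda>s. r\<^sup>2 - (snd c (\<gamma> s) - y0) \<bullet> (snd c (\<gamma> s) - y0)) has_real_derivative
            - (2 * ((?y - y0) \<bullet> v))) (at s)"
          by (auto intro!: derivative_eq_intros simp: inner_commute)
        from DERIV_chain2[OF DERIV_max0_power2 this]
        have "((\<lambda>s. b (snd c (\<gamma> s))) has_real_derivative h) (at s)"
          unfolding b_def h_def .
        then have "((\<phi> \<circ> \<gamma>) has_real_derivative h) (at s)"
          by (rule has_field_derivative_transform_within_open[OF _ op[OF openin_chart[OF c(1)]]])
            (use s01 True in \<open>auto simp: \<phi>_def\<close>)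
        moreover have "\<bar>h\<bar> \<le> L * curve_speed A G \<gamma> s"
        proof (cases "?y \<in> ?B")
          case True
          have n: "norm (?y - y0) \<le> r" using True by (simp add: dist_norm norm_minus_commute)
          have "\<bar>(?y - y0) \<bullet> v\<bar> \<le> norm (?y - y0) * norm v" by (rule Cauchy_Schwarz_ineq2)
          also have "\<dots> \<le> r * norm v" using n by (simp add: mult_right_mono)
          finally have 1: "\<bar>(?y - y0) \<bullet> v\<bar> \<le> r * norm v" .
          have 2: "\<bar>max 0 (r\<^sup>2 - (?y - y0) \<bullet> (?y - y0))\<bar> \<le> r\<^sup>2" by simp
          have "\<bar>h\<bar> = 4 * (\<bar>max 0 (r\<^sup>2 - (?y - y0) \<bullet> (?y - y0))\<bar> * \<bar>(?y - y0) \<bullet> v\<bar>)"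
            by (simp add: h_def abs_mult)
          also have "\<dots> \<le> 4 * (r\<^sup>2 * (r * norm v))"
            using mult_mono[OF 2 1] by simp
          also have "\<dots> = L * (k * norm v)"
            using k(1) by (simp add: L_def power2_eq_square power3_eq_cube)
          also have "\<dots> \<le> L * curve_speed A G \<gamma> s"
            unfolding v(2) using k(2)[OF True] \<open>L > 0\<close> by simp
          finally show ?thesis .
        next
          case False
          then have "max 0 (r\<^sup>2 - (?y - y0) \<bullet> (?y - y0)) = 0" using b0[OF False] by (simp add: b_def)
          then have "h = 0" by (simp add: h_def)
          then show ?thesis using \<open>L > 0\<close> curve_speed_nonneg[OF \<gamma>X] s by simp
        qed
        ultimately show ?thesis using has_real_derivative_iff_has_vector_derivative by blast
      next
        case False
        then have "\<gamma> s \<in> C" using cover \<gamma>X s by blast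
        have "((\<lambda>_. 0) has_real_derivative 0) (at s)" by simp
        then have "((\<phi> \<circ> \<gamma>) has_real_derivative 0) (at s)"
          by (rule has_field_derivative_transform_within_open[OF _ op[OF openC]])
            (use s01 \<open>\<gamma> s \<in> C\<close> in \<open>auto simp: \<phi>C\<close>)
        then have "((\<phi> \<circ> \<gamma>) has_vector_derivative 0) (at s)"
          using has_real_derivative_iff_has_vector_derivative by blast
        moreover have "curve_speed A G \<gamma> s \<ge> 0" using curve_speed_nonneg[OF \<gamma>X] s by simp
        ultimately show ?thesis using \<open>L > 0\<close> by (intro exI[of _ 0]) simp
      qed
    qed
    then have "\<forall>s. \<exists>h. s \<in> {0..1} - K \<longrightarrow>
        ((\<phi> \<circ> \<gamma>) has_vector_derivative h) (at s) \<and> \<bar>h\<bar> \<le> L * curve_speed A G \<gamma> s"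
      by blast
    from choice[OF this] obtain h where h: "\<forall>s. s \<in> {0..1} - K \<longrightarrow>
        ((\<phi> \<circ> \<gamma>) has_vector_derivative h s) (at s) \<and> \<bar>h s\<bar> \<le> L * curve_speed A G \<gamma> s" ..
    \<comment> \<open>On the finite set \<open>K\<close> the curve need not be differentiable; the
      value 0 there leaves the integral unchanged and still lies below the nonnegative
      speed.\<close>
    define h' where "h' s = (if s \<in> K then 0 else h s)" for s
    have cont: "continuous_on {0..1} (\<phi> \<circ> \<gamma>)"
      using continuous_map_compose[OF path cont\<phi>] by simp
    have deriv: "((\<phi> \<circ> \<gamma>) has_vector_derivative h' s) (at s)" if "s \<in> {0<..<1} - K" for s
      using h that by (simp add: h'_def)
    have int: "(h' has_integral ((\<phi> \<circ> \<gamma>) 1 - (\<phi> \<circ> \<gamma>) 0)) {0..1}"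
      by (rule fundamental_theorem_of_calculus_interior_strong[OF K(1) zero_le_one deriv cont])
    have "\<phi> (\<gamma> 1) = r ^ 4"
      using c(2) by (simp add: \<gamma>(3) \<phi>_def b_def y0_def)
    moreover have "\<phi> (\<gamma> 0) = 0"
    proof (rule \<phi>C)
      show "\<gamma> 0 \<in> C" using \<gamma>(2) r(2) \<gamma>X[of 0] by (auto simp: C_def)
    qed
    ultimately have "r ^ 4 = integral {0..1} h'" using integral_unique[OF int] by simp
    also have "\<dots> \<le> integral {0..1} (\<lambda>s. L * curve_speed A G \<gamma> s)"
    proof (rule integral_le)
      show "h' integrable_on {0..1}" using int by blast
      show "(\<lambda>s. L * curve_speed A G \<gamma> s) integrable_on {0..1}"
        using piecewise_C1_curve_speed(1)[OF \<gamma>(1)] by (rule integrable_on_mult_right)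
      show "h' s \<le> L * curve_speed A G \<gamma> s" if "s \<in> {0..1}" for s
      proof (cases "s \<in> K")
        case True
        then show ?thesis using curve_speed_nonneg[of \<gamma> s, OF \<gamma>X[OF that]] \<open>L > 0\<close> by (simp add: h'_def)
      next
        case False
        then have "\<bar>h s\<bar> \<le> L * curve_speed A G \<gamma> s" using h that by blast
        then show ?thesis using False by (simp add: h'_def)
      qed
    qed
    finally have "r ^ 4 \<le> L * curve_length A G \<gamma>" by (simp add: curve_length_def)
    then show ?thesis using \<open>L > 0\<close> by (simp add: pos_divide_le_eq mult.commute)
  qed
  show ?thesis
    by (rule that[of "r ^ 4 / L"]) (use r(1) \<open>L > 0\<close> main in auto)
qed

section \<open>The projection to \<open>R^n\<close> and its sections\<close>

lemma spacelike_tangent: "c \<in> A \<Longrightarrow> y \<in> coords c \<Longrightarrow> spacelike_tangent a (fst ((\<psi> \<circ> param c) y)) (D c y)"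
  by (rule spacelike_immersion.tangent[OF spacelike_immersion])

lemma projection_has_derivative:
  "c \<in> A \<Longrightarrow> y \<in> coords c \<Longrightarrow> ((\<lambda>y. snd (\<psi> (param c y))) has_derivative (\<lambda>u. snd (D c y u))) (at y)"
  using has_derivative_snd[OF embedding_has_derivative] by simp

lemma continuous_map_projection: "continuous_map X euclidean (snd \<circ> \<psi>)"
  by (rule continuous_map_compose[OF continuous_map_embedding]) (auto intro: continuous_intros)

text \<open>The inverse function theorem in a chart, applicable because the spatial part of the
  differential is injective. \<open>U\<close> provides local injectivity, and
  \<open>\<sigma>\<close> is the parametrisation composed with the local inverse.\<close>

lemma local_inverse:
  assumes p: "p \<in> topspace X"
  obtains U V \<sigma> where "openin X U" "p \<in> U" "inj_on (snd \<circ> \<psi>) U" "open V" "snd (\<psi> p) \<in> V"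
    "is_section X (snd \<circ> \<psi>) V \<sigma>" "\<sigma> (snd (\<psi> p)) = p"
proof -
  obtain c where c: "c \<in> A" "p \<in> fst c" using charts_cover[OF p] by blast
  define f where "f y = snd (\<psi> (param c y))" for y
  define f' where "f' y = Blinfun (\<lambda>u. snd (D c y u))" for y
  have blin: "bounded_linear (\<lambda>u. snd (D c y u))" if "y \<in> coords c" for y
    using projection_has_derivative[OF c(1) that] by (rule has_derivative_bounded_linear)
  have f': "blinfun_apply (f' y) = (\<lambda>u. snd (D c y u))" if "y \<in> coords c" for y
    unfolding f'_def by (rule bounded_linear_Blinfun_apply[OF blin[OF that]])
  define y0 where "y0 = snd c p"
  have y0: "y0 \<in> coords c" "param c y0 = p"
    using chart_in_coords[OF c] param_chart[OF c] by (simp_all add: y0_def)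
  interpret spacelike_tangent a "fst ((\<psi> \<circ> param c) y0)" "D c y0"
    by (rule spacelike_tangent[OF c(1) y0(1)])
  obtain L where L: "linear L" "L \<circ> (\<lambda>u. snd (D c y0 u)) = id"
    using linear_injective_left_inverse[OF linear_snd inj_snd] by blast
  have "Blinfun L o\<^sub>L f' y0 = id_blinfun"
  proof (rule blinfun_eqI)
    fix u
    have "blinfun_apply (Blinfun L) = L"
      using L(1) by (simp add: bounded_linear_Blinfun_apply linear_conv_bounded_linear)
    then show "blinfun_apply (Blinfun L o\<^sub>L f' y0) u = blinfun_apply id_blinfun u"
      using L(2) f'[OF y0(1)] by (simp add: fun_eq_iff)
  qed
  moreover have "continuous_on (coords c) f'"
  proof (rule continuous_on_blinfun_componentwise)
    fix i :: "real ^ 'n"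
    have "continuous_on (coords c) (\<lambda>y. snd (D c y i))"
      by (intro continuous_intros continuous_on_D[OF c(1)])
    then show "continuous_on (coords c) (\<lambda>y. blinfun_apply (f' y) i)"
      by (rule continuous_on_eq) (simp add: f')
  qed
  moreover have "(f has_derivative blinfun_apply (f' y)) (at y)" if "y \<in> coords c" for y
    using projection_has_derivative[OF c(1) that] by (simp add: f'[OF that] f_def[abs_def])
  ultimately obtain U' V h where h: "open U'" "U' \<subseteq> coords c" "y0 \<in> U'" "open V" "f y0 \<in> V"
      "homeomorphism U' V f h"
    using inverse_function_theorem[OF open_coords[OF c(1)] _ _ y0(1), of f f' "Blinfun L"] by metis
  have hf: "h (f y) = y" if "y \<in> U'" for y using h(6) that by (simp add: homeomorphism_def)
  have fh: "f (h v) = v" "h v \<in> U'" if "v \<in> V" for v using h(6) that by (auto simp: homeomorphism_def)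
  show ?thesis
  proof (rule that)
    show "openin X (param c ` U')" by (rule openin_param_image[OF c(1) h(1,2)])
    show "p \<in> param c ` U'" using y0(2) h(3) by blast
    show "inj_on (snd \<circ> \<psi>) (param c ` U')"
      by (rule inj_on_inverseI[of _ "param c \<circ> h"]) (use hf in \<open>auto simp: f_def\<close>)
    show "open V" by (rule h(4))
    show "snd (\<psi> p) \<in> V" using h(5) by (simp add: f_def y0)
    have "continuous_map (top_of_set V) (top_of_set (coords c)) h"
      using h(2,6) fh by (auto simp: homeomorphism_def)
    from continuous_map_compose[OF this continuous_map_param[OF c(1)]]
    show "is_section X (snd \<circ> \<psi>) V (param c \<circ> h)"
      using fh by (simp add: is_section_def f_def)
    show "(param c \<circ> h) (snd (\<psi> p)) = p" using hf[OF h(3)] by (simp add: f_def y0)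
  qed
qed

sublocale locally_injective X "snd \<circ> \<psi>"
  by unfold_locales (use Hausdorff local_inverse in metis)+

text \<open>A section is only known to be continuous, but in a chart it is a continuous right
  inverse of a map with invertible differential, hence differentiable with the inverse differential.
  Writing that inverse by Cramer's rule shows that it varies continuously.\<close>

lemma C1_map_section:
  assumes s: "is_section X (snd \<circ> \<psi>) S s" and "open S"
  shows "C1_map s S"
  unfolding C1_map_def
proof (intro conjI ballI)
  show cont: "continuous_map (top_of_set S) X s" using s by (simp add: is_section_def)
  fix d assume d: "d \<in> A"
  let ?T = "{z \<in> S. s z \<in> fst d}"
  have "openin (top_of_set S) {z \<in> topspace (top_of_set S). s z \<in> fst d}"
    by (rule openin_continuous_map_preimage[OF cont openin_chart[OF d]])
  then have T: "open ?T" using openin_open_trans[OF _ \<open>open S\<close>] by simp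
  have "continuous_map (top_of_set ?T) (subtopology X (fst d)) s"
    using continuous_map_from_subtopology_mono[OF cont, of ?T] by (auto simp: continuous_map_in_subtopology)
  from continuous_map_compose[OF this continuous_map_chart[OF d]]
  have conty: "continuous_on ?T (\<lambda>z. snd d (s z))" by (simp add: comp_def)
  define M where "M y = matrix (\<lambda>u. snd (D d y u))" for y
  have det: "det (M y) \<noteq> 0" if "y \<in> coords d" for y
  proof -
    interpret spacelike_tangent a "fst ((\<psi> \<circ> param d) y)" "D d y" by (rule spacelike_tangent[OF d that])
    show ?thesis unfolding M_def using det_nz_iff_inj[OF linear_snd] inj_snd by simp
  qed
  have contM: "continuous_on (coords d) (\<lambda>y. cramer_solution (M y) v)" for v
  proof (rule differentiable_imp_continuous_on)
    show "(\<lambda>y. cramer_solution (M y) v) differentiable_on coords d"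
      unfolding differentiable_on_def
    proof
      fix y assume y: "y \<in> coords d"
      have "(\<lambda>y. M y $ i $ j) differentiable at y" for i j
        unfolding M_def matrix_def
        using spacelike_immersion.deriv_differentiable[OF spacelike_immersion[OF d] y]
        by (auto intro!: differentiable_vec_nth_at differentiable_fst_snd)
      then have "(\<lambda>y. cramer_solution (M y) v) differentiable at y"
        by (intro differentiable_cramer_solution det[OF y]) auto
      then show "(\<lambda>y. cramer_solution (M y) v) differentiable at y within coords d"
        by (rule differentiable_at_withinI)
    qed
  qed
  show "\<exists>D. \<forall>z\<in>S. s z \<in> fst d \<longrightarrow> ((snd d \<circ> s) has_derivative D z) (at z) \<and>
        (\<forall>v. continuous_on ?T (\<lambda>z. D z v))"
  proof (intro exI ballI impI conjI allI)
    fix z assume z: "z \<in> S" "s z \<in> fst d"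
    show "continuous_on ?T (\<lambda>z. cramer_solution (M (snd d (s z))) v)" for v
      by (rule continuous_on_compose2[OF contM conty]) (use chart_in_coords[OF d] in auto)
    let ?y = "snd d (s z)"
    have y: "?y \<in> coords d" by (rule chart_in_coords[OF d z(2)])
    interpret spacelike_tangent a "fst ((\<psi> \<circ> param d) ?y)" "D d ?y" by (rule spacelike_tangent[OF d y])
    obtain L where L: "linear L" "L \<circ> (\<lambda>u. snd (D d ?y u)) = id"
      using linear_injective_left_inverse[OF linear_snd inj_snd] by blast
    have "L = cramer_solution (M ?y)"
    proof
      fix v
      obtain u where u: "snd (D d ?y u) = v" using surj_snd by (metis surjD)
      then have "M ?y *v u = v" unfolding M_def using fun_cong[OF matrix_vector_mul(2)[OF linear_snd], of u] by simp
      then have "u = cramer_solution (M ?y) v" using cramer_solution[OF det[OF y]] by blast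
      moreover have "L v = u" using fun_cong[OF L(2), of u] u by simp
      ultimately show "L v = cramer_solution (M ?y) v" by simp
    qed
    moreover have "((snd d \<circ> s) has_derivative L) (at z)"
    proof (rule has_derivative_inverse_basic[where T = ?T])
      show "((\<lambda>y. snd (\<psi> (param d y))) has_derivative (\<lambda>u. snd (D d ?y u))) (at ((snd d \<circ> s) z))"
        using projection_has_derivative[OF d y] by simp
      show "bounded_linear L" using L(1) by (simp add: linear_conv_bounded_linear)
      show "continuous (at z) (snd d \<circ> s)"
        using continuous_on_interior[OF conty] z T by (simp add: comp_def interior_open)
      show "snd (\<psi> (param d ((snd d \<circ> s) w))) = w" if "w \<in> ?T" for w
        using that s param_chart[OF d] by (simp add: is_section_def)
    qed (use L(2) T z in auto)
    ultimately show "((snd d \<circ> s) has_derivative cramer_solution (M ?y)) (at z)" by simp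
  qed
qed

lemma section_lipschitz:
  assumes s: "is_section X (snd \<circ> \<psi>) S s" and S: "open S" "convex S"
    and bound: "\<And>p. p \<in> topspace X \<Longrightarrow> fst (\<psi> p) \<le> B" and yz: "y \<in> S" "z \<in> S"
  shows "riemannian_dist X A G (s y) (s z) \<le> sqrt (2 * a * B) * dist y z"
proof -
  let ?\<gamma> = "\<lambda>r. s (y + r *\<^sub>R (z - y))"
  define C where "C = sqrt (2 * a * B) * dist y z"
  have seg: "closed_segment y z \<subseteq> S" by (rule closed_segment_subset[OF yz S(2)])
  have \<gamma>: "piecewise_C1_curve X A ?\<gamma>"
    by (rule C1_map_segment[OF C1_map_section[OF s S(1)] seg])
  then have path: "continuous_map (top_of_set {0..1}) X ?\<gamma>"
    by (simp add: piecewise_C1_curve_def pathin_def)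
  have inS: "y + r *\<^sub>R (z - y) \<in> S" if "r \<in> {0..1}" for r
    using that seg unfolding closed_segment_def by (force simp: algebra_simps)
  obtain K where K: "finite K" "\<forall>r\<in>{0..1} - K. r \<in> {0<..<1} \<and> (\<forall>c\<in>A. ?\<gamma> r \<in> fst c \<longrightarrow>
         (\<exists>v. ((snd c \<circ> ?\<gamma>) has_vector_derivative v) (at r) \<and>
           curve_speed A G ?\<gamma> r = sqrt (G c (snd c (?\<gamma> r)) v v)))"
    using piecewise_C1_curve_speed(2)[OF \<gamma>] by (elim exE conjE)
  have speed: "curve_speed A G ?\<gamma> r \<le> C" if r: "r \<in> {0..1} - K" for r
  proof -
    have r01: "r \<in> {0<..<1}" using K(2) r by blast
    have \<gamma>r: "?\<gamma> r \<in> topspace X" using is_section_in_topspace[OF s inS] r by simp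
    then obtain c where c: "c \<in> A" "?\<gamma> r \<in> fst c" using charts_cover by blast
    then obtain v where v: "((snd c \<circ> ?\<gamma>) has_vector_derivative v) (at r)"
        "curve_speed A G ?\<gamma> r = sqrt (G c (snd c (?\<gamma> r)) v v)"
      using K(2) r by blast
    let ?w = "D c (snd c (?\<gamma> r)) v"
    have int: "r \<in> interior {0..1}" using r01 by simp
    have "openin (top_of_set {0..1}) {r \<in> topspace (top_of_set {0..1}). ?\<gamma> r \<in> fst c}"
      by (rule openin_continuous_map_preimage[OF path openin_chart[OF c(1)]])
    then have "((\<psi> \<circ> ?\<gamma>) has_vector_derivative ?w) (at r within {0..1})"
      by (rule curve_embedding_derivative[OF c(1) _ _ _ has_vector_derivative_at_within[OF v(1)]])
        (use c r in simp_all)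
    then have "((\<psi> \<circ> ?\<gamma>) has_vector_derivative ?w) (at r)"
      unfolding at_within_interior[OF int] .
    then have "((\<lambda>r. snd ((\<psi> \<circ> ?\<gamma>) r)) has_vector_derivative snd ?w) (at r)"
      by (rule bounded_linear.has_vector_derivative[OF bounded_linear_snd])
    moreover have "((\<lambda>r. snd ((\<psi> \<circ> ?\<gamma>) r)) has_vector_derivative z - y) (at r)"
    proof (rule has_vector_derivative_transform_within_open)
      show "((\<lambda>r. y + r *\<^sub>R (z - y)) has_vector_derivative z - y) (at r)"
        by (auto intro!: derivative_eq_intros simp: has_vector_derivative_def)
      show "r \<in> {0<..<1}" by (rule r01)
      show "y + r *\<^sub>R (z - y) = snd ((\<psi> \<circ> ?\<gamma>) r)" if "r \<in> {0<..<1}" for r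
        using s inS[of r] that by (simp add: is_section_def)
    qed simp
    ultimately have w: "snd ?w = z - y" by (rule vector_derivative_unique_at)
    have "G c (snd c (?\<gamma> r)) v v \<le> 2 * a * fst (\<psi> (?\<gamma> r)) * ((z - y) \<bullet> (z - y))"
      unfolding induced_metric_def param_chart[OF c]
        rw_metric_radiation[OF a less_imp_le[OF time_pos[OF \<gamma>r]]] w by simp
    also have "\<dots> \<le> 2 * a * B * ((z - y) \<bullet> (z - y))"
      using bound[OF \<gamma>r] a by (intro mult_right_mono mult_left_mono) auto
    also have "\<dots> = (2 * a * B) * (dist y z)\<^sup>2"
      by (simp add: dot_square_norm dist_norm norm_minus_commute)
    finally have "sqrt (G c (snd c (?\<gamma> r)) v v) \<le> sqrt ((2 * a * B) * (dist y z)\<^sup>2)"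
      by (rule real_sqrt_le_mono)
    then show ?thesis unfolding v(2) C_def by (simp add: real_sqrt_mult)
  qed
  have "((\<lambda>r. C) has_integral C) {0..1::real}" using has_integral_const_real[of C 0 1] by simp
  \<comment> \<open>The speed is not controlled on \<open>K\<close>, so the constant is replaced
    there by the speed itself, which makes the comparison hold at every point.\<close>
  then have "((\<lambda>r. if r \<in> K then curve_speed A G ?\<gamma> r else C) has_integral C) {0..1}"
    by (rule has_integral_spike_finite[OF K(1), rotated]) simp
  with integrable_integral[OF piecewise_C1_curve_speed(1)[OF \<gamma>]]
  have "curve_length A G ?\<gamma> \<le> C"
    unfolding curve_length_def by (rule has_integral_le) (use speed in auto)
  then show ?thesis
    using riemannian_dist_le[OF \<gamma> refl refl] by (simp add: C_def)
qed

text \<open>A Lipschitz section takes a convergent sequence, even one that approaches the bounding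
  sphere, to a Cauchy sequence, and completeness supplies a limit for the Riemannian distance. It is
  a limit in the topology too, since points outside a neighbourhood of \<open>p\<close> have
  distance at least some \<open>\<epsilon> > 0\<close> from \<open>p\<close>.\<close>

lemma complete_local_homeo:
  assumes conn: "connected_space X"
    and complete: "complete_hypersurface (\<lambda>t. sqrt (2 * a * t)) X A \<psi>"
    and bound: "\<And>p. p \<in> topspace X \<Longrightarrow> fst (\<psi> p) \<le> B"
  shows "complete_local_homeo X (snd \<circ> \<psi>)"
proof unfold_locales
  show "continuous_map X euclidean (snd \<circ> \<psi>)" by (rule continuous_map_projection)
  fix p assume p: "p \<in> topspace X"
  show "\<exists>\<rho>>0. \<exists>s. is_section X (snd \<circ> \<psi>) (ball ((snd \<circ> \<psi>) p) \<rho>) s \<and> s ((snd \<circ> \<psi>) p) = p"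
  proof -
    obtain U V \<sigma> where V: "open V" "snd (\<psi> p) \<in> V" "is_section X (snd \<circ> \<psi>) V \<sigma>" "\<sigma> (snd (\<psi> p)) = p"
      using local_inverse[OF p] by metis
    obtain \<rho> where "\<rho> > 0" "ball (snd (\<psi> p)) \<rho> \<subseteq> V" using V(1,2) by (meson openE)
    then show ?thesis using is_section_subset[OF V(3)] V(4) by auto
  qed
next
  fix x r s u l
  assume s: "is_section X (snd \<circ> \<psi>) (ball x r) s" and u: "range u \<subseteq> ball x r" "u \<longlonglongrightarrow> l"
  define L where "L = sqrt (2 * a * B) + 1"
  have uS: "u i \<in> ball x r" for i using u(1) by blast
  have suX: "s (u i) \<in> topspace X" for i by (rule is_section_in_topspace[OF s uS])
  have "B > 0" using time_pos[OF suX[of 0]] bound[OF suX[of 0]] by simp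
  then have "L > 0" using a by (simp add: L_def add_nonneg_pos)
  have lip: "riemannian_dist X A G (s (u i)) (s (u j)) \<le> L * dist (u i) (u j)" for i j
  proof -
    have "riemannian_dist X A G (s (u i)) (s (u j)) \<le> sqrt (2 * a * B) * dist (u i) (u j)"
      by (rule section_lipschitz[OF s open_ball convex_ball bound uS uS])
    also have "\<dots> \<le> L * dist (u i) (u j)" by (intro mult_right_mono) (simp_all add: L_def)
    finally show ?thesis .
  qed
  have "\<exists>N. \<forall>i\<ge>N. \<forall>j\<ge>N. riemannian_dist X A G ((s \<circ> u) i) ((s \<circ> u) j) < \<epsilon>" if "\<epsilon> > 0" for \<epsilon>
  proof -
    have "Cauchy u" using u(2) by (rule LIMSEQ_imp_Cauchy)
    moreover have "\<epsilon> / L > 0" using that \<open>L > 0\<close> by simp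
    ultimately obtain N where N: "\<And>i j. i \<ge> N \<Longrightarrow> j \<ge> N \<Longrightarrow> dist (u i) (u j) < \<epsilon> / L"
      unfolding Cauchy_def by meson
    have "riemannian_dist X A G (s (u i)) (s (u j)) < \<epsilon>" if "i \<ge> N" "j \<ge> N" for i j
    proof -
      have "L * dist (u i) (u j) < \<epsilon>"
        using N[OF that] \<open>L > 0\<close> by (simp add: pos_less_divide_eq mult.commute)
      then show ?thesis using lip[of i j] by simp
    qed
    then show ?thesis by auto
  qed
  moreover have "range (s \<circ> u) \<subseteq> topspace X" using suX by auto
  ultimately obtain p where p: "p \<in> topspace X"
      "(\<lambda>i. riemannian_dist X A G ((s \<circ> u) i) p) \<longlonglongrightarrow> 0"
    using complete unfolding complete_hypersurface_def riemannian_complete_def by blast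
  have "limitin X (s \<circ> u) p sequentially"
    unfolding limitin_def
  proof (intro conjI allI impI p(1))
    fix U assume U: "openin X U \<and> p \<in> U"
    obtain \<epsilon> where \<epsilon>: "\<epsilon> > 0"
        "\<And>\<gamma>. piecewise_C1_curve X A \<gamma> \<Longrightarrow> \<gamma> 0 \<notin> U \<Longrightarrow> \<gamma> 1 = p \<Longrightarrow> \<epsilon> \<le> curve_length A G \<gamma>"
      using curve_length_lower_bound[OF p(1), of U] U by metis
    \<comment> \<open>The infimum over an empty set of curves would be an unspecified number, so this needs connectedness.\<close>
    have far: "riemannian_dist X A G q p \<ge> \<epsilon>" if q: "q \<in> topspace X" "q \<notin> U" for q
      unfolding riemannian_dist_def
    proof (rule cInf_greatest)
      show "curve_length A G ` {\<gamma>. piecewise_C1_curve X A \<gamma> \<and> \<gamma> 0 = q \<and> \<gamma> 1 = p} \<noteq> {}"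
        using connected_by_curve[OF conn q(1) p(1)] by blast
    qed (use \<epsilon>(2) q(2) in auto)
    have "\<forall>\<^sub>F i in sequentially. riemannian_dist X A G ((s \<circ> u) i) p < \<epsilon>"
      using order_tendstoD(2)[OF p(2) \<epsilon>(1)] .
    then show "\<forall>\<^sub>F i in sequentially. (s \<circ> u) i \<in> U"
    proof eventually_elim
      case (elim i)
      then show ?case using far[OF suX[of i]] by fastforce
    qed
  qed
  then show "\<exists>p. limitin X (s \<circ> u) p sequentially" by blast
qed

text \<open>Over a large ball the barrier along the section is larger on the bounding sphere than at
  the centre. Its minimum is therefore interior, and \<open>no_barrier_minimum\<close> applies in a
  chart around that point.\<close>

lemma complete_bounded_not_maximal:
  assumes "topspace X \<noteq> {}" and conn: "connected_space X"
    and complete: "complete_hypersurface (\<lambda>t. sqrt (2 * a * t)) X A \<psi>"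
    and bounded: "bounded_away_from_future_infinity X \<psi>"
  shows "\<exists>c\<in>A. \<exists>y\<in>coords c. mean_curvature (\<lambda>t. sqrt (2 * a * t)) \<psi> c y \<noteq> 0"
proof -
  obtain B where B: "\<And>p. p \<in> topspace X \<Longrightarrow> fst (\<psi> p) \<le> B"
    using bounded by (auto simp: bounded_away_from_future_infinity_def bdd_above_def)
  interpret complete_local_homeo X "snd \<circ> \<psi>" by (rule complete_local_homeo[OF conn complete B])
  obtain p0 where p0: "p0 \<in> topspace X" using assms(1) by blast
  have "B > 0" using time_pos[OF p0] B[OF p0] by simp
  define x0 where "x0 = snd (\<psi> p0)"
  \<comment> \<open>This choice gives the strict inequality of the comparison at every point of the
    hypersurface. It also makes \<open>b sqrt t - t\<close> nonnegative, so that the barrier is at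
    least \<open>a / 2\<close> times the squared distance from \<open>x0\<close>.\<close>
  define b where "b = 4 * sqrt B + 1"
  have b: "b > 4 * sqrt (fst (\<psi> p))" "b * sqrt (fst (\<psi> p)) \<ge> fst (\<psi> p)" "b * sqrt (fst (\<psi> p)) \<le> b * sqrt B"
    if p: "p \<in> topspace X" for p
  proof -
    have le: "sqrt (fst (\<psi> p)) \<le> sqrt B" using B[OF p] by simp
    then show "b > 4 * sqrt (fst (\<psi> p))" unfolding b_def by linarith
    have "sqrt B \<ge> 0" using \<open>B > 0\<close> by simp
    then have "sqrt (fst (\<psi> p)) \<le> b" "b \<ge> 0" using le unfolding b_def by linarith+
    then show "b * sqrt (fst (\<psi> p)) \<le> b * sqrt B" using le by (simp add: mult_left_mono)
    have "fst (\<psi> p) = sqrt (fst (\<psi> p)) * sqrt (fst (\<psi> p))" using time_pos[OF p] by simp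
    also have "\<dots> \<le> b * sqrt (fst (\<psi> p))"
      using \<open>sqrt (fst (\<psi> p)) \<le> b\<close> time_pos[OF p] by (intro mult_right_mono) auto
    finally show "b * sqrt (fst (\<psi> p)) \<ge> fst (\<psi> p)" .
  qed
  \<comment> \<open>The barrier over the centre is at most \<open>b * sqrt B\<close>; the root is
    the radius at which \<open>a / 2 * R^2\<close> reaches this value, and adding 1 makes the
    inequality strict.\<close>
  define R where "R = sqrt (2 * (b * sqrt B) / a) + 1"
  have bB: "b * sqrt B \<ge> 0" using \<open>B > 0\<close> by (simp add: b_def)
  have R: "R > 0" "a / 2 * R\<^sup>2 > b * sqrt B"
  proof -
    have nonneg: "2 * (b * sqrt B) / a \<ge> 0" using bB a by simp
    then have "sqrt (2 * (b * sqrt B) / a) \<ge> 0" by simp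
    then show "R > 0" unfolding R_def by linarith
    have "2 * (b * sqrt B) / a = (sqrt (2 * (b * sqrt B) / a))\<^sup>2" using nonneg by simp
    also have "\<dots> < R\<^sup>2"
      unfolding R_def using \<open>sqrt (2 * (b * sqrt B) / a) \<ge> 0\<close> by (intro power_strict_mono) auto
    finally show "a / 2 * R\<^sup>2 > b * sqrt B" using a by (simp add: field_simps)
  qed
  \<comment> \<open>One unit of slack makes the section continuous on the closed ball of radius
    \<open>R\<close>, where a minimum is then attained.\<close>
  obtain s where s: "is_section X (snd \<circ> \<psi>) (ball x0 (R + 1)) s" "s x0 = p0"
    using section_on_ball[OF p0, of "R + 1"] by (auto simp: x0_def)
  have \<pi>s: "snd (\<psi> (s x)) = x" "s x \<in> topspace X" if "x \<in> cball x0 R" for x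
    using that s(1) is_section_in_topspace[OF s(1)] by (auto simp: is_section_def)
  define k where "k x = barrier a b x0 (\<psi> (s x))" for x
  have k_ge: "k x \<ge> a / 2 * (dist x0 x)\<^sup>2" if "x \<in> cball x0 R" for x
    using b(2)[OF \<pi>s(2)[OF that]]
    by (simp add: k_def barrier_def \<pi>s(1)[OF that] dot_square_norm dist_norm norm_minus_commute)
  have k0: "k x0 \<le> b * sqrt B"
    using b(3)[OF p0] time_pos[OF p0] by (simp add: k_def barrier_def s(2) flip: x0_def)
  have "continuous_map (top_of_set (cball x0 R)) X s"
  proof -
    have "cball x0 R \<subseteq> ball x0 (R + 1)" by (auto simp: mem_ball)
    from is_section_subset[OF s(1) this] show ?thesis by (simp add: is_section_def)
  qed
  from continuous_map_compose[OF this continuous_map_embedding]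
  have "continuous_on (cball x0 R) (\<lambda>x. \<psi> (s x))" by (simp add: comp_def)
  then have "continuous_on (cball x0 R) k"
    unfolding k_def barrier_def by (intro continuous_intros)
  moreover have "cball x0 R \<noteq> {}" using R(1) by simp
  ultimately obtain x1 where x1: "x1 \<in> cball x0 R" "\<And>x. x \<in> cball x0 R \<Longrightarrow> k x1 \<le> k x"
    using continuous_attains_inf[OF compact_cball] by blast
  have "dist x0 x1 < R"
  proof (rule ccontr)
    assume "\<not> ?thesis"
    then have "dist x0 x1 = R" using x1(1) by simp
    then have "k x0 < k x1" using k_ge[OF x1(1)] k0 R(2) by simp
    moreover have "k x1 \<le> k x0" using x1(2) R(1) by simp
    ultimately show False by simp
  qed
  define p1 where "p1 = s x1"
  have p1: "p1 \<in> topspace X" "snd (\<psi> p1) = x1" using \<pi>s[OF x1(1)] by (simp_all add: p1_def)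
  obtain c where c: "c \<in> A" "p1 \<in> fst c" using charts_cover[OF p1(1)] by blast
  define y1 where "y1 = snd c p1"
  have y1: "y1 \<in> coords c" "param c y1 = p1"
    using chart_in_coords[OF c] param_chart[OF c] by (simp_all add: y1_def)
  obtain U where U: "openin X U" "p1 \<in> U" "inj_on (snd \<circ> \<psi>) U" using locally_inj[OF p1(1)] by blast
  define \<xi> where "\<xi> y = snd (\<psi> (param c y))" for y
  have cont\<xi>: "continuous_on (coords c) \<xi>"
    using continuous_on_snd[OF Ck_on_imp_continuous_on[OF Ck_embedding[OF c(1)]]] by (simp add: \<xi>_def[abs_def] comp_def)
  define W1 where "W1 = {x \<in> ball x0 R. s x \<in> U}"
  have "continuous_map (top_of_set (ball x0 R)) X s"
  proof -
    have "ball x0 R \<subseteq> ball x0 (R + 1)" by (auto simp: mem_ball)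
    from is_section_subset[OF s(1) this] show ?thesis by (simp add: is_section_def)
  qed
  from openin_continuous_map_preimage[OF this U(1)]
  have W1: "open W1" unfolding W1_def using openin_open_trans[OF _ open_ball] by simp
  \<comment> \<open>For \<open>z\<close> in \<open>W\<close> both \<open>param c z\<close> and
    \<open>s (\<xi> z)\<close> lie in \<open>U\<close> and have the same projection, so they
    coincide. This transfers minimality from the section to all points near \<open>y1\<close> in the
    chart.\<close>
  define W where "W = {y \<in> coords c. param c y \<in> U} \<inter> {y \<in> coords c. \<xi> y \<in> W1}"
  have "open {y \<in> coords c. param c y \<in> U}"
    using openin_continuous_map_preimage[OF continuous_map_param[OF c(1)] U(1)]
      openin_open_trans[OF _ open_coords[OF c(1)]] by simp
  moreover have "open {y \<in> coords c. \<xi> y \<in> W1}"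
    using continuous_open_preimage[OF cont\<xi> open_coords[OF c(1)] W1] by (simp add: vimage_def Int_def)
  ultimately have "open W" unfolding W_def by (rule open_Int)
  moreover have "y1 \<in> W"
    using y1 U(2) p1(2) \<open>dist x0 x1 < R\<close> by (simp add: W_def W1_def \<xi>_def flip: p1_def)
  ultimately obtain d where d: "d > 0" "ball y1 d \<subseteq> W" by (meson openE)
  have min: "barrier a b x0 ((\<psi> \<circ> param c) y1) \<le> barrier a b x0 ((\<psi> \<circ> param c) z)" if "z \<in> ball y1 d" for z
  proof -
    have z: "z \<in> coords c" "param c z \<in> U" "\<xi> z \<in> ball x0 R" "s (\<xi> z) \<in> U"
      using that d(2) by (auto simp: W_def W1_def)
    then have "\<xi> z \<in> cball x0 R" by simp
    have "(snd \<circ> \<psi>) (s (\<xi> z)) = (snd \<circ> \<psi>) (param c z)"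
      using \<pi>s(1)[OF \<open>\<xi> z \<in> cball x0 R\<close>] by (simp add: \<xi>_def)
    then have "s (\<xi> z) = param c z" using U(3) z by (meson inj_onD)
    then show ?thesis using x1(2)[OF \<open>\<xi> z \<in> cball x0 R\<close>] by (simp add: k_def y1(2) p1_def)
  qed
  interpret im: spacelike_immersion a "coords c" "\<psi> \<circ> param c" "D c"
    by (rule spacelike_immersion[OF c(1)])
  have "b > 4 * sqrt (fst ((\<psi> \<circ> param c) y1))" using b(1)[OF p1(1)] y1(2) by simp
  from im.no_barrier_minimum[OF refl y1(1) this d(1) min]
  show ?thesis using c(1) y1(1) by blast
qed

end

theorem corollary7:
  fixes a :: real
  assumes "CARD('n::finite) \<ge> 2"
    and "a > 0"
  shows "\<not> (\<exists>(X :: 'm topology) (A :: ('m, 'n) chart set) (\<psi> :: 'm \<Rightarrow> real \<times> (real ^ 'n)).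
      topspace X \<noteq> {} \<and> connected_space X \<and>
      maximal_hypersurface {0<..} (\<lambda>t. sqrt (2 * a * t)) X A \<psi> \<and>
      complete_hypersurface (\<lambda>t. sqrt (2 * a * t)) X A \<psi> \<and>
      bounded_away_from_future_infinity X \<psi>)"
proof (intro notI, elim exE conjE)
  fix X :: "'m topology" and A :: "('m, 'n) chart set" and \<psi> :: "'m \<Rightarrow> real \<times> (real ^ 'n)"
  assume X: "topspace X \<noteq> {}" "connected_space X"
    and maximal: "maximal_hypersurface {0<..} (\<lambda>t. sqrt (2 * a * t)) X A \<psi>"
    and *: "complete_hypersurface (\<lambda>t. sqrt (2 * a * t)) X A \<psi>" "bounded_away_from_future_infinity X \<psi>"
  interpret radiation_hypersurface a X A \<psi>
    by unfold_locales (use maximal \<open>a > 0\<close> in \<open>simp_all add: maximal_hypersurface_def\<close>)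
  show False
    using complete_bounded_not_maximal[OF X *] maximal by (auto simp: maximal_hypersurface_def)
qed

end
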